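(* Let $A$ be a finite étale $\mathbb Z_p$-algebra of rank $d$ with $p>d+1$. Let $\eta\in A^\times$, $P$ the order of $\bar\eta$ in $(A/pA)^\times$, $\eta^P=1+pU$, $\omega=\bar U$. Assume $1,\omega,\dots,\omega^{d-1}$ is an $\mathbb F_p$-basis of $A/pA$ and $\omega\in(A/pA)^\times$. Let $y=\gamma\eta^a\in A$ (with $\gamma\in A$), $x=\bar y$, $c\in\mathbb Z_p$, and suppose $x\ne0$ and $\operatorname{Tr}_{A/pA/\mathbb F_p}(x)=\bar c$. Let $F_c(X)=\operatorname{Tr}_A(y(\eta^P)^X)-c$, $C_0=\operatorname{Tr}_A(y)-c$, $C_m=\operatorname{Tr}_A(yU^m)$ for $m\ge1$, and $s=\min(v_p(C_0),\min_{1\le m\le d}(m+v_p(C_m)))$. Then $s\le d$ and $p^{-s}F_c(X)\in\mathbb Z_p\langle X\rangle$ has nonzero reduction of degree at most $d$; hence $F_c$ has a distinguished Weierstrass factor of degree at most $d$ and at most $d$ zeros in $\mathbb Z_p$ counted with Weierstrass multiplicity. The bound $d$ is sharp, already for split algebras with $\eta\equiv1\pmod p$.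
   Context: $(\eta^P)^X$ is the convergent binomial series; $v_p(0)=+\infty$. *)

theory Defs
  imports
    "HOL-Algebra.UnivPoly"
    "HOL-Algebra.QuotRing"
    "HOL-Algebra.Divisibility"
    "HOL-Algebra.Multiplicative_Group"
    "HOL-Computational_Algebra.Primes"
    "HOL-Library.Extended_Nat"
begin

subsection \<open>The ring of \<open>p\<close>-adic integers\<close>

text \<open>The inverse limit of the rings of integers modulo \<open>p ^ n\<close>: the \<open>n\<close>-th entry of an element
  is its residue modulo \<open>p ^ n\<close>, represented in \<open>{0..<p ^ n}\<close>.\<close>

type_synonym padic = "nat \<Rightarrow> int"

definition Zp :: "nat \<Rightarrow> padic ring" where
  "Zp p = \<lparr>carrier = {x. \<forall>n. x n \<in> {0..<int p ^ n} \<and> x (Suc n) mod int p ^ n = x n},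
           monoid.mult = (\<lambda>x y n. (x n * y n) mod int p ^ n),
           monoid.one = (\<lambda>n. 1 mod int p ^ n),
           ring.zero = (\<lambda>n. 0),
           ring.add = (\<lambda>x y n. (x n + y n) mod int p ^ n)\<rparr>"

lemma cring_Zp:
  assumes "p > 0"
  shows "cring (Zp p)"
proof -
  have md: "(t mod int p ^ Suc n) mod int p ^ n = t mod int p ^ n" for t n
    by (rule mod_mod_cancel) (simp add: le_imp_power_dvd)
  have pos: "0 < int p ^ n" for n using assms by simp
  have neg: "\<exists>y\<in>carrier (Zp p). y \<oplus>\<^bsub>Zp p\<^esub> x = \<zero>\<^bsub>Zp p\<^esub>" if x: "x \<in> carrier (Zp p)" for x
  proof
    show "(\<lambda>n. (- x n) mod int p ^ n) \<in> carrier (Zp p)"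
    proof -
      have "(- x (Suc n)) mod int p ^ n = (- x n) mod int p ^ n" for n
        using x by (metis (mono_tags, lifting) Zp_def mem_Collect_eq mod_minus_eq
            partial_object.select_convs(1))
      then show ?thesis using pos by (simp add: Zp_def md del: power_Suc)
    qed
    show "(\<lambda>n. (- x n) mod int p ^ n) \<oplus>\<^bsub>Zp p\<^esub> x = \<zero>\<^bsub>Zp p\<^esub>"
      by (simp add: Zp_def mod_simps)
  qed
  show ?thesis
  proof (rule cringI)
    show "abelian_group (Zp p)"
    proof (rule abelian_groupI)
      fix x y assume "x \<in> carrier (Zp p)" "y \<in> carrier (Zp p)"
      then show "x \<oplus>\<^bsub>Zp p\<^esub> y \<in> carrier (Zp p)"
        using pos by (simp add: Zp_def md del: power_Suc) (metis mod_add_eq)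
    qed (use pos neg in \<open>auto simp: Zp_def mod_simps ac_simps\<close>)
    show "comm_monoid (Zp p)"
    proof (rule comm_monoidI)
      fix x y assume "x \<in> carrier (Zp p)" "y \<in> carrier (Zp p)"
      then show "x \<otimes>\<^bsub>Zp p\<^esub> y \<in> carrier (Zp p)"
        using pos by (simp add: Zp_def md del: power_Suc) (metis mod_mult_eq)
    qed (use pos in \<open>auto simp: Zp_def mod_simps ac_simps md simp del: power_Suc\<close>)
  qed (auto simp: Zp_def mod_simps algebra_simps)
qed

definition vp :: "nat \<Rightarrow> padic \<Rightarrow> enat" where
  "vp p x = Sup {enat n |n. ([(p ^ n)] \<cdot>\<^bsub>Zp p\<^esub> \<one>\<^bsub>Zp p\<^esub>) divides\<^bsub>Zp p\<^esub> x}"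

definition padic_limit :: "nat \<Rightarrow> ('a, 'b) ring_scheme \<Rightarrow> (nat \<Rightarrow> 'a) \<Rightarrow> 'a" where
  "padic_limit p R f = (THE L. L \<in> carrier R \<and>
     (\<forall>n. \<exists>N. \<forall>m\<ge>N. f m \<ominus>\<^bsub>R\<^esub> L \<in> PIdl\<^bsub>R\<^esub> ([(p ^ n)] \<cdot>\<^bsub>R\<^esub> \<one>\<^bsub>R\<^esub>)))"


subsection \<open>Finite free modules, traces, finite etale algebras\<close>

definition is_basis :: "('r, 's) ring_scheme \<Rightarrow> ('r, 'a, 'm) module_scheme \<Rightarrow> nat \<Rightarrow> (nat \<Rightarrow> 'a) \<Rightarrow> bool"
  where
  "is_basis R M n b \<longleftrightarrow> b \<in> {..<n} \<rightarrow> carrier M \<and>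
     (\<forall>v\<in>carrier M. \<exists>!f. f \<in> {..<n} \<rightarrow>\<^sub>E carrier R \<and> v = (\<Oplus>\<^bsub>M\<^esub>i\<in>{..<n}. f i \<odot>\<^bsub>M\<^esub> b i))"

definition coords :: "('r, 's) ring_scheme \<Rightarrow> ('r, 'a, 'm) module_scheme \<Rightarrow> nat \<Rightarrow> (nat \<Rightarrow> 'a) \<Rightarrow> 'a \<Rightarrow> nat \<Rightarrow> 'r"
  where
  "coords R M n b v =
     (THE f. f \<in> {..<n} \<rightarrow>\<^sub>E carrier R \<and> v = (\<Oplus>\<^bsub>M\<^esub>i\<in>{..<n}. f i \<odot>\<^bsub>M\<^esub> b i))"

text \<open>The trace of multiplication by \<open>x\<close>, computed in an arbitrary basis.\<close>

definition alg_trace :: "('r, 's) ring_scheme \<Rightarrow> ('r, 'a, 'm) module_scheme \<Rightarrow> 'a \<Rightarrow> 'r" where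
  "alg_trace R M x =
     (case (SOME (n, b). is_basis R M n b) of
        (n, b) \<Rightarrow> \<Oplus>\<^bsub>R\<^esub>i\<in>{..<n}. coords R M n b (x \<otimes>\<^bsub>M\<^esub> b i) i)"

definition linear_forms :: "('r, 's) ring_scheme \<Rightarrow> ('r, 'a, 'm) module_scheme \<Rightarrow> ('a \<Rightarrow> 'r) set" where
  "linear_forms R M = {f \<in> carrier M \<rightarrow>\<^sub>E carrier R.
     (\<forall>x\<in>carrier M. \<forall>y\<in>carrier M. f (x \<oplus>\<^bsub>M\<^esub> y) = f x \<oplus>\<^bsub>R\<^esub> f y) \<and>
     (\<forall>c\<in>carrier R. \<forall>x\<in>carrier M. f (c \<odot>\<^bsub>M\<^esub> x) = c \<otimes>\<^bsub>R\<^esub> f x)}"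

text \<open>A finite etale algebra of rank \<open>d\<close> over a local ring \<open>R\<close>, in the form of Lenstra's definition
  (free separable algebra): the module is free of rank \<open>d\<close>, and \<open>x \<mapsto> Tr(x \<cdot> _)\<close> is an isomorphism
  onto the dual module. Over a local base, finitely generated projective modules are free.\<close>

definition finite_etale :: "('r, 's) ring_scheme \<Rightarrow> ('r, 'a, 'm) module_scheme \<Rightarrow> nat \<Rightarrow> bool" where
  "finite_etale R A d \<longleftrightarrow> algebra R A \<and> (\<exists>b. is_basis R A d b) \<and>
     bij_betw (\<lambda>x. \<lambda>y\<in>carrier A. alg_trace R A (x \<otimes>\<^bsub>A\<^esub> y)) (carrier A) (linear_forms R A)"

definition split_algebra :: "('r, 's) ring_scheme \<Rightarrow> nat \<Rightarrow> ('r, nat \<Rightarrow> 'r) module" where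
  "split_algebra R d = \<lparr>carrier = {..<d} \<rightarrow>\<^sub>E carrier R,
     monoid.mult = (\<lambda>x y. \<lambda>i\<in>{..<d}. x i \<otimes>\<^bsub>R\<^esub> y i),
     monoid.one = (\<lambda>i\<in>{..<d}. \<one>\<^bsub>R\<^esub>),
     ring.zero = (\<lambda>i\<in>{..<d}. \<zero>\<^bsub>R\<^esub>),
     ring.add = (\<lambda>x y. \<lambda>i\<in>{..<d}. x i \<oplus>\<^bsub>R\<^esub> y i),
     smult = (\<lambda>c x. \<lambda>i\<in>{..<d}. c \<otimes>\<^bsub>R\<^esub> x i)\<rparr>"


subsection \<open>Reduction modulo \<open>p\<close>\<close>

definition p_ideal :: "nat \<Rightarrow> ('a, 'b) ring_scheme \<Rightarrow> 'a set" where
  "p_ideal p R = PIdl\<^bsub>R\<^esub> ([p] \<cdot>\<^bsub>R\<^esub> \<one>\<^bsub>R\<^esub>)"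

definition reduce :: "nat \<Rightarrow> ('a, 'b) ring_scheme \<Rightarrow> 'a \<Rightarrow> 'a set" where
  "reduce p R x = p_ideal p R +>\<^bsub>R\<^esub> x"

definition Fp :: "nat \<Rightarrow> padic set ring" where
  "Fp p = Zp p Quot p_ideal p (Zp p)"

text \<open>The ring \<open>A/pA\<close> with its structure of \<open>Fp\<close>-algebra; scalar multiplication of cosets is defined
  like \<open>rcoset_mult\<close>.\<close>

definition quot_algebra :: "nat \<Rightarrow> (padic, 'a, 'm) module_scheme \<Rightarrow> (padic set, 'a set) module" where
  "quot_algebra p A = ring.extend (A Quot p_ideal p A)
     (module.fields (\<lambda>C X. \<Union>c\<in>C. \<Union>x\<in>X. reduce p A (c \<odot>\<^bsub>A\<^esub> x)))"


subsection \<open>Restricted power series over the \<open>p\<close>-adic integers\<close>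

text \<open>The algebra of power series, given by their coefficients, whose coefficients tend to 0.
  Polynomials (\<open>UP\<close>) are represented in the same way, but the operations of \<open>UP\<close> are undefined
  outside of the polynomials.\<close>

definition tate :: "nat \<Rightarrow> (padic, nat \<Rightarrow> padic) module" where
  "tate p = \<lparr>carrier = {f. range f \<subseteq> carrier (Zp p) \<and>
       (\<forall>n. \<exists>N. \<forall>k\<ge>N. ([(p ^ n)] \<cdot>\<^bsub>Zp p\<^esub> \<one>\<^bsub>Zp p\<^esub>) divides\<^bsub>Zp p\<^esub> f k)},
     monoid.mult = (\<lambda>f g k. \<Oplus>\<^bsub>Zp p\<^esub>i\<in>{..k}. f i \<otimes>\<^bsub>Zp p\<^esub> g (k - i)),
     monoid.one = (\<lambda>k. if k = 0 then \<one>\<^bsub>Zp p\<^esub> else \<zero>\<^bsub>Zp p\<^esub>),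
     ring.zero = (\<lambda>k. \<zero>\<^bsub>Zp p\<^esub>),
     ring.add = (\<lambda>f g k. f k \<oplus>\<^bsub>Zp p\<^esub> g k),
     smult = (\<lambda>a f k. a \<otimes>\<^bsub>Zp p\<^esub> f k)\<rparr>"

definition tate_eval :: "nat \<Rightarrow> (nat \<Rightarrow> padic) \<Rightarrow> padic \<Rightarrow> padic" where
  "tate_eval p f z =
     padic_limit p (Zp p) (\<lambda>N. \<Oplus>\<^bsub>Zp p\<^esub>k\<in>{..N}. f k \<otimes>\<^bsub>Zp p\<^esub> z [^]\<^bsub>Zp p\<^esub> k)"

definition tate_zeros :: "nat \<Rightarrow> (nat \<Rightarrow> padic) \<Rightarrow> padic set" where
  "tate_zeros p f = {z \<in> carrier (Zp p). tate_eval p f z = \<zero>\<^bsub>Zp p\<^esub>}"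

definition reduce_series :: "nat \<Rightarrow> (nat \<Rightarrow> padic) \<Rightarrow> nat \<Rightarrow> padic set" where
  "reduce_series p f = (\<lambda>k. reduce p (Zp p) (f k))"

definition lin_factor :: "('a, 'b) ring_scheme \<Rightarrow> 'a \<Rightarrow> nat \<Rightarrow> 'a" where
  "lin_factor R z = monom (UP R) \<one>\<^bsub>R\<^esub> 1 \<ominus>\<^bsub>UP R\<^esub> monom (UP R) z 0"

definition root_mult :: "('a, 'b) ring_scheme \<Rightarrow> (nat \<Rightarrow> 'a) \<Rightarrow> 'a \<Rightarrow> nat" where
  "root_mult R W z = (GREATEST n. (lin_factor R z [^]\<^bsub>UP R\<^esub> n) divides\<^bsub>UP R\<^esub> W)"

text \<open>Weierstrass preparation in the Tate algebra (not in the ring of all formal power series):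
  the distinguished factor is a monic polynomial with integral coefficients, and the cofactor is a
  unit of the Tate algebra up to a power of \<open>p\<close>. The lower coefficients need not be divisible by
  \<open>p\<close>, so that the factor carries all zeros in the closed unit disc.\<close>

definition weierstrass_factor :: "nat \<Rightarrow> (nat \<Rightarrow> padic) \<Rightarrow> (nat \<Rightarrow> padic) \<Rightarrow> bool" where
  "weierstrass_factor p f W \<longleftrightarrow>
     W \<in> carrier (UP (Zp p)) \<and> coeff (UP (Zp p)) W (deg (Zp p) W) = \<one>\<^bsub>Zp p\<^esub> \<and>
     (\<exists>s. \<exists>u\<in>Units (tate p).
        f = ([(p ^ s)] \<cdot>\<^bsub>Zp p\<^esub> \<one>\<^bsub>Zp p\<^esub>) \<odot>\<^bsub>tate p\<^esub> (u \<otimes>\<^bsub>tate p\<^esub> W))"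

text \<open>The number of zeros, each counted with its multiplicity as a root of the Weierstrass factor \<open>W\<close>.\<close>

definition zero_count :: "nat \<Rightarrow> (nat \<Rightarrow> padic) \<Rightarrow> (nat \<Rightarrow> padic) \<Rightarrow> nat" where
  "zero_count p f W = (\<Sum>z\<in>tate_zeros p f. root_mult (Zp p) W z)"


subsection \<open>The binomial series and the trace series\<close>

text \<open>The polynomial \<open>p ^ m * binom(X, m)\<close>, which has \<open>p\<close>-adically integral coefficients.\<close>

definition scaled_binomial :: "nat \<Rightarrow> nat \<Rightarrow> nat \<Rightarrow> padic" where
  "scaled_binomial p m = (THE B. B \<in> carrier (UP (Zp p)) \<and>
     [(fact m :: nat)] \<cdot>\<^bsub>UP (Zp p)\<^esub> B =
     [(p ^ m)] \<cdot>\<^bsub>UP (Zp p)\<^esub> (\<Otimes>\<^bsub>UP (Zp p)\<^esub>i\<in>{..<m}. lin_factor (Zp p) ([i] \<cdot>\<^bsub>Zp p\<^esub> \<one>\<^bsub>Zp p\<^esub>)))"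

text \<open>The series \<open>(1 + p U) ^ X\<close>, i.e. the sum over \<open>m\<close> of \<open>binom(X, m) * (p U) ^ m\<close>, as a power
  series in \<open>X\<close> over \<open>A\<close>: the coefficient of \<open>X ^ k\<close> is the limit of the coefficients of the
  partial sums.\<close>

definition binomial_series :: "nat \<Rightarrow> (padic, 'a, 'm) module_scheme \<Rightarrow> 'a \<Rightarrow> nat \<Rightarrow> 'a" where
  "binomial_series p A U k = padic_limit p A
     (\<lambda>N. \<Oplus>\<^bsub>A\<^esub>m\<in>{..N}. coeff (UP (Zp p)) (scaled_binomial p m) k \<odot>\<^bsub>A\<^esub> (U [^]\<^bsub>A\<^esub> m))"

definition trace_series :: "nat \<Rightarrow> (padic, 'a, 'm) module_scheme \<Rightarrow> 'a \<Rightarrow> 'a \<Rightarrow> padic \<Rightarrow> nat \<Rightarrow> padic" where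
  "trace_series p A U y c = (\<lambda>k. alg_trace (Zp p) A (y \<otimes>\<^bsub>A\<^esub> binomial_series p A U k)
     \<ominus>\<^bsub>Zp p\<^esub> (if k = 0 then c else \<zero>\<^bsub>Zp p\<^esub>))"

definition trace_coeff :: "nat \<Rightarrow> (padic, 'a, 'm) module_scheme \<Rightarrow> 'a \<Rightarrow> 'a \<Rightarrow> padic \<Rightarrow> nat \<Rightarrow> padic" where
  "trace_coeff p A U y c m = (if m = 0 then alg_trace (Zp p) A y \<ominus>\<^bsub>Zp p\<^esub> c
     else alg_trace (Zp p) A (y \<otimes>\<^bsub>A\<^esub> U [^]\<^bsub>A\<^esub> m))"

definition min_valuation :: "nat \<Rightarrow> nat \<Rightarrow> (nat \<Rightarrow> padic) \<Rightarrow> enat" where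
  "min_valuation p d C = Min (insert (vp p (C 0)) ((\<lambda>m. enat m + vp p (C m)) ` {1..d}))"

locale trace_datum =
  fixes p d :: nat
    and A :: "(padic, 'a) module"
    and \<eta> :: 'a and P :: nat and U \<gamma> :: 'a and a :: int and y :: 'a and c :: padic
  assumes prime_p: "prime p"
    and p_gt: "p > d + 1"
    and etale: "finite_etale (Zp p) A d"
    and unit_eta: "\<eta> \<in> Units A"
    and P_eq: "P = group.ord (units_of (quot_algebra p A)) (reduce p A \<eta>)"
    and U_closed: "U \<in> carrier A"
    and eta_pow: "\<eta> [^]\<^bsub>A\<^esub> P = \<one>\<^bsub>A\<^esub> \<oplus>\<^bsub>A\<^esub> [p] \<cdot>\<^bsub>A\<^esub> U"
    and basis: "is_basis (Fp p) (quot_algebra p A) d (\<lambda>i. reduce p A U [^]\<^bsub>quot_algebra p A\<^esub> i)"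
    and unit_omega: "reduce p A U \<in> Units (quot_algebra p A)"
    and gamma_closed: "\<gamma> \<in> carrier A"
    and y_eq: "y = \<gamma> \<otimes>\<^bsub>A\<^esub> \<eta> [^]\<^bsub>A\<^esub> a"
    and c_closed: "c \<in> carrier (Zp p)"
    and x_nonzero: "reduce p A y \<noteq> \<zero>\<^bsub>quot_algebra p A\<^esub>"
    and trace_x: "alg_trace (Fp p) (quot_algebra p A) (reduce p A y) = reduce p (Zp p) c"

end

theory Submission
  imports
    Defs
    "HOL-Computational_Algebra.Polynomial"
    "HOL-Number_Theory.Cong"
begin

text \<open>Expanding the binomial series, \<open>F\<^sub>c = \<Sum>\<^sub>m C\<^sub>m p ^ m binom(X, m)\<close>. The trace form of \<open>A / p A\<close> is
  nondegenerate and \<open>\<omega>, \<dots>, \<omega> ^ d\<close> is a basis, so some \<open>C\<^sub>m\<close> with \<open>1 \<le> m \<le> d\<close> is a unit and \<open>s \<le> d\<close>.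
  By Legendre's bound on the \<open>p\<close>-part of \<open>m!\<close> the terms with \<open>m > d\<close> are divisible by \<open>p ^ (d + 1)\<close>, so
  \<open>p ^ -s F\<^sub>c\<close> reduces to a nonzero combination of the falling factorials of degree at most \<open>d\<close>.
  Weierstrass preparation is a Hensel lift of the factorization (constant) * (monic polynomial) of this
  reduction, and the zeros of the series are the roots of the lifted monic factor.

  For the sharpness take \<open>U = (1, \<dots>, d)\<close> and \<open>y\<^sub>j = (-1) ^ j binom(d, j + 1)\<close> for \<open>j < d\<close>: since a \<open>d\<close>-th
  difference kills polynomials of degree less than \<open>d\<close>, all \<open>C\<^sub>m\<close> with \<open>m < d\<close> vanish (for \<open>c = Tr y\<close>),
  and \<open>0, \<dots>, d - 1\<close> are zeros of \<open>F\<^sub>c\<close>.\<close>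

subsection \<open>Arithmetic of the \<open>p\<close>-adic integers\<close>

text \<open>The decisive numbers are the valuations of p^m / m!. They equal m for m < p and are at
  least p - 1 for m >= p, with equality at m = p; so p > d + 1 gives every term beyond d the factor
  p^(d + 1), one power more than p^s with s <= d can absorb. The unit among the C_m has to be sought
  at m >= 1, because C_0 is divisible by p by the condition on Tr(x). The power basis of A / pA
  starts at exponent 0, and the invertibility of \<open>\<omega>\<close> is what shifts it to the
  exponents 1, ..., d. Nondegeneracy modulo p is derived from perfectness of the trace form over
  Z_p: a form with values in p Z_p can be divided by p and then represented. Analysis is made finite
  throughout. Entry n of a p-adic integer is its residue modulo p^n, so divisibility by p^n is the
  vanishing of one entry, and the series has an explicit rate of convergence: p > 2 gives p^m / m! a
  valuation of at least m / 2. Each congruence thus concerns integer polynomials. The degree e of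
  the reduction is the last index with a unit coefficient, as falling factorials are monic of
  increasing degree; it may be less than d.\<close>

definition padic_of_int :: "nat \<Rightarrow> int \<Rightarrow> padic" where
  "padic_of_int p k = (\<lambda>n. k mod int p ^ n)"

locale padic_integers =
  fixes p :: nat
  assumes prime_p: "prime p"
begin

lemma p_pos [simp]: "0 < p"
  using prime_p prime_gt_0_nat by simp

lemma p_nonzero [simp]: "p \<noteq> 0"
  using p_pos by simp

lemma p_pow_pos [simp]: "0 < int p ^ n"
  by simp

lemma p_gt_1: "int p > 1"
  using prime_p prime_gt_1_nat by simp

sublocale Zp: cring "Zp p"
  using prime_p prime_gt_0_nat by (intro cring_Zp) blast

lemma carrier_iff:
  "x \<in> carrier (Zp p) \<longleftrightarrow> (\<forall>n. x n \<in> {0..<int p ^ n} \<and> x (Suc n) mod int p ^ n = x n)"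
  by (simp add: Zp_def)

lemma nth_mod_le:
  assumes "x \<in> carrier (Zp p)" and "m \<le> n"
  shows "x n mod int p ^ m = x m"
  using assms(2)
proof (induction n rule: dec_induct)
  case base
  show ?case using assms(1) by (simp add: carrier_iff)
next
  case (step n)
  have "x (Suc n) mod int p ^ m = (x (Suc n) mod int p ^ n) mod int p ^ m"
    using step.hyps by (intro mod_mod_cancel[symmetric]) (simp add: le_imp_power_dvd)
  then show ?case using step.IH assms(1) by (simp add: carrier_iff)
qed

lemma nth_mod [simp]: "x \<in> carrier (Zp p) \<Longrightarrow> x n mod int p ^ n = x n"
  by (rule nth_mod_le) auto

lemma nth_0: "x \<in> carrier (Zp p) \<Longrightarrow> x 0 = 0"
  by (metis mod_by_1 nth_mod power_0)

lemma carrierI: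
  assumes "\<And>n. [f (Suc n) = f n] (mod int p ^ n)"
  shows "(\<lambda>n. f n mod int p ^ n) \<in> carrier (Zp p)"
proof -
  have "f (Suc n) mod int p ^ Suc n mod int p ^ n = f n mod int p ^ n" for n
    using assms[of n] by (subst mod_mod_cancel) (auto simp: cong_def)
  then show ?thesis by (simp add: carrier_iff del: power_Suc)
qed

lemma nth_mult: "(x \<otimes>\<^bsub>Zp p\<^esub> y) n = x n * y n mod int p ^ n"
  and nth_add: "(x \<oplus>\<^bsub>Zp p\<^esub> y) n = (x n + y n) mod int p ^ n"
  and nth_zero [simp]: "\<zero>\<^bsub>Zp p\<^esub> n = 0"
  and nth_one: "\<one>\<^bsub>Zp p\<^esub> n = 1 mod int p ^ n"
  by (simp_all add: Zp_def)

lemma nth_a_inv: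
  assumes x: "x \<in> carrier (Zp p)"
  shows "(\<ominus>\<^bsub>Zp p\<^esub> x) n = (- x n) mod int p ^ n"
proof -
  have "x \<oplus>\<^bsub>Zp p\<^esub> (\<ominus>\<^bsub>Zp p\<^esub> x) = \<zero>\<^bsub>Zp p\<^esub>" using x by (rule Zp.r_neg)
  then have "(x n + (\<ominus>\<^bsub>Zp p\<^esub> x) n) mod int p ^ n = 0"
    by (metis nth_add nth_zero)
  then have "[(\<ominus>\<^bsub>Zp p\<^esub> x) n = - x n] (mod int p ^ n)"
    by (simp add: cong_iff_dvd_diff mod_eq_0_iff_dvd add.commute)
  then show ?thesis using x by (simp add: cong_def)
qed

lemma nth_minus:
  assumes "x \<in> carrier (Zp p)" "y \<in> carrier (Zp p)"
  shows "(x \<ominus>\<^bsub>Zp p\<^esub> y) n = (x n - y n) mod int p ^ n"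
  using assms by (simp add: a_minus_def nth_add nth_a_inv mod_simps)

lemma nth_minus_eq_0_iff:
  assumes "x \<in> carrier (Zp p)" "y \<in> carrier (Zp p)"
  shows "(x \<ominus>\<^bsub>Zp p\<^esub> y) n = 0 \<longleftrightarrow> x n = y n"
proof -
  have "(x n - y n) mod int p ^ n = 0 \<longleftrightarrow> x n mod int p ^ n = y n mod int p ^ n"
    by (simp only: mod_eq_dvd_iff mod_eq_0_iff_dvd)
  then show ?thesis unfolding nth_minus[OF assms] nth_mod[OF assms(1)] nth_mod[OF assms(2)] .
qed

lemma nth_finsum:
  assumes "f \<in> S \<rightarrow> carrier (Zp p)" "finite S"
  shows "(\<Oplus>\<^bsub>Zp p\<^esub>i\<in>S. f i) n = (\<Sum>i\<in>S. f i n) mod int p ^ n"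
  using assms(2,1)
  by (induction S rule: finite_induct) (simp_all add: nth_add Pi_iff mod_simps)

lemma nth_pow: "x \<in> carrier (Zp p) \<Longrightarrow> (x [^]\<^bsub>Zp p\<^esub> (k::nat)) n = x n ^ k mod int p ^ n"
  by (induction k) (simp_all add: nth_one nth_mult mod_simps mult.commute)

lemma nth_add_pow: "x \<in> carrier (Zp p) \<Longrightarrow> ([(k::nat)] \<cdot>\<^bsub>Zp p\<^esub> x) n = int k * x n mod int p ^ n"
  by (induction k) (simp_all add: nth_add mod_simps algebra_simps)

lemma of_int_closed [simp]: "padic_of_int p k \<in> carrier (Zp p)"
  unfolding padic_of_int_def by (rule carrierI) simp

lemma nth_of_int: "padic_of_int p k n = k mod int p ^ n"
  by (simp add: padic_of_int_def)

lemma of_int_add: "padic_of_int p (a + b) = padic_of_int p a \<oplus>\<^bsub>Zp p\<^esub> padic_of_int p b"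
  and of_int_mult: "padic_of_int p (a * b) = padic_of_int p a \<otimes>\<^bsub>Zp p\<^esub> padic_of_int p b"
  and of_int_0: "padic_of_int p 0 = \<zero>\<^bsub>Zp p\<^esub>"
  and of_int_1: "padic_of_int p 1 = \<one>\<^bsub>Zp p\<^esub>"
  by (auto simp: nth_of_int nth_add nth_mult nth_one mod_simps)

lemma of_int_uminus: "padic_of_int p (- a) = \<ominus>\<^bsub>Zp p\<^esub> padic_of_int p a"
  by (auto simp: nth_of_int nth_a_inv mod_simps)

lemma of_int_sum:
  "finite S \<Longrightarrow> padic_of_int p (\<Sum>i\<in>S. f i) = (\<Oplus>\<^bsub>Zp p\<^esub>i\<in>S. padic_of_int p (f i))"
  by (induction S rule: finite_induct) (simp_all add: of_int_0 of_int_add)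

lemma of_int_nat: "[(k::nat)] \<cdot>\<^bsub>Zp p\<^esub> \<one>\<^bsub>Zp p\<^esub> = padic_of_int p (int k)"
  by (auto simp: nth_add_pow nth_of_int nth_one mod_simps)

text \<open>The workhorse for valuations: divisibility becomes the vanishing of a single entry.
  Entry n of the quotient needs k further digits of x, hence its construction from
  \<open>x (n + k)\<close>.\<close>

lemma p_pow_divides_iff:
  assumes x: "x \<in> carrier (Zp p)"
  shows "padic_of_int p (int p ^ k) divides\<^bsub>Zp p\<^esub> x \<longleftrightarrow> x k = 0"
proof
  assume "padic_of_int p (int p ^ k) divides\<^bsub>Zp p\<^esub> x"
  then show "x k = 0" by (auto simp: factor_def nth_mult nth_of_int)
next
  assume xk: "x k = 0"
  define y where "y = (\<lambda>n. x (n + k) div int p ^ k)"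
  have dv: "int p ^ k * y n = x (n + k)" for n
    using nth_mod_le[OF x, of k "n + k"] xk by (simp add: y_def mod_eq_0_iff_dvd)
  have lt: "int p ^ k * y n < int p ^ k * int p ^ n" for n
  proof -
    have "x (n + k) < int p ^ (n + k)" using x by (simp add: carrier_iff)
    then show ?thesis unfolding dv by (simp add: power_add mult.commute)
  qed
  have rng: "0 \<le> y n \<and> y n < int p ^ n" for n
  proof
    have "0 \<le> x (n + k)" using x by (simp add: carrier_iff)
    then show "0 \<le> y n" unfolding y_def by (intro pos_imp_zdiv_nonneg_iff[THEN iffD2]) simp
    show "y n < int p ^ n" by (rule mult_left_less_imp_less[OF lt]) simp
  qed
  have "int p ^ k * (y (Suc n) mod int p ^ n) = int p ^ k * y n" for n
  proof -
    have "int p ^ k * (y (Suc n) mod int p ^ n) = (int p ^ k * y (Suc n)) mod (int p ^ k * int p ^ n)"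
      by (rule mult_mod_right)
    also have "\<dots> = x (Suc n + k) mod int p ^ (n + k)"
      unfolding dv by (simp add: power_add mult.commute)
    also have "\<dots> = x (n + k)" by (rule nth_mod_le[OF x]) simp
    finally show ?thesis by (simp add: dv)
  qed
  then have "y (Suc n) mod int p ^ n = y n" for n by (simp add: mult_cancel_left)
  then have y: "y \<in> carrier (Zp p)" using rng by (simp add: carrier_iff)
  have "x = padic_of_int p (int p ^ k) \<otimes>\<^bsub>Zp p\<^esub> y"
  proof
    fix n
    show "x n = (padic_of_int p (int p ^ k) \<otimes>\<^bsub>Zp p\<^esub> y) n"
      using nth_mod_le[OF x, of n "n + k"] by (simp add: nth_mult nth_of_int mod_simps dv)
  qed
  then show "padic_of_int p (int p ^ k) divides\<^bsub>Zp p\<^esub> x" using y by (auto simp: factor_def)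
qed

lemma p_pow_divE:
  assumes "x \<in> carrier (Zp p)" "x k = 0"
  obtains y where "y \<in> carrier (Zp p)" "x = padic_of_int p (int p ^ k) \<otimes>\<^bsub>Zp p\<^esub> y"
  using p_pow_divides_iff[OF assms(1), of k] assms(2) by (auto simp: factor_def)

text \<open>Valuations add. Entry i is nonzero iff the valuation is below i, so the product has
  valuation at most i + j - 2 and its entry i + j survives.\<close>

lemma integral:
  assumes x: "x \<in> carrier (Zp p)" and y: "y \<in> carrier (Zp p)"
    and "x i \<noteq> 0" "y j \<noteq> 0"
  shows "(x \<otimes>\<^bsub>Zp p\<^esub> y) (i + j) \<noteq> 0"
proof
  assume "(x \<otimes>\<^bsub>Zp p\<^esub> y) (i + j) = 0"
  then have dv: "int p ^ (i + j) dvd x (i + j) * y (i + j)"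
    by (simp add: nth_mult mod_eq_0_iff_dvd)
  have *: "\<not> int p ^ i dvd x (i + j)" "\<not> int p ^ j dvd y (i + j)"
    using assms nth_mod_le[OF x, of i "i + j"] nth_mod_le[OF y, of j "i + j"]
    by (auto simp: mod_eq_0_iff_dvd[symmetric])
  then have "i > 0" "j > 0" by (auto intro: gr0I)
  \<comment> \<open>One power is given away on purpose: in \<open>prime_elem_power_dvd_cases\<close>
    the exponents i and j add up to one more than the given exponent.\<close>
  then have "int p ^ (i + j - 1) dvd x (i + j) * y (i + j)"
    using dv by (elim dvd_trans[rotated]) (simp add: le_imp_power_dvd)
  moreover have "prime_elem (int p)" using prime_p by simp
  ultimately show False
    using * \<open>i > 0\<close> \<open>j > 0\<close> prime_elem_power_dvd_cases[of "int p" "i+j-1" "x (i+j)" "y (i+j)" i j]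
    by auto
qed

sublocale Zp: "domain" "Zp p"
proof
  have "\<one>\<^bsub>Zp p\<^esub> 1 \<noteq> \<zero>\<^bsub>Zp p\<^esub> 1" using p_gt_1 by (simp add: nth_one)
  then show "\<one>\<^bsub>Zp p\<^esub> \<noteq> \<zero>\<^bsub>Zp p\<^esub>" by auto
next
  fix a b assume *: "a \<otimes>\<^bsub>Zp p\<^esub> b = \<zero>\<^bsub>Zp p\<^esub>" "a \<in> carrier (Zp p)" "b \<in> carrier (Zp p)"
  show "a = \<zero>\<^bsub>Zp p\<^esub> \<or> b = \<zero>\<^bsub>Zp p\<^esub>"
  proof (rule ccontr)
    assume "\<not> ?thesis"
    then obtain i j where "a i \<noteq> 0" "b j \<noteq> 0" by (auto simp: fun_eq_iff)
    then show False using integral[of a b i j] * by simp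
  qed
qed

text \<open>The entry with index |k| already detects k, because |k| < p^|k|.\<close>

lemma of_int_nonzero: "k \<noteq> 0 \<Longrightarrow> padic_of_int p k \<noteq> \<zero>\<^bsub>Zp p\<^esub>"
proof
  assume k: "k \<noteq> 0" and "padic_of_int p k = \<zero>\<^bsub>Zp p\<^esub>"
  then have "padic_of_int p k (nat \<bar>k\<bar>) = 0" by simp
  then have "int p ^ nat \<bar>k\<bar> dvd k" by (simp add: nth_of_int mod_eq_0_iff_dvd)
  then have "int p ^ nat \<bar>k\<bar> \<le> \<bar>k\<bar>" using k by (simp add: zdvd_imp_le)
  moreover have "nat \<bar>k\<bar> < p ^ nat \<bar>k\<bar>"
    using prime_p prime_gt_1_nat by (intro power_gt_expt) auto
  then have "int (nat \<bar>k\<bar>) < int (p ^ nat \<bar>k\<bar>)" by (simp only: of_nat_less_iff)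
  then have "\<bar>k\<bar> < int p ^ nat \<bar>k\<bar>" by simp
  ultimately show False by simp
qed

text \<open>An element that is nonzero modulo p is coprime to p in every positive entry, hence
  invertible modulo each p^n; uniqueness of inverses modulo p^n makes the chosen inverses
  compatible.\<close>

lemma Units_iff: "x \<in> Units (Zp p) \<longleftrightarrow> x \<in> carrier (Zp p) \<and> x 1 \<noteq> 0"
proof
  assume "x \<in> Units (Zp p)"
  then obtain y where "x \<in> carrier (Zp p)" "y \<in> carrier (Zp p)" "x \<otimes>\<^bsub>Zp p\<^esub> y = \<one>\<^bsub>Zp p\<^esub>"
    by (auto simp: Units_def)
  moreover from this have "x 1 * y 1 mod int p = 1"
    using p_gt_1 by (metis mod_pos_pos_trivial nth_mult nth_one power_one_right zero_le_one)
  ultimately show "x \<in> carrier (Zp p) \<and> x 1 \<noteq> 0" by auto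
next
  assume "x \<in> carrier (Zp p) \<and> x 1 \<noteq> 0"
  then have x: "x \<in> carrier (Zp p)" and x1: "x 1 \<noteq> 0" by auto
  have co: "coprime (x n) (int p ^ n)" for n
  proof (cases "n = 0")
    case False
    then have "x n mod int p = x 1" using nth_mod_le[OF x, of 1 n] by simp
    then have "\<not> int p dvd x n" using x1 by (auto simp: mod_eq_0_iff_dvd[symmetric])
    then have "coprime (int p) (x n)" using prime_p by (intro prime_imp_coprime) auto
    then show ?thesis by (simp add: coprime_commute)
  qed simp
  have "\<exists>y. [x n * y = 1] (mod int p ^ n)" for n
    using cong_solve_coprime_int[OF co] by auto
  then obtain y where y: "\<And>n. [x n * y n = 1] (mod int p ^ n)" by metis
  define z where "z = (\<lambda>n. y n mod int p ^ n)"
  have "[y (Suc n) = y n] (mod int p ^ n)" for n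
  proof -
    have "[x n = x (Suc n)] (mod int p ^ n)" using x by (simp add: cong_def carrier_iff)
    then have "[x n * y (Suc n) = x (Suc n) * y (Suc n)] (mod int p ^ n)"
      by (rule cong_scalar_right)
    also have "[x (Suc n) * y (Suc n) = 1] (mod int p ^ n)"
      using y[of "Suc n"] by (rule cong_dvd_modulus) simp
    also have "[1 = x n * y n] (mod int p ^ n)" using y by (rule cong_sym)
    finally show ?thesis using co by (simp add: cong_mult_lcancel)
  qed
  then have z: "z \<in> carrier (Zp p)" unfolding z_def by (rule carrierI)
  have "x \<otimes>\<^bsub>Zp p\<^esub> z = \<one>\<^bsub>Zp p\<^esub>"
    using y by (auto simp: z_def nth_mult nth_one mod_simps cong_def)
  then show "x \<in> Units (Zp p)" using x z Zp.m_comm[OF x z] by (auto simp: Units_def)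
qed

text \<open>The exponents n with \<open>x n = 0\<close> form an initial segment of the naturals, so
  comparing the supremum with k only requires entry k. For x = 0 the segment is everything and the
  valuation is infinite.\<close>

lemma vp_ge_iff:
  assumes x: "x \<in> carrier (Zp p)"
  shows "enat k \<le> vp p x \<longleftrightarrow> x k = 0"
proof
  assume "x k = 0"
  then show "enat k \<le> vp p x"
    unfolding vp_def of_int_nat of_nat_power using p_pow_divides_iff[OF x]
    by (intro Sup_upper) auto
next
  assume le: "enat k \<le> vp p x"
  show "x k = 0"
  proof (rule ccontr)
    assume nz: "x k \<noteq> 0"
    then have k: "k > 0" using nth_0[OF x] by (auto intro: gr0I)
    have "vp p x \<le> enat (k - 1)"
      unfolding vp_def of_int_nat of_nat_power p_pow_divides_iff[OF x]
    proof (rule Sup_least)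
      fix e assume "e \<in> {enat n |n. x n = 0}"
      then obtain n where n: "e = enat n" "x n = 0" by auto
      have "n < k" using nth_mod_le[OF x, of k n] n(2) nz by (cases "k \<le> n") auto
      then show "e \<le> enat (k - 1)" using n by simp
    qed
    then have "enat k \<le> enat (k - 1)" using le by (rule order_trans[rotated])
    then show False using k by simp
  qed
qed

end

subsection \<open>Weierstrass preparation\<close>

lemma sum_mod_cong:
  fixes m :: int
  assumes "\<And>i. i \<in> S \<Longrightarrow> f i mod m = g i mod m"
  shows "sum f S mod m = sum g S mod m"
  using cong_sum[of S f g m] assms by (simp add: cong_def)

lemma (in cring) cgenideal_iff_divides:
  assumes a: "a \<in> carrier R"
  shows "x \<in> PIdl a \<longleftrightarrow> a divides x"
proof
  assume "x \<in> PIdl a"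
  then obtain y where "y \<in> carrier R" "x = y \<otimes> a" by (auto simp: cgenideal_def)
  then show "a divides x" using m_comm[OF a] by (auto simp: factor_def)
next
  assume "a divides x"
  then obtain y where "y \<in> carrier R" "x = a \<otimes> y" by (auto simp: factor_def)
  then show "x \<in> PIdl a" using m_comm[OF a] by (auto simp: cgenideal_def)
qed

text \<open>Hensel lifting without Bezout coefficients: modulo q the cofactor u is the constant c,
  so only a division by W is required. With error h = (g - u W) / q^n, divide c' h = W s + b and
  correct u by q^n c s and W by q^n b; the new error is q^n times a multiple of q, since 1 - c c'
  and u - c are such multiples. The bound deg b < deg W preserves the degree and the leading
  coefficient of W.\<close>

lemma hensel_step:
  fixes g u W :: "int poly" and q c c' :: int
  assumes n: "n \<ge> 1" and g: "[:q ^ n:] dvd g - u * W" and u: "[:q:] dvd u - [:c:]"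
    and c: "[:q:] dvd 1 - [:c * c':]" and W: "lead_coeff W = 1"
  obtains u' W' where "[:q ^ n:] dvd u' - u" "[:q ^ n:] dvd W' - W"
    "degree W' = degree W" "lead_coeff W' = 1" "[:q ^ Suc n:] dvd g - u' * W'"
proof -
  obtain h where h: "g - u * W = [:q ^ n:] * h" using g by (elim dvdE)
  obtain s b where "pseudo_divmod ([:c':] * h) W = (s, b)" by fastforce
  moreover have "W \<noteq> 0" using W by auto
  ultimately have s: "[:c':] * h = W * s + b" and b: "b = 0 \<or> degree b < degree W"
    using pseudo_divmod[of W "[:c':] * h" s b] W by auto
  define u' where "u' = u + [:q ^ n:] * ([:c:] * s)"
  define W' where "W' = W + [:q ^ n:] * b"
  have "[:q ^ n:] * b = 0 \<or> degree ([:q ^ n:] * b) < degree W"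
    using b by (auto simp: smult_conv_map_poly[symmetric] intro: le_less_trans[OF degree_smult_le])
  moreover have "degree (W + r) = degree W \<and> lead_coeff (W + r) = 1" if "r = 0 \<or> degree r < degree W" for r
    using that W by (auto simp: degree_add_eq_left coeff_eq_0)
  ultimately have "degree W' = degree W" "lead_coeff W' = 1" unfolding W'_def by blast+
  moreover have "g - u' * W' = [:q ^ n:] * ((1 - [:c * c':]) * h - (u - [:c:]) * b
      - [:q ^ n:] * ([:c:] * s * b))"
  proof -
    have "g - u' * W' = [:q ^ n:] * h - [:q ^ n:] * (u * b + [:c:] * (W * s) + [:q ^ n:] * ([:c:] * s * b))"
    proof -
      have "g - (u + Q * (C * s)) * (W + Q * b) = Q * h - Q * (u * b + C * (W * s) + Q * (C * s * b))"
        if "g - u * W = Q * h" for Q C :: "int poly"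
      proof -
        have "g = u * W + Q * h" using that by (simp add: diff_eq_eq add.commute)
        then show ?thesis by (simp add: algebra_simps)
      qed
      then show ?thesis using h unfolding u'_def W'_def .
    qed
    also have "W * s = [:c':] * h - b" using s by simp
    also have "[:q ^ n:] * h - [:q ^ n:] * (u * b + [:c:] * ([:c':] * h - b) + [:q ^ n:] * ([:c:] * s * b))
      = [:q ^ n:] * ((1 - [:c:] * [:c':]) * h - (u - [:c:]) * b - [:q ^ n:] * ([:c:] * s * b))"
    proof -
      have "Q * h - Q * (u * b + C * (C' * h - b) + Q * (C * s * b))
        = Q * ((1 - C * C') * h - (u - C) * b - Q * (C * s * b))" for Q C C' :: "int poly"
        by (simp add: algebra_simps)
      then show ?thesis .
    qed
    finally show ?thesis by (simp add: mult.commute)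
  qed
  moreover have "[:q ^ Suc n:] dvd \<dots>"
  proof -
    \<comment> \<open>Here n >= 1 matters: the product of the two corrections carries q^(2 n), which
      has to reach q^(n + 1).\<close>
    have "[:q:] dvd [:q ^ n:]" using n by (simp add: const_poly_dvd_iff coeff_pCons split: nat.split)
    then have "[:q:] dvd (1 - [:c * c':]) * h - (u - [:c:]) * b - [:q ^ n:] * ([:c:] * s * b)"
      using u c by (intro dvd_diff[OF dvd_diff[OF dvd_mult2 dvd_mult2] dvd_mult2])
    then have "[:q ^ n:] * [:q:] dvd [:q ^ n:] * ((1 - [:c * c':]) * h - (u - [:c:]) * b
      - [:q ^ n:] * ([:c:] * s * b))"
      by (rule mult_dvd_mono[OF dvd_refl])
    then show ?thesis by (simp add: mult.commute)
  qed
  moreover have "[:q ^ n:] dvd u' - u" "[:q ^ n:] dvd W' - W" by (simp_all add: u'_def W'_def del: mult_pCons_left)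
  ultimately show ?thesis using that by metis
qed

context padic_integers
begin

text \<open>The degree of \<open>P n\<close> may grow with n; this is what lets the limit be a
  restricted power series and not only a polynomial.\<close>

definition coherent :: "(nat \<Rightarrow> int poly) \<Rightarrow> bool" where
  "coherent P \<longleftrightarrow> (\<forall>n. [:int p ^ n:] dvd P (Suc n) - P n)"

text \<open>The Tate algebra is the inverse limit of the polynomial rings over the integers modulo
  \<open>p ^ n\<close>; its elements are handled through coherent sequences of integer polynomials.\<close>

definition tate_of :: "(nat \<Rightarrow> int poly) \<Rightarrow> nat \<Rightarrow> padic" where
  "tate_of P = (\<lambda>k n. poly.coeff (P n) k mod int p ^ n)"

lemma coherent_mult:
  assumes "coherent P" "coherent Q"
  shows "coherent (\<lambda>n. P n * Q n)"
  unfolding coherent_def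
proof
  fix n
  have "P (Suc n) * Q (Suc n) - P n * Q n = (P (Suc n) - P n) * Q (Suc n) + P n * (Q (Suc n) - Q n)"
    by (simp add: algebra_simps)
  then show "[:int p ^ n:] dvd P (Suc n) * Q (Suc n) - P n * Q n"
    using assms unfolding coherent_def by (metis dvd_add dvd_mult dvd_mult2)
qed

lemma coherent_const: "coherent (\<lambda>_. P)"
  by (simp add: coherent_def)

lemma tate_of_eqI:
  assumes "\<And>n. [:int p ^ n:] dvd P n - Q n"
  shows "tate_of P = tate_of Q"
  using assms unfolding tate_of_def const_poly_dvd_iff by (auto simp: mod_eq_dvd_iff fun_eq_iff)

lemma tate_of_nth_closed [simp]: "coherent P \<Longrightarrow> tate_of P k \<in> carrier (Zp p)"
  unfolding tate_of_def coherent_def const_poly_dvd_iff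
  by (intro carrierI) (auto simp: cong_iff_dvd_diff)

text \<open>Modulo p^n no coefficient beyond the degree of \<open>P n\<close> survives, which is the
  decay that \<open>tate p\<close> asks for.\<close>

lemma tate_of_closed [simp]:
  assumes "coherent P"
  shows "tate_of P \<in> carrier (tate p)"
proof -
  have "tate_of P k n = 0" if "k > degree (P n)" for k n
    using that by (simp add: tate_of_def coeff_eq_0)
  then have "padic_of_int p (int p ^ n) divides\<^bsub>Zp p\<^esub> tate_of P k" if "k > degree (P n)" for k n
    using that assms p_pow_divides_iff by simp
  then have "\<exists>N. \<forall>k\<ge>N. padic_of_int p (int p ^ n) divides\<^bsub>Zp p\<^esub> tate_of P k" for n
    by (metis Suc_le_lessD)
  then show ?thesis using assms by (auto simp: tate_def of_int_nat)
qed

lemma tate_of_mult: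
  assumes "coherent P" "coherent Q"
  shows "tate_of P \<otimes>\<^bsub>tate p\<^esub> tate_of Q = tate_of (\<lambda>n. P n * Q n)"
proof (intro ext)
  fix k n
  have "(\<Oplus>\<^bsub>Zp p\<^esub>i\<in>{..k}. tate_of P i \<otimes>\<^bsub>Zp p\<^esub> tate_of Q (k - i)) n =
    (\<Sum>i\<le>k. (tate_of P i \<otimes>\<^bsub>Zp p\<^esub> tate_of Q (k - i)) n) mod int p ^ n"
    using assms by (intro nth_finsum) auto
  also have "\<dots> = (\<Sum>i\<le>k. poly.coeff (P n) i * poly.coeff (Q n) (k - i)) mod int p ^ n"
    by (rule sum_mod_cong) (simp add: nth_mult tate_of_def mod_simps)
  finally show "(tate_of P \<otimes>\<^bsub>tate p\<^esub> tate_of Q) k n = tate_of (\<lambda>n. P n * Q n) k n"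
    by (simp add: tate_def tate_of_def Polynomial.coeff_mult)
qed

lemma tate_one_eq: "\<one>\<^bsub>tate p\<^esub> = tate_of (\<lambda>_. 1)"
  by (auto simp: tate_def tate_of_def nth_one fun_eq_iff)

lemma tate_of_smult:
  "padic_of_int p a \<odot>\<^bsub>tate p\<^esub> tate_of P = tate_of (\<lambda>n. [:a:] * P n)"
  by (auto simp: tate_def tate_of_def nth_mult nth_of_int fun_eq_iff mod_simps)

section \<open>Evaluation of restricted series\<close>

lemma padic_limit_Zp:
  assumes f: "\<And>m. f m \<in> carrier (Zp p)" and L: "L \<in> carrier (Zp p)"
    and lim: "\<And>n. \<exists>N. \<forall>m\<ge>N. f m n = L n"
  shows "padic_limit p (Zp p) f = L"
proof -
  have *: "f m \<ominus>\<^bsub>Zp p\<^esub> K \<in> PIdl\<^bsub>Zp p\<^esub> ([(p ^ n)] \<cdot>\<^bsub>Zp p\<^esub> \<one>\<^bsub>Zp p\<^esub>) \<longleftrightarrow> f m n = K n"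
    if K: "K \<in> carrier (Zp p)" for m n K
  proof -
    have "f m \<ominus>\<^bsub>Zp p\<^esub> K \<in> PIdl\<^bsub>Zp p\<^esub> ([(p ^ n)] \<cdot>\<^bsub>Zp p\<^esub> \<one>\<^bsub>Zp p\<^esub>) \<longleftrightarrow>
      padic_of_int p (int p ^ n) divides\<^bsub>Zp p\<^esub> (f m \<ominus>\<^bsub>Zp p\<^esub> K)"
      unfolding of_int_nat of_nat_power by (rule Zp.cgenideal_iff_divides) simp
    also have "\<dots> \<longleftrightarrow> f m n = K n"
      using f K by (simp add: p_pow_divides_iff nth_minus_eq_0_iff)
    finally show ?thesis .
  qed
  show ?thesis unfolding padic_limit_def
  proof (rule the_equality)
    show "L \<in> carrier (Zp p) \<and> (\<forall>n. \<exists>N. \<forall>m\<ge>N. f m \<ominus>\<^bsub>Zp p\<^esub> L \<in> PIdl\<^bsub>Zp p\<^esub> ([(p ^ n)] \<cdot>\<^bsub>Zp p\<^esub> \<one>\<^bsub>Zp p\<^esub>))"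
      using L lim by (simp add: *)
    fix K assume "K \<in> carrier (Zp p) \<and> (\<forall>n. \<exists>N. \<forall>m\<ge>N. f m \<ominus>\<^bsub>Zp p\<^esub> K \<in> PIdl\<^bsub>Zp p\<^esub> ([(p ^ n)] \<cdot>\<^bsub>Zp p\<^esub> \<one>\<^bsub>Zp p\<^esub>))"
    then have K: "\<exists>N. \<forall>m\<ge>N. f m n = K n" for n by (auto simp: *)
    show "K = L"
    proof
      fix n
      obtain M N where "\<forall>m\<ge>M. f m n = K n" "\<forall>m\<ge>N. f m n = L n" using K lim by metis
      then show "K n = L n" by (metis max.cobounded1 max.cobounded2)
    qed
  qed
qed

lemma coherent_poly_cong:
  assumes "coherent P" "z \<in> carrier (Zp p)"
  shows "[poly (P (Suc n)) (z (Suc n)) = poly (P n) (z n)] (mod int p ^ n)"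
proof -
  have "[:int p ^ n:] dvd P (Suc n) - P n" using assms by (simp add: coherent_def)
  then have "int p ^ n dvd poly (P (Suc n) - P n) (z (Suc n))"
    by (elim dvdE) simp
  then have "[poly (P (Suc n)) (z (Suc n)) = poly (P n) (z (Suc n))] (mod int p ^ n)"
    by (simp add: cong_iff_dvd_diff)
  also have "[z (Suc n) = z n] (mod int p ^ n)"
    using assms(2) by (simp add: cong_def carrier_iff)
  then have "[poly (P n) (z (Suc n)) = poly (P n) (z n)] (mod int p ^ n)"
    unfolding poly_altdef by (intro cong_sum cong_scalar_left cong_pow)
  finally show ?thesis .
qed

definition poly_value :: "(nat \<Rightarrow> int poly) \<Rightarrow> padic \<Rightarrow> padic" where
  "poly_value P z = (\<lambda>n. poly (P n) (z n) mod int p ^ n)"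

lemma poly_value_closed [simp]:
  "coherent P \<Longrightarrow> z \<in> carrier (Zp p) \<Longrightarrow> poly_value P z \<in> carrier (Zp p)"
  unfolding poly_value_def by (intro carrierI coherent_poly_cong)

lemma poly_value_mult: "poly_value (\<lambda>n. P n * Q n) z = poly_value P z \<otimes>\<^bsub>Zp p\<^esub> poly_value Q z"
  by (auto simp: poly_value_def nth_mult mod_simps)

text \<open>Modulo p^n the partial sums are constant from the degree of \<open>P n\<close> on. This
  settles the convergence in \<open>tate_eval\<close> and also the comparison with the polynomial
  evaluation \<open>eval\<close>.\<close>

lemma partial_sum_nth:
  assumes P: "coherent P" and z: "z \<in> carrier (Zp p)" and N: "degree (P n) \<le> N"
  shows "(\<Oplus>\<^bsub>Zp p\<^esub>k\<in>{..N}. tate_of P k \<otimes>\<^bsub>Zp p\<^esub> z [^]\<^bsub>Zp p\<^esub> k) n = poly_value P z n"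
proof -
  have "(\<Oplus>\<^bsub>Zp p\<^esub>k\<in>{..N}. tate_of P k \<otimes>\<^bsub>Zp p\<^esub> z [^]\<^bsub>Zp p\<^esub> k) n
    = (\<Sum>k\<le>N. (tate_of P k \<otimes>\<^bsub>Zp p\<^esub> z [^]\<^bsub>Zp p\<^esub> k) n) mod int p ^ n"
    using P z by (intro nth_finsum) auto
  also have "\<dots> = (\<Sum>k\<le>N. poly.coeff (P n) k * z n ^ k) mod int p ^ n"
    using z by (intro sum_mod_cong) (simp add: nth_mult nth_pow tate_of_def mod_simps)
  also have "(\<Sum>k\<le>N. poly.coeff (P n) k * z n ^ k) = (\<Sum>k\<le>degree (P n). poly.coeff (P n) k * z n ^ k)"
    using N by (intro sum.mono_neutral_right) (auto simp: coeff_eq_0)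
  finally show ?thesis by (simp add: poly_value_def poly_altdef)
qed

lemma tate_eval_tate_of:
  assumes "coherent P" "z \<in> carrier (Zp p)"
  shows "tate_eval p (tate_of P) z = poly_value P z"
  unfolding tate_eval_def
proof (rule padic_limit_Zp)
  show "\<exists>N. \<forall>m\<ge>N. (\<Oplus>\<^bsub>Zp p\<^esub>k\<in>{..m}. tate_of P k \<otimes>\<^bsub>Zp p\<^esub> z [^]\<^bsub>Zp p\<^esub> k) n = poly_value P z n" for n
    using partial_sum_nth[OF assms] by blast
qed (use assms in auto)

text \<open>Turns the lifted factor into an element of \<open>UP (Zp p)\<close>: as all levels have
  the same degree, nothing above e survives in the limit.\<close>

lemma monic_tate_of_UP:
  assumes W: "coherent W" and deg: "\<And>n. degree (W n) = e" and monic: "\<And>n. lead_coeff (W n) = 1"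
  shows "tate_of W \<in> carrier (UP (Zp p))" "deg (Zp p) (tate_of W) = e"
    "UnivPoly.coeff (UP (Zp p)) (tate_of W) e = \<one>\<^bsub>Zp p\<^esub>"
    and "z \<in> carrier (Zp p) \<Longrightarrow> eval (Zp p) (Zp p) id z (tate_of W) = poly_value W z"
proof -
  interpret U: UP_domain "Zp p" "UP (Zp p)" by unfold_locales simp
  have above: "tate_of W k = \<zero>\<^bsub>Zp p\<^esub>" if "k > e" for k
    using that by (auto simp: tate_of_def coeff_eq_0 deg fun_eq_iff)
  then have up: "tate_of W \<in> up (Zp p)" using W by (auto intro!: mem_upI exI[of _ e] bound.intro)
  then show c: "tate_of W \<in> carrier (UP (Zp p))" by (simp add: UP_def)
  have co: "UnivPoly.coeff (UP (Zp p)) (tate_of W) k = tate_of W k" for k using up by (simp add: UP_def)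
  show one: "UnivPoly.coeff (UP (Zp p)) (tate_of W) e = \<one>\<^bsub>Zp p\<^esub>"
    unfolding co using monic by (auto simp: tate_of_def deg nth_one fun_eq_iff)
  show dg: "deg (Zp p) (tate_of W) = e"
  proof (rule antisym)
    show "deg (Zp p) (tate_of W) \<le> e" using above c by (intro U.deg_aboveI) (simp_all add: co)
    show "e \<le> deg (Zp p) (tate_of W)" using one c by (intro U.deg_belowI) simp_all
  qed
  assume z: "z \<in> carrier (Zp p)"
  show "eval (Zp p) (Zp p) id z (tate_of W) = poly_value W z"
    using partial_sum_nth[OF W z] deg
    by (auto simp: eval_def c co dg fun_eq_iff)
qed

text \<open>Modulo p, P is the constant c times a monic polynomial of degree e, and
  \<open>hensel_step\<close> carries this factorization through all powers of p. The inverse V of U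
  is a geometric series: c' U is congruent to 1 modulo p, so (1 - c' U)^n vanishes modulo
  p^n.\<close>

theorem weierstrass_lift:
  assumes P: "coherent P" and above: "\<And>k. k > e \<Longrightarrow> int p dvd poly.coeff (P 1) k"
    and lead: "\<not> int p dvd poly.coeff (P 1) e"
  obtains U V W where "coherent U" "coherent V" "coherent W"
    "\<And>n. degree (W n) = e" "\<And>n. lead_coeff (W n) = 1"
    "tate_of P = tate_of (\<lambda>n. U n * W n)" "tate_of (\<lambda>n. U n * V n) = tate_of (\<lambda>_. 1)"
proof -
  define c where "c = poly.coeff (P 1) e"
  have "coprime c (int p)" using lead prime_p
    by (simp add: c_def coprime_commute prime_imp_coprime)
  then obtain c' where c': "[c * c' = 1] (mod int p)" using cong_solve_coprime_int by blast
  have cc: "[:int p:] dvd 1 - [:c * c':]"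
    using cong_sym[OF c'] by (simp add: const_poly_dvd_iff coeff_pCons one_pCons cong_iff_dvd_diff split: nat.split)
  \<comment> \<open>Index n stands for the modulus p^(n + 1), as the lifting starts at p. The
    congruence between u and c modulo p is carried along because every step needs it again.\<close>
  define good where "good = (\<lambda>n (u, W). [:int p ^ Suc n:] dvd P (Suc n) - u * W \<and> [:int p:] dvd u - [:c:]
    \<and> degree W = e \<and> lead_coeff W = 1)"
  have "\<exists>f. \<forall>n. good n (f n) \<and> ([:int p ^ Suc n:] dvd fst (f (Suc n)) - fst (f n)
      \<and> [:int p ^ Suc n:] dvd snd (f (Suc n)) - snd (f n))"
  proof (rule dependent_nat_choice)
    \<comment> \<open>This is \<open>P 1\<close> divided by its leading unit modulo p: coefficients
      below e are multiplied by c', position e gets exactly 1, and what lies above e is divisible by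
      p and dropped.\<close>
    define W where "W = poly_cutoff e ([:c':] * P 1) + Polynomial.monom 1 e"
    have co: "poly.coeff W k = (if k < e then c' * poly.coeff (P 1) k else if k = e then 1 else 0)" for k
      by (auto simp: W_def coeff_poly_cutoff)
    have deg: "degree W = e"
      by (intro antisym degree_le le_degree) (auto simp: co)
    have "int p dvd poly.coeff (P 1 - [:c:] * W) k" for k
    proof -
      have "int p dvd a - c * (c' * a)" for a
        using cong_scalar_right[OF cong_sym[OF c'], of a] by (simp add: cong_iff_dvd_diff mult.assoc)
      then show ?thesis using above by (auto simp: co c_def)
    qed
    then have "[:int p:] dvd P 1 - [:c:] * W" by (simp only: const_poly_dvd_iff) simp
    then have "good 0 ([:c:], W)" using deg by (simp add: good_def co)
    then show "\<exists>x. good 0 x" ..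
  next
    fix x n assume "good n x"
    then obtain u W where x: "x = (u, W)" and 1: "[:int p ^ Suc n:] dvd P (Suc n) - u * W"
      and 2: "[:int p:] dvd u - [:c:]" and 3: "degree W = e" "lead_coeff W = 1"
      by (cases x) (auto simp: good_def)
    have "[:int p ^ Suc n:] dvd P (Suc (Suc n)) - P (Suc n)" using P unfolding coherent_def by blast
    then have "[:int p ^ Suc n:] dvd (P (Suc (Suc n)) - P (Suc n)) + (P (Suc n) - u * W)"
      using 1 by (rule dvd_add)
    then have "[:int p ^ Suc n:] dvd P (Suc (Suc n)) - u * W" by simp
    then obtain u' W' where *: "[:int p ^ Suc n:] dvd u' - u" "[:int p ^ Suc n:] dvd W' - W"
      "degree W' = degree W" "lead_coeff W' = 1" "[:int p ^ Suc (Suc n):] dvd P (Suc (Suc n)) - u' * W'"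
      using hensel_step[OF _ _ 2 cc 3(2), of "Suc n"] by (metis le_add1 plus_1_eq_Suc)
    have "[:int p:] dvd [:int p ^ Suc n:]" by (simp add: const_poly_dvd_iff coeff_pCons split: nat.split)
    then have "[:int p:] dvd (u' - u) + (u - [:c:])" using *(1) 2 by (intro dvd_add) (metis dvd_trans)
    then have "[:int p:] dvd u' - [:c:]" by (simp only: add_diff_eq diff_add_cancel)
    then have "good (Suc n) (u', W')" using * 3 by (simp add: good_def)
    then show "\<exists>y. good (Suc n) y \<and> ([:int p ^ Suc n:] dvd fst y - fst x \<and> [:int p ^ Suc n:] dvd snd y - snd x)"
      using * by (intro exI[of _ "(u', W')"]) (simp add: x)
  qed
  then obtain f where f: "\<And>n. good n (f n)"
    "\<And>n. [:int p ^ Suc n:] dvd fst (f (Suc n)) - fst (f n)"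
    "\<And>n. [:int p ^ Suc n:] dvd snd (f (Suc n)) - snd (f n)" by metis
  \<comment> \<open>Back to the modulus p^n. For n = 0 truncated subtraction repeats the first pair,
    harmlessly since the modulus is then 1.\<close>
  define U where "U = (\<lambda>n. fst (f (n - 1)))"
  define W where "W = (\<lambda>n. snd (f (n - 1)))"
  have unit_dvd: "[:int p ^ 0:] dvd Q" for Q by (simp add: one_pCons[symmetric])
  have co: "coherent U" "coherent W"
    unfolding coherent_def U_def W_def
  proof safe
    fix n
    show "[:int p ^ n:] dvd fst (f (Suc n - 1)) - fst (f (n - 1))"
      using f(2)[of "n - 1"] by (cases n) (simp_all add: unit_dvd)
    show "[:int p ^ n:] dvd snd (f (Suc n - 1)) - snd (f (n - 1))"
      using f(3)[of "n - 1"] by (cases n) (simp_all add: unit_dvd)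
  qed
  have W: "degree (W n) = e" "lead_coeff (W n) = 1" for n
    using f(1)[of "n - 1"] by (auto simp: good_def W_def split: prod.splits)
  have fac: "[:int p ^ n:] dvd P n - U n * W n" for n
    using f(1)[of "n - 1"] by (cases n) (use unit_dvd in \<open>auto simp: good_def U_def W_def split: prod.splits\<close>)
  have "\<exists>V. [:int p ^ n:] dvd U n * V - 1" for n
  proof -
    have "[:int p:] dvd U n - [:c:]"
      using f(1)[of "n - 1"] by (auto simp: good_def U_def split: prod.splits)
    then have "[:int p:] dvd (1 - [:c * c':]) - [:c':] * (U n - [:c:])"
      using cc by (intro dvd_diff[OF _ dvd_mult])
    also have "(1 - [:c * c':]) - [:c':] * (U n - [:c:]) = 1 - [:c':] * U n"
      by (simp add: algebra_simps)
    finally have "[:int p:] ^ n dvd (1 - [:c':] * U n) ^ n" by (rule dvd_power_same)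
    also have "[:int p:] ^ n = [:int p ^ n:]" by (simp add: poly_const_pow)
    finally have "[:int p ^ n:] dvd - ((1 - [:c':] * U n) ^ n)" by (simp only: dvd_minus_iff)
    \<comment> \<open>Finite geometric sum: with t = 1 - c' U, the product of c' U and the sum of
      all t^i with i < n is 1 - t^n.\<close>
    also have "- ((1 - [:c':] * U n) ^ n) = U n * ([:c':] * (\<Sum>i<n. (1 - [:c':] * U n) ^ i)) - 1"
      using one_diff_power_eq[of "1 - [:c':] * U n" n] by (simp add: algebra_simps)
    finally show ?thesis ..
  qed
  then obtain V where V: "\<And>n. [:int p ^ n:] dvd U n * V n - 1" by metis
  have "coherent V" unfolding coherent_def
  proof
    fix n
    have "[:int p ^ n:] dvd [:int p ^ Suc n:]" by (simp add: const_poly_dvd_iff coeff_pCons split: nat.split)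
    then have 1: "[:int p ^ n:] dvd U (Suc n) * V (Suc n) - 1" using V[of "Suc n"] by (rule dvd_trans)
    have 2: "[:int p ^ n:] dvd U (Suc n) - U n" using co by (simp add: coherent_def)
    \<comment> \<open>The usual comparison of two inverses; each summand contains a factor that
      vanishes modulo p^n.\<close>
    have "V (Suc n) - V n = V n * (U (Suc n) * V (Suc n) - 1) - V (Suc n) * (U n * V n - 1)
        - V n * V (Suc n) * (U (Suc n) - U n)"
      by (simp add: algebra_simps)
    then show "[:int p ^ n:] dvd V (Suc n) - V n" using 1 2 V[of n] by (metis dvd_diff dvd_mult)
  qed
  with co W that[of U V W] show ?thesis
    using tate_of_eqI[of P "\<lambda>n. U n * W n"] tate_of_eqI[of "\<lambda>n. U n * V n" "\<lambda>_. 1"] fac V by auto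
qed

text \<open>On values the factorization reads F(z) = p^s U(z) W(z). Evaluating U V = 1 gives U(z)
  V(z) = 1, and p^s is nonzero, so in the domain \<open>Zp p\<close> only W(z) can vanish.\<close>

theorem weierstrass_preparation:
  fixes s :: nat
  assumes P: "coherent P" and above: "\<And>k. k > e \<Longrightarrow> int p dvd poly.coeff (P 1) k"
    and lead: "\<not> int p dvd poly.coeff (P 1) e"
  defines "F \<equiv> tate_of (\<lambda>n. [:int p ^ s:] * P n)"
  obtains W where "weierstrass_factor p F W" "deg (Zp p) W = e"
    "tate_zeros p F = {z \<in> carrier (Zp p). eval (Zp p) (Zp p) id z W = \<zero>\<^bsub>Zp p\<^esub>}"
proof -
  obtain U V W where co: "coherent U" "coherent V" "coherent W"
    and W: "\<And>n. degree (W n) = e" "\<And>n. lead_coeff (W n) = 1"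
    and fac: "tate_of P = tate_of (\<lambda>n. U n * W n)" and inv: "tate_of (\<lambda>n. U n * V n) = tate_of (\<lambda>_. 1)"
    using weierstrass_lift[OF assms(1-3)] by blast
  note UPW = monic_tate_of_UP[OF co(3) W]
  have F: "F = padic_of_int p (int p ^ s) \<odot>\<^bsub>tate p\<^esub> tate_of P"
    by (simp only: F_def tate_of_smult)
  have "tate_of U \<in> Units (tate p)"
    unfolding Units_def using co inv by (auto simp: tate_of_mult tate_one_eq mult.commute[of "V _"] intro!: bexI[of _ "tate_of V"])
  then have "weierstrass_factor p F (tate_of W)"
    unfolding weierstrass_factor_def F fac of_int_nat of_nat_power using UPW co
    by (auto simp: tate_of_mult intro!: exI[of _ s] bexI[of _ "tate_of U"])
  moreover have "tate_eval p F z = \<zero>\<^bsub>Zp p\<^esub> \<longleftrightarrow> poly_value W z = \<zero>\<^bsub>Zp p\<^esub>" if z: "z \<in> carrier (Zp p)" for z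
  proof -
    have "tate_eval p F z = poly_value (\<lambda>n. [:int p ^ s:] * (U n * W n)) z"
      unfolding F fac tate_of_smult using co coherent_const z
      by (intro tate_eval_tate_of coherent_mult)
    also have "\<dots> = padic_of_int p (int p ^ s) \<otimes>\<^bsub>Zp p\<^esub> (poly_value U z \<otimes>\<^bsub>Zp p\<^esub> poly_value W z)"
      unfolding poly_value_mult by (simp add: poly_value_def padic_of_int_def)
    finally have *: "tate_eval p F z = \<dots>" .
    have "poly_value U z \<otimes>\<^bsub>Zp p\<^esub> poly_value V z = poly_value (\<lambda>n. U n * V n) z"
      by (simp add: poly_value_mult)
    also have "\<dots> = tate_eval p (tate_of (\<lambda>n. U n * V n)) z"
      using co z by (intro tate_eval_tate_of[symmetric] coherent_mult)
    also have "\<dots> = poly_value (\<lambda>_. 1) z"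
      unfolding inv using z by (intro tate_eval_tate_of coherent_const)
    also have "\<dots> = \<one>\<^bsub>Zp p\<^esub>" by (auto simp: poly_value_def nth_one)
    finally have "poly_value U z \<noteq> \<zero>\<^bsub>Zp p\<^esub>" using co z by auto
    then show ?thesis unfolding * using co z of_int_nonzero[of "int p ^ s"]
      by (simp add: Zp.integral_iff)
  qed
  then have "tate_zeros p F = {z \<in> carrier (Zp p). eval (Zp p) (Zp p) id z (tate_of W) = \<zero>\<^bsub>Zp p\<^esub>}"
    using UPW(4) by (auto simp: tate_zeros_def)
  ultimately show ?thesis using that UPW(2) by blast
qed

end

subsection \<open>Root multiplicities\<close>

lemma (in domain) nat_pow_nonzero: "x \<in> carrier R \<Longrightarrow> x \<noteq> \<zero> \<Longrightarrow> x [^] (n::nat) \<noteq> \<zero>"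
  by (induction n) (auto simp: integral_iff)

context UP_domain
begin

lemma lin_factor_eq: "lin_factor R z = UnivPoly.monom P \<one> 1 \<ominus>\<^bsub>P\<^esub> UnivPoly.monom P z 0"
  by (simp add: lin_factor_def P_def)

lemma nontrivial: "carrier R \<noteq> {\<zero>}"
  using R.one_not_zero R.one_closed by blast

lemma lin_factor_closed [simp]: "z \<in> carrier R \<Longrightarrow> lin_factor R z \<in> carrier P"
  by (simp add: lin_factor_eq)

lemma deg_lin_factor [simp]: "z \<in> carrier R \<Longrightarrow> deg R (lin_factor R z) = 1"
  unfolding lin_factor_eq using deg_monom_minus[OF _ nontrivial] by simp

lemma lin_factor_nonzero [simp]: "z \<in> carrier R \<Longrightarrow> lin_factor R z \<noteq> \<zero>\<^bsub>P\<^esub>"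
  by (metis deg_lin_factor deg_zero zero_neq_one)

lemma eval_hom: "z \<in> carrier R \<Longrightarrow> eval R R id z \<in> ring_hom P R"
proof -
  interpret UP_pre_univ_prop R R id P by unfold_locales simp
  show "z \<in> carrier R \<Longrightarrow> ?thesis" by (rule eval_ring_hom)
qed

lemma eval_lin_factor:
  assumes "z \<in> carrier R" "w \<in> carrier R"
  shows "eval R R id z (lin_factor R w) = z \<ominus> w"
proof -
  interpret UP_pre_univ_prop R R id P by unfold_locales simp
  interpret E: ring_hom_cring P R "eval R R id z"
    using eval_hom[OF assms(1)] by unfold_locales
  have "eval R R id z (lin_factor R w) = eval R R id z (UnivPoly.monom P \<one> 1) \<ominus> eval R R id z (UnivPoly.monom P w 0)"
    using assms by (simp add: lin_factor_eq a_minus_def)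
  then show ?thesis using assms eval_monom1[of z] eval_const[of z w] by simp
qed

lemma lin_factor_divides_iff:
  assumes z: "z \<in> carrier R" and W: "W \<in> carrier P"
  shows "lin_factor R z divides\<^bsub>P\<^esub> W \<longleftrightarrow> eval R R id z W = \<zero>"
proof
  assume "lin_factor R z divides\<^bsub>P\<^esub> W"
  then obtain V where V: "V \<in> carrier P" "W = lin_factor R z \<otimes>\<^bsub>P\<^esub> V" by (auto simp: factor_def)
  have "eval R R id z V \<in> carrier R" using eval_hom[OF z] V by (auto simp: ring_hom_def)
  then show "eval R R id z W = \<zero>"
    using ring_hom_mult[OF eval_hom[OF z] _ V(1)] z V(2) by (simp add: eval_lin_factor R.r_neg a_minus_def)
next
  assume "eval R R id z W = \<zero>"
  then show "lin_factor R z divides\<^bsub>P\<^esub> W"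
    using remainder_theorem[OF W z nontrivial]
    unfolding lin_factor_eq[symmetric] using z by (auto simp: factor_def)
qed

text \<open>As Q does not vanish at z, evaluation at z shows that a factor X - z of the product must
  come from V; it is cancelled and the argument is repeated m times.\<close>

lemma lin_factor_pow_divides_cancel:
  assumes z: "z \<in> carrier R" and Q: "Q \<in> carrier P" "eval R R id z Q \<noteq> \<zero>"
  shows "V \<in> carrier P \<Longrightarrow> lin_factor R z [^]\<^bsub>P\<^esub> (m::nat) divides\<^bsub>P\<^esub> (Q \<otimes>\<^bsub>P\<^esub> V) \<Longrightarrow>
    lin_factor R z [^]\<^bsub>P\<^esub> m divides\<^bsub>P\<^esub> V"
proof (induction m arbitrary: V)
  case 0
  then show ?case by (auto simp: factor_def)
next
  case (Suc m)
  let ?L = "lin_factor R z"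
  have L: "?L \<in> carrier P" using z by simp
  obtain T where T: "T \<in> carrier P" "Q \<otimes>\<^bsub>P\<^esub> V = ?L [^]\<^bsub>P\<^esub> Suc m \<otimes>\<^bsub>P\<^esub> T"
    using Suc.prems by (auto simp: factor_def)
  then have QV: "Q \<otimes>\<^bsub>P\<^esub> V = ?L \<otimes>\<^bsub>P\<^esub> (?L [^]\<^bsub>P\<^esub> m \<otimes>\<^bsub>P\<^esub> T)"
    using L by (simp add: P.m_ac)
  then have "?L divides\<^bsub>P\<^esub> (Q \<otimes>\<^bsub>P\<^esub> V)" using L T by (auto simp: factor_def)
  then have "eval R R id z (Q \<otimes>\<^bsub>P\<^esub> V) = \<zero>" using Q Suc.prems z by (simp add: lin_factor_divides_iff)
  then have "eval R R id z Q \<otimes> eval R R id z V = \<zero>"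
    using ring_hom_mult[OF eval_hom[OF z] Q(1) Suc.prems(1)] by simp
  moreover have "eval R R id z Q \<in> carrier R" "eval R R id z V \<in> carrier R"
    using Q Suc.prems(1) ring_hom_closed[OF eval_hom[OF z]] by auto
  ultimately have "eval R R id z V = \<zero>"
    using Q by (simp add: R.integral_iff)
  then obtain S where S: "S \<in> carrier P" "V = ?L \<otimes>\<^bsub>P\<^esub> S"
    using Suc.prems(1) z by (auto simp: lin_factor_divides_iff[symmetric] factor_def)
  have "?L \<otimes>\<^bsub>P\<^esub> (Q \<otimes>\<^bsub>P\<^esub> S) = ?L \<otimes>\<^bsub>P\<^esub> (?L [^]\<^bsub>P\<^esub> m \<otimes>\<^bsub>P\<^esub> T)"
    using QV S Q L by (simp add: P.m_lcomm)
  then have "Q \<otimes>\<^bsub>P\<^esub> S = ?L [^]\<^bsub>P\<^esub> m \<otimes>\<^bsub>P\<^esub> T"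
    using L Q S T z by (subst (asm) m_lcancel) auto
  then have "?L [^]\<^bsub>P\<^esub> m divides\<^bsub>P\<^esub> (Q \<otimes>\<^bsub>P\<^esub> S)" using T by (auto simp: factor_def)
  then obtain S' where S': "S' \<in> carrier P" "S = ?L [^]\<^bsub>P\<^esub> m \<otimes>\<^bsub>P\<^esub> S'"
    using Suc.IH[OF S(1)] by (auto simp: factor_def)
  have "V = ?L [^]\<^bsub>P\<^esub> Suc m \<otimes>\<^bsub>P\<^esub> S'" using S S' L by (simp add: P.m_ac)
  then show ?case using S' by (auto simp: factor_def)
qed

lemma deg_pow: "x \<in> carrier P \<Longrightarrow> x \<noteq> \<zero>\<^bsub>P\<^esub> \<Longrightarrow> deg R (x [^]\<^bsub>P\<^esub> (n::nat)) = n * deg R x"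
  by (induction n) (auto simp: nat_pow_nonzero)

lemma deg_divides_le:
  assumes "x divides\<^bsub>P\<^esub> W" "x \<in> carrier P" "W \<in> carrier P" "W \<noteq> \<zero>\<^bsub>P\<^esub>"
  shows "deg R x \<le> deg R W"
proof -
  obtain V where V: "V \<in> carrier P" "W = x \<otimes>\<^bsub>P\<^esub> V" using assms by (auto simp: factor_def)
  then have "x \<noteq> \<zero>\<^bsub>P\<^esub>" "V \<noteq> \<zero>\<^bsub>P\<^esub>" using assms by auto
  then show ?thesis using V assms by simp
qed

text \<open>Powers of distinct linear factors that divide W one by one also divide it jointly, and
  degrees add over a domain.\<close>

lemma sum_multiplicities_le_deg:
  assumes "finite Z" "Z \<subseteq> carrier R" and W: "W \<in> carrier P" "W \<noteq> \<zero>\<^bsub>P\<^esub>"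
    and dvd: "\<And>z. z \<in> Z \<Longrightarrow> lin_factor R z [^]\<^bsub>P\<^esub> (m z :: nat) divides\<^bsub>P\<^esub> W"
  shows "(\<Sum>z\<in>Z. m z) \<le> deg R W"
proof -
  \<comment> \<open>Q collects the powers split off so far. Its lack of zeros outside Z is kept in
    the invariant because it is what allows the next power to be cancelled past Q.\<close>
  have "\<exists>Q V. Q \<in> carrier P \<and> V \<in> carrier P \<and> W = Q \<otimes>\<^bsub>P\<^esub> V \<and> deg R Q = (\<Sum>z\<in>Z. m z) \<and>
      (\<forall>z\<in>carrier R - Z. eval R R id z Q \<noteq> \<zero>)"
    using assms(1,2) dvd
  proof (induction Z rule: finite_induct)
    case empty
    have "eval R R id z \<one>\<^bsub>P\<^esub> \<noteq> \<zero>" if "z \<in> carrier R" for z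
      using ring_hom_one[OF eval_hom[OF that]] by simp
    then have "\<one>\<^bsub>P\<^esub> \<in> carrier P \<and> W \<in> carrier P \<and> W = \<one>\<^bsub>P\<^esub> \<otimes>\<^bsub>P\<^esub> W \<and> deg R \<one>\<^bsub>P\<^esub> = (\<Sum>z\<in>{}. m z) \<and>
      (\<forall>z\<in>carrier R - {}. eval R R id z \<one>\<^bsub>P\<^esub> \<noteq> \<zero>)" using W by simp
    then show ?case by blast
  next
    case (insert z Z)
    have "Z \<subseteq> carrier R" "\<And>z. z \<in> Z \<Longrightarrow> lin_factor R z [^]\<^bsub>P\<^esub> m z divides\<^bsub>P\<^esub> W"
      using insert.prems by auto
    from insert.IH[OF this] obtain Q V where Q: "Q \<in> carrier P" "V \<in> carrier P" "W = Q \<otimes>\<^bsub>P\<^esub> V" "deg R Q = (\<Sum>z\<in>Z. m z)"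
      and ne: "\<And>z. z \<in> carrier R \<Longrightarrow> z \<notin> Z \<Longrightarrow> eval R R id z Q \<noteq> \<zero>" by blast
    have z: "z \<in> carrier R" "z \<notin> Z" using insert by auto
    let ?L = "lin_factor R z [^]\<^bsub>P\<^esub> m z"
    have L: "?L \<in> carrier P" using z by simp
    have "?L divides\<^bsub>P\<^esub> (Q \<otimes>\<^bsub>P\<^esub> V)" using insert.prems(2)[of z] Q by simp
    then have "?L divides\<^bsub>P\<^esub> V"
      by (rule lin_factor_pow_divides_cancel[OF z(1) Q(1) ne[OF z] Q(2)])
    then obtain S where S: "S \<in> carrier P" "V = ?L \<otimes>\<^bsub>P\<^esub> S" by (auto simp: factor_def)
    have "Q \<noteq> \<zero>\<^bsub>P\<^esub>" using Q W by auto
    then have "deg R (Q \<otimes>\<^bsub>P\<^esub> ?L) = deg R Q + m z"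
      using Q L z by (simp add: nat_pow_nonzero deg_pow)
    moreover have "eval R R id w (Q \<otimes>\<^bsub>P\<^esub> ?L) \<noteq> \<zero>" if w: "w \<in> carrier R - insert z Z" for w
    proof -
      interpret E: ring_hom_cring P R "eval R R id w"
        using eval_hom[of w] w by unfold_locales auto
      have "w \<ominus> z \<noteq> \<zero>" using w z R.r_right_minus_eq by auto
      then have "(w \<ominus> z) [^] m z \<noteq> \<zero>"
        using w z by (intro R.nat_pow_nonzero) auto
      then show ?thesis using ne[of w] w z Q L
        by (simp add: E.hom_pow eval_lin_factor R.integral_iff)
    qed
    moreover have "W = (Q \<otimes>\<^bsub>P\<^esub> ?L) \<otimes>\<^bsub>P\<^esub> S" using Q S L by (simp add: P.m_assoc)
    moreover have "deg R Q + m z = (\<Sum>z\<in>insert z Z. m z)" using Q insert.hyps by simp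
    moreover have "Q \<otimes>\<^bsub>P\<^esub> ?L \<in> carrier P" using Q L by simp
    ultimately show ?case using S by metis
  qed
  then obtain Q V where "Q \<in> carrier P" "V \<in> carrier P" "W = Q \<otimes>\<^bsub>P\<^esub> V" "deg R Q = (\<Sum>z\<in>Z. m z)"
    by blast
  then show ?thesis using deg_divides_le[of Q W] W by (auto simp: factor_def)
qed

text \<open>\<open>GREATEST\<close> is meaningful here: exponent 0 is admissible and the degree of W
  bounds all admissible exponents.\<close>

lemma root_mult_divides:
  assumes z: "z \<in> carrier R" and W: "W \<in> carrier P" "W \<noteq> \<zero>\<^bsub>P\<^esub>"
  shows "lin_factor R z [^]\<^bsub>P\<^esub> root_mult R W z divides\<^bsub>P\<^esub> W"
    and "lin_factor R z [^]\<^bsub>P\<^esub> (n::nat) divides\<^bsub>P\<^esub> W \<Longrightarrow> n \<le> root_mult R W z"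
proof -
  have bound: "n \<le> deg R W" if "lin_factor R z [^]\<^bsub>P\<^esub> (n::nat) divides\<^bsub>P\<^esub> W" for n
    using deg_divides_le[OF that _ W] z by (simp add: deg_pow)
  have "lin_factor R z [^]\<^bsub>P\<^esub> (0::nat) divides\<^bsub>P\<^esub> W" using W by (auto simp: factor_def)
  then show "lin_factor R z [^]\<^bsub>P\<^esub> root_mult R W z divides\<^bsub>P\<^esub> W"
    unfolding root_mult_def P_def[symmetric] using bound by (rule GreatestI_nat)
  show "lin_factor R z [^]\<^bsub>P\<^esub> n divides\<^bsub>P\<^esub> W \<Longrightarrow> n \<le> root_mult R W z"
    unfolding root_mult_def P_def[symmetric] by (rule Greatest_le_nat[OF _ bound])
qed

lemma root_mult_pos:
  assumes z: "z \<in> carrier R" and W: "W \<in> carrier P" "W \<noteq> \<zero>\<^bsub>P\<^esub>" and "eval R R id z W = \<zero>"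
  shows "root_mult R W z \<ge> 1"
  using root_mult_divides(2)[OF z W, of 1] assms by (simp add: lin_factor_divides_iff P.nat_pow_eone)

text \<open>Each root has multiplicity at least 1, so the bound for the multiplicities over finite
  sets of roots also bounds the size of such sets; this gives finiteness.\<close>

theorem root_count:
  assumes W: "W \<in> carrier P" "W \<noteq> \<zero>\<^bsub>P\<^esub>"
  defines "Z \<equiv> {z \<in> carrier R. eval R R id z W = \<zero>}"
  shows "finite Z" "(\<Sum>z\<in>Z. root_mult R W z) \<le> deg R W"
proof -
  have sum_le: "(\<Sum>z\<in>Y. root_mult R W z) \<le> deg R W" if "finite Y" "Y \<subseteq> Z" for Y
    using that W root_mult_divides(1)[OF _ W] by (intro sum_multiplicities_le_deg) (auto simp: Z_def)
  have "card Y \<le> deg R W" if "finite Y" "Y \<subseteq> Z" for Y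
  proof -
    have "card Y = (\<Sum>z\<in>Y. 1)" by simp
    also have "\<dots> \<le> (\<Sum>z\<in>Y. root_mult R W z)"
      using that root_mult_pos[OF _ W] by (intro sum_mono) (auto simp: Z_def)
    finally show ?thesis using sum_le[OF that] by simp
  qed
  then show fin: "finite Z"
    using infinite_arbitrarily_large[of Z "Suc (deg R W)"] by (metis Suc_n_not_le_n)
  show "(\<Sum>z\<in>Z. root_mult R W z) \<le> deg R W" by (rule sum_le[OF fin order_refl])
qed

end

subsection \<open>Traces\<close>

lemma (in abelian_monoid) finsum_swap:
  assumes "finite S" "finite T" "\<And>i j. i \<in> S \<Longrightarrow> j \<in> T \<Longrightarrow> f i j \<in> carrier G"
  shows "(\<Oplus>i\<in>S. \<Oplus>j\<in>T. f i j) = (\<Oplus>j\<in>T. \<Oplus>i\<in>S. f i j)"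
  using assms(1,3)
proof (induction S rule: finite_induct)
  case empty
  then show ?case by (simp add: finsum_zero)
next
  case (insert x S)
  have "(\<Oplus>i\<in>insert x S. \<Oplus>j\<in>T. f i j) = (\<Oplus>j\<in>T. f x j) \<oplus> (\<Oplus>i\<in>S. \<Oplus>j\<in>T. f i j)"
    using insert by (intro finsum_insert) auto
  also have "\<dots> = (\<Oplus>j\<in>T. f x j) \<oplus> (\<Oplus>j\<in>T. \<Oplus>i\<in>S. f i j)" using insert by simp
  also have "\<dots> = (\<Oplus>j\<in>T. f x j \<oplus> (\<Oplus>i\<in>S. f i j))"
    using insert by (intro finsum_addf[symmetric]) auto
  also have "\<dots> = (\<Oplus>j\<in>T. \<Oplus>i\<in>insert x S. f i j)"
    using insert by (intro finsum_cong') auto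
  finally show ?case .
qed

context algebra
begin

text \<open>Unlike in \<open>linear_forms\<close>, nothing is prescribed outside the carrier, so
  that \<open>alg_trace\<close>, coordinates and their compositions with multiplications qualify as
  they stand.\<close>

definition is_linear :: "('c \<Rightarrow> 'a) \<Rightarrow> bool" where
  "is_linear f \<longleftrightarrow> f \<in> carrier M \<rightarrow> carrier R \<and>
    (\<forall>x\<in>carrier M. \<forall>y\<in>carrier M. f (x \<oplus>\<^bsub>M\<^esub> y) = f x \<oplus> f y) \<and>
    (\<forall>c\<in>carrier R. \<forall>x\<in>carrier M. f (c \<odot>\<^bsub>M\<^esub> x) = c \<otimes> f x)"

lemma is_linearD:
  assumes "is_linear f"
  shows "x \<in> carrier M \<Longrightarrow> f x \<in> carrier R"
    and "x \<in> carrier M \<Longrightarrow> y \<in> carrier M \<Longrightarrow> f (x \<oplus>\<^bsub>M\<^esub> y) = f x \<oplus> f y"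
    and "c \<in> carrier R \<Longrightarrow> x \<in> carrier M \<Longrightarrow> f (c \<odot>\<^bsub>M\<^esub> x) = c \<otimes> f x"
  using assms by (auto simp: is_linear_def)

lemma is_linear_zero: "is_linear f \<Longrightarrow> f \<zero>\<^bsub>M\<^esub> = \<zero>"
  using is_linearD(3)[of f \<zero> "\<zero>\<^bsub>M\<^esub>"] is_linearD(1)[of f "\<zero>\<^bsub>M\<^esub>"] by simp

lemma is_linear_sum:
  assumes f: "is_linear f" and "finite S" "g \<in> S \<rightarrow> carrier R" "x \<in> S \<rightarrow> carrier M"
  shows "f (\<Oplus>\<^bsub>M\<^esub>i\<in>S. g i \<odot>\<^bsub>M\<^esub> x i) = (\<Oplus>i\<in>S. g i \<otimes> f (x i))"
  using assms(2-)
proof (induction S rule: finite_induct)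
  case empty
  then show ?case using is_linear_zero[OF f] by simp
next
  case (insert s S)
  then have "f (\<Oplus>\<^bsub>M\<^esub>i\<in>insert s S. g i \<odot>\<^bsub>M\<^esub> x i) = f (g s \<odot>\<^bsub>M\<^esub> x s \<oplus>\<^bsub>M\<^esub> (\<Oplus>\<^bsub>M\<^esub>i\<in>S. g i \<odot>\<^bsub>M\<^esub> x i))"
    by (subst M.finsum_insert) auto
  also have "\<dots> = f (g s \<odot>\<^bsub>M\<^esub> x s) \<oplus> f (\<Oplus>\<^bsub>M\<^esub>i\<in>S. g i \<odot>\<^bsub>M\<^esub> x i)"
    using insert by (intro is_linearD(2)[OF f] M.finsum_closed) auto
  also have "\<dots> = g s \<otimes> f (x s) \<oplus> (\<Oplus>i\<in>S. g i \<otimes> f (x i))"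
    using insert by (simp add: is_linearD(3)[OF f])
  also have "\<dots> = (\<Oplus>i\<in>insert s S. g i \<otimes> f (x i))"
    using insert is_linearD(1)[OF f] by (subst R.finsum_insert) (auto simp: Pi_iff)
  finally show ?case .
qed

lemma is_linear_mult:
  "is_linear f \<Longrightarrow> x \<in> carrier M \<Longrightarrow> is_linear (\<lambda>v. f (x \<otimes>\<^bsub>M\<^esub> v))"
  using smult_assoc2 by (auto simp: is_linear_def r_distr m_comm[of x])

context
  fixes n :: nat and b :: "nat \<Rightarrow> 'c"
  assumes basis: "is_basis R M n b"
begin

lemma basis_closed: "i < n \<Longrightarrow> b i \<in> carrier M"
  using basis by (auto simp: is_basis_def)

lemma coords_closed: "v \<in> carrier M \<Longrightarrow> i < n \<Longrightarrow> coords R M n b v i \<in> carrier R"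
  and coords_sum: "v \<in> carrier M \<Longrightarrow> (\<Oplus>\<^bsub>M\<^esub>i\<in>{..<n}. coords R M n b v i \<odot>\<^bsub>M\<^esub> b i) = v"
proof -
  assume v: "v \<in> carrier M"
  have "\<exists>!f. f \<in> {..<n} \<rightarrow>\<^sub>E carrier R \<and> v = (\<Oplus>\<^bsub>M\<^esub>i\<in>{..<n}. f i \<odot>\<^bsub>M\<^esub> b i)"
    using basis v by (auto simp: is_basis_def)
  from theI'[OF this] have *: "coords R M n b v \<in> {..<n} \<rightarrow>\<^sub>E carrier R"
    "v = (\<Oplus>\<^bsub>M\<^esub>i\<in>{..<n}. coords R M n b v i \<odot>\<^bsub>M\<^esub> b i)"
    unfolding coords_def by auto
  show "(\<Oplus>\<^bsub>M\<^esub>i\<in>{..<n}. coords R M n b v i \<odot>\<^bsub>M\<^esub> b i) = v" by (rule *(2)[symmetric])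
  show "coords R M n b v i \<in> carrier R" if "i < n" using *(1) that by auto
qed

lemma coords_eqI:
  assumes f: "f \<in> {..<n} \<rightarrow> carrier R" and i: "i < n"
  shows "coords R M n b (\<Oplus>\<^bsub>M\<^esub>i\<in>{..<n}. f i \<odot>\<^bsub>M\<^esub> b i) i = f i"
proof -
  define v where "v = (\<Oplus>\<^bsub>M\<^esub>i\<in>{..<n}. f i \<odot>\<^bsub>M\<^esub> b i)"
  have v: "v \<in> carrier M" unfolding v_def using f basis_closed by (intro M.finsum_closed) (auto simp: Pi_iff)
  have v': "v = (\<Oplus>\<^bsub>M\<^esub>i\<in>{..<n}. restrict f {..<n} i \<odot>\<^bsub>M\<^esub> b i)"
    unfolding v_def using f basis_closed by (intro M.finsum_cong') (auto simp: Pi_iff)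
  have "\<exists>!f. f \<in> {..<n} \<rightarrow>\<^sub>E carrier R \<and> v = (\<Oplus>\<^bsub>M\<^esub>i\<in>{..<n}. f i \<odot>\<^bsub>M\<^esub> b i)"
    using basis v by (auto simp: is_basis_def)
  moreover have "restrict f {..<n} \<in> {..<n} \<rightarrow>\<^sub>E carrier R" using f by auto
  ultimately have "coords R M n b v = restrict f {..<n}"
    unfolding coords_def using v' by (intro the1_equality) auto
  then show ?thesis using i unfolding v_def by simp
qed

lemma coords_linear:
  assumes i: "i < n"
  shows "is_linear (\<lambda>v. coords R M n b v i)"
  unfolding is_linear_def
proof (intro conjI ballI)
  show "(\<lambda>v. coords R M n b v i) \<in> carrier M \<rightarrow> carrier R" using coords_closed i by auto
next
  fix x y assume x: "x \<in> carrier M" and y: "y \<in> carrier M"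
  have "x \<oplus>\<^bsub>M\<^esub> y = (\<Oplus>\<^bsub>M\<^esub>j\<in>{..<n}. coords R M n b x j \<odot>\<^bsub>M\<^esub> b j) \<oplus>\<^bsub>M\<^esub> (\<Oplus>\<^bsub>M\<^esub>j\<in>{..<n}. coords R M n b y j \<odot>\<^bsub>M\<^esub> b j)"
    using coords_sum x y by simp
  also have "\<dots> = (\<Oplus>\<^bsub>M\<^esub>j\<in>{..<n}. coords R M n b x j \<odot>\<^bsub>M\<^esub> b j \<oplus>\<^bsub>M\<^esub> coords R M n b y j \<odot>\<^bsub>M\<^esub> b j)"
    using x y coords_closed basis_closed by (intro M.finsum_addf[symmetric]) auto
  also have "\<dots> = (\<Oplus>\<^bsub>M\<^esub>j\<in>{..<n}. (coords R M n b x j \<oplus> coords R M n b y j) \<odot>\<^bsub>M\<^esub> b j)"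
    using x y coords_closed basis_closed by (intro M.finsum_cong') (auto simp: smult_l_distr)
  finally show "coords R M n b (x \<oplus>\<^bsub>M\<^esub> y) i = coords R M n b x i \<oplus> coords R M n b y i"
    using i x y coords_closed by (simp add: coords_eqI)
next
  fix c x assume c: "c \<in> carrier R" and x: "x \<in> carrier M"
  have "c \<odot>\<^bsub>M\<^esub> x = c \<odot>\<^bsub>M\<^esub> (\<Oplus>\<^bsub>M\<^esub>j\<in>{..<n}. coords R M n b x j \<odot>\<^bsub>M\<^esub> b j)"
    using coords_sum x by simp
  also have "\<dots> = (\<Oplus>\<^bsub>M\<^esub>j\<in>{..<n}. c \<odot>\<^bsub>M\<^esub> (coords R M n b x j \<odot>\<^bsub>M\<^esub> b j))"
    using c x coords_closed basis_closed by (intro finsum_smult_ldistr) auto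
  also have "\<dots> = (\<Oplus>\<^bsub>M\<^esub>j\<in>{..<n}. (c \<otimes> coords R M n b x j) \<odot>\<^bsub>M\<^esub> b j)"
    using c x coords_closed basis_closed by (intro M.finsum_cong') (auto simp: smult_assoc1)
  finally show "coords R M n b (c \<odot>\<^bsub>M\<^esub> x) i = c \<otimes> coords R M n b x i"
    using i x c coords_closed by (simp add: coords_eqI)
qed

lemma is_linear_expand:
  assumes f: "is_linear f" and v: "v \<in> carrier M"
  shows "f v = (\<Oplus>i\<in>{..<n}. coords R M n b v i \<otimes> f (b i))"
  using is_linear_sum[OF f, of "{..<n}" "coords R M n b v" b] v coords_closed basis_closed
  by (simp add: coords_sum Pi_iff)

end

text \<open>Both sides are one double sum, with terms (coordinate j of b_i in the basis c) times
  (coordinate i of x c_j in the basis b), summed in either order. The lengths n and m are kept apart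
  because the basis behind \<open>alg_trace\<close> is an arbitrary choice.\<close>

lemma trace_basis_independent:
  assumes b: "is_basis R M n b" and c: "is_basis R M m c" and x: "x \<in> carrier M"
  shows "(\<Oplus>i\<in>{..<n}. coords R M n b (x \<otimes>\<^bsub>M\<^esub> b i) i) = (\<Oplus>j\<in>{..<m}. coords R M m c (x \<otimes>\<^bsub>M\<^esub> c j) j)"
proof -
  let ?b = "coords R M n b" and ?c = "coords R M m c"
  note cl = basis_closed[OF b] basis_closed[OF c] coords_closed[OF b] coords_closed[OF c]
  have "(\<Oplus>i\<in>{..<n}. ?b (x \<otimes>\<^bsub>M\<^esub> b i) i) = (\<Oplus>i\<in>{..<n}. \<Oplus>j\<in>{..<m}. ?c (b i) j \<otimes> ?b (x \<otimes>\<^bsub>M\<^esub> c j) i)"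
  proof (intro R.finsum_cong')
    fix i assume i: "i \<in> {..<n}"
    show "?b (x \<otimes>\<^bsub>M\<^esub> b i) i = (\<Oplus>j\<in>{..<m}. ?c (b i) j \<otimes> ?b (x \<otimes>\<^bsub>M\<^esub> c j) i)"
      using i cl x by (intro is_linear_expand[OF c] is_linear_mult coords_linear[OF b]) auto
  qed (use cl x in \<open>auto intro!: R.finsum_closed\<close>)
  also have "\<dots> = (\<Oplus>j\<in>{..<m}. \<Oplus>i\<in>{..<n}. ?c (b i) j \<otimes> ?b (x \<otimes>\<^bsub>M\<^esub> c j) i)"
    using cl x by (intro R.finsum_swap) auto
  also have "\<dots> = (\<Oplus>j\<in>{..<m}. ?c (x \<otimes>\<^bsub>M\<^esub> c j) j)"
  proof (intro R.finsum_cong')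
    fix j assume j: "j \<in> {..<m}"
    have "?c (x \<otimes>\<^bsub>M\<^esub> c j) j = (\<Oplus>i\<in>{..<n}. ?b (x \<otimes>\<^bsub>M\<^esub> c j) i \<otimes> ?c (b i) j)"
      using j cl x by (intro is_linear_expand[OF b] coords_linear[OF c]) auto
    also have "\<dots> = (\<Oplus>i\<in>{..<n}. ?c (b i) j \<otimes> ?b (x \<otimes>\<^bsub>M\<^esub> c j) i)"
      using j cl x by (intro R.finsum_cong') (auto intro: R.m_comm)
    finally show "(\<Oplus>i\<in>{..<n}. ?c (b i) j \<otimes> ?b (x \<otimes>\<^bsub>M\<^esub> c j) i) = ?c (x \<otimes>\<^bsub>M\<^esub> c j) j" by simp
  qed (use cl x in auto)
  finally show ?thesis .
qed

lemma alg_trace_eq: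
  assumes b: "is_basis R M n b" and x: "x \<in> carrier M"
  shows "alg_trace R M x = (\<Oplus>i\<in>{..<n}. coords R M n b (x \<otimes>\<^bsub>M\<^esub> b i) i)"
proof -
  obtain m c where mc: "(SOME (n, b). is_basis R M n b) = (m, c)" by fastforce
  have "case_prod (is_basis R M) (n, b)" using b by simp
  from someI[of "case_prod (is_basis R M)", OF this] have "is_basis R M m c" unfolding mc by simp
  then show ?thesis unfolding alg_trace_def mc using trace_basis_independent[OF b _ x] by simp
qed

lemma alg_trace_linear:
  assumes b: "is_basis R M n b"
  shows "is_linear (alg_trace R M)"
  unfolding is_linear_def
proof (intro conjI ballI)
  note cl = basis_closed[OF b] coords_closed[OF b]
  note lin = coords_linear[OF b]
  show "alg_trace R M \<in> carrier M \<rightarrow> carrier R"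
    using cl by (auto simp: alg_trace_eq[OF b] intro!: R.finsum_closed)
  fix x assume x: "x \<in> carrier M"
  { fix y assume y: "y \<in> carrier M"
    have "alg_trace R M (x \<oplus>\<^bsub>M\<^esub> y) = (\<Oplus>i\<in>{..<n}. coords R M n b (x \<otimes>\<^bsub>M\<^esub> b i) i \<oplus> coords R M n b (y \<otimes>\<^bsub>M\<^esub> b i) i)"
      unfolding alg_trace_eq[OF b M.a_closed[OF x y]] using x y cl
      by (intro R.finsum_cong') (auto simp: l_distr is_linearD(2)[OF lin])
    also have "\<dots> = alg_trace R M x \<oplus> alg_trace R M y"
      unfolding alg_trace_eq[OF b x] alg_trace_eq[OF b y] using x y cl by (intro R.finsum_addf) auto
    finally show "alg_trace R M (x \<oplus>\<^bsub>M\<^esub> y) = alg_trace R M x \<oplus> alg_trace R M y" . }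
  { fix c assume c: "c \<in> carrier R"
    have "alg_trace R M (c \<odot>\<^bsub>M\<^esub> x) = (\<Oplus>i\<in>{..<n}. c \<otimes> coords R M n b (x \<otimes>\<^bsub>M\<^esub> b i) i)"
      unfolding alg_trace_eq[OF b smult_closed[OF c x]] using x c cl
      by (intro R.finsum_cong') (auto simp: smult_assoc2 is_linearD(3)[OF lin])
    also have "\<dots> = c \<otimes> alg_trace R M x"
      unfolding alg_trace_eq[OF b x] using x c cl by (intro R.finsum_rdistr[symmetric]) auto
    finally show "alg_trace R M (c \<odot>\<^bsub>M\<^esub> x) = c \<otimes> alg_trace R M x" . }
qed

lemma add_pow_eq_smult:
  "x \<in> carrier M \<Longrightarrow> [(k::nat)] \<cdot>\<^bsub>M\<^esub> x = ([k] \<cdot>\<^bsub>R\<^esub> \<one>) \<odot>\<^bsub>M\<^esub> x"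
  by (induction k) (simp_all add: smult_l_distr)

lemma cgenideal_add_pow_iff:
  "x \<in> PIdl\<^bsub>M\<^esub> ([(k::nat)] \<cdot>\<^bsub>M\<^esub> \<one>\<^bsub>M\<^esub>) \<longleftrightarrow> (\<exists>w\<in>carrier M. x = ([k] \<cdot>\<^bsub>R\<^esub> \<one>) \<odot>\<^bsub>M\<^esub> w)"
  unfolding cgenideal_iff_divides[OF M.add.nat_pow_closed[OF one_closed]] factor_def
  by (intro bex_cong refl) (simp add: add_pow_eq_smult smult_assoc2)

end

subsection \<open>The binomial series\<close>

text \<open>Legendre's recursion: the positive multiples of p up to p q + r are p, 2 p, ..., q p,
  and their product is p^q q!.\<close>

lemma multiplicity_fact_mult:
  fixes p q :: nat
  assumes p: "prime p"
  shows "r < p \<Longrightarrow> multiplicity p (fact (p * q + r) :: nat) = q + multiplicity p (fact q :: nat)"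
proof (induction q arbitrary: r)
  case 0
  then have "\<not> p dvd (fact r :: nat)" using p by (simp add: prime_dvd_fact_iff)
  then show ?case by (simp add: not_dvd_imp_multiplicity_0)
next
  case (Suc q)
  have pe: "prime_elem p" using p by simp
  have p0: "p \<noteq> 0" "p > 1" using p prime_gt_1_nat by auto
  show ?case using Suc.prems
  proof (induction r)
    case 0
    have "p * Suc q = Suc (p * q + (p - 1))" using p0 by simp
    then have "(fact (p * Suc q) :: nat) = p * (Suc q * fact (p * q + (p - 1)))"
      by (metis (no_types, lifting) fact_Suc mult.assoc of_nat_id)
    then have "multiplicity p (fact (p * Suc q) :: nat) =
      multiplicity p p + (multiplicity p (Suc q) + multiplicity p (fact (p * q + (p - 1)) :: nat))"
    proof -
      have aux: "multiplicity p (p * (a * b)) = multiplicity p p + (multiplicity p a + multiplicity p b)"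
        if "a \<noteq> 0" "b \<noteq> 0" for a b :: nat
        using pe p0 that by (simp only: prime_elem_multiplicity_mult_distrib mult_eq_0_iff simp_thms)
      show ?thesis unfolding \<open>fact (p * Suc q) = _\<close> by (rule aux) simp_all
    qed
    also have "\<dots> = 1 + multiplicity p (Suc q) + (q + multiplicity p (fact q :: nat))"
      using Suc.IH[of "p - 1"] p0 multiplicity_prime[OF pe] by simp
    also have "multiplicity p (Suc q) + multiplicity p (fact q :: nat) = multiplicity p (fact (Suc q) :: nat)"
      using pe by (simp add: prime_elem_multiplicity_mult_distrib del: mult_Suc)
    then have "1 + multiplicity p (Suc q) + (q + multiplicity p (fact q :: nat)) = Suc q + multiplicity p (fact (Suc q) :: nat)"
      by simp
    finally show ?case by simp
  next
    case (Suc r)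
    have "\<not> p dvd p * Suc q + Suc r"
      using Suc.prems by (metis Suc_neq_Zero dvd_add_right_iff dvd_triv_left nat_dvd_not_less zero_less_Suc)
    then have "multiplicity p (p * Suc q + Suc r) = 0" by (rule not_dvd_imp_multiplicity_0)
    moreover have "(fact (p * Suc q + Suc r) :: nat) = (p * Suc q + Suc r) * fact (p * Suc q + r)" by simp
    moreover have "multiplicity p (a * b) = multiplicity p a + multiplicity p b"
      if "a \<noteq> 0" "b \<noteq> 0" for a b :: nat
      using pe that by (rule prime_elem_multiplicity_mult_distrib)
    ultimately have "multiplicity p (fact (p * Suc q + Suc r) :: nat) = multiplicity p (fact (p * Suc q + r) :: nat)"
      by (metis add_0 add_Suc_right fact_nonzero nat.simps(3))
    then show ?case using Suc.IH Suc.prems by simp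
  qed
qed

text \<open>By Legendre, (p - 1) v_p(m!) is m minus the digit sum of m in base p, and this sum is
  positive. The induction passes from m to m div p.\<close>

lemma multiplicity_fact_less:
  fixes p m :: nat
  assumes p: "prime p"
  shows "m > 0 \<Longrightarrow> multiplicity p (fact m :: nat) * (p - 1) < m"
proof (induction m rule: less_induct)
  case (less m)
  define q where "q = m div p"
  have p1: "p > 1" using p prime_gt_1_nat by auto
  have m: "m = p * q + m mod p" by (simp add: q_def)
  have v: "multiplicity p (fact m :: nat) = q + multiplicity p (fact q :: nat)"
    using multiplicity_fact_mult[OF p, of "m mod p" q] p1 m by simp
  show ?case
  proof (cases "q = 0")
    case True
    then show ?thesis using v less.prems by simp
  next
    case False
    then have "q < m" using p1 less.prems by (simp add: q_def)
    then have "multiplicity p (fact q :: nat) * (p - 1) < q" using less.IH False by simp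
    then have "(q + multiplicity p (fact q :: nat)) * (p - 1) < q * (p - 1) + q"
      by (simp add: add_mult_distrib)
    also have "\<dots> = p * q" using p1 by (simp add: algebra_simps)
    also have "\<dots> \<le> m" using m by simp
    finally show ?thesis by (simp add: v)
  qed
qed

text \<open>This is m! binom(X, m), a polynomial with integer coefficients.\<close>

definition falling :: "nat \<Rightarrow> int poly" where
  "falling m = (\<Prod>i<m. [:- int i, 1:])"

lemma falling_Suc: "falling (Suc m) = falling m * [:- int m, 1:]"
  by (simp add: falling_def)

lemma falling_nonzero: "falling m \<noteq> 0"
  by (simp add: falling_def)

lemma degree_falling: "degree (falling m) = m"
proof (induction m)
  case (Suc m)
  have "degree (falling m * [:- int m, 1:]) = degree (falling m) + 1"
    by (subst degree_mult_eq) (simp_all add: falling_nonzero)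
  then show ?case using Suc by (simp add: falling_Suc del: mult_pCons_right)
qed (simp add: falling_def)

lemma lead_coeff_falling: "poly.coeff (falling m) m = 1"
proof -
  have "lead_coeff (falling m) = 1" by (simp add: falling_def lead_coeff_prod)
  then show ?thesis by (simp add: degree_falling)
qed

lemma poly_falling_eq_0: "j < m \<Longrightarrow> poly (falling m) (int j) = 0"
  by (auto simp: falling_def poly_prod prod_zero_iff)

context padic_integers
begin

lemma nth_mult_zero:
  assumes "x \<in> carrier (Zp p)" "y \<in> carrier (Zp p)" "x i = 0" "y j = 0"
  shows "(x \<otimes>\<^bsub>Zp p\<^esub> y) (i + j) = 0"
proof -
  obtain x' where x': "x' \<in> carrier (Zp p)" "x = padic_of_int p (int p ^ i) \<otimes>\<^bsub>Zp p\<^esub> x'"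
    using p_pow_divE assms by blast
  obtain y' where y': "y' \<in> carrier (Zp p)" "y = padic_of_int p (int p ^ j) \<otimes>\<^bsub>Zp p\<^esub> y'"
    using p_pow_divE assms by blast
  have "x \<otimes>\<^bsub>Zp p\<^esub> y = padic_of_int p (int p ^ (i + j)) \<otimes>\<^bsub>Zp p\<^esub> (x' \<otimes>\<^bsub>Zp p\<^esub> y')"
    using x' y' by (simp add: power_add of_int_mult Zp.m_ac)
  then show ?thesis by (simp add: nth_mult nth_of_int)
qed

lemma p_pow_mult_nth_zero_iff:
  assumes "x \<in> carrier (Zp p)"
  shows "(padic_of_int p (int p ^ i) \<otimes>\<^bsub>Zp p\<^esub> x) (i + j) = 0 \<longleftrightarrow> x j = 0"
proof
  assume "x j = 0"
  then show "(padic_of_int p (int p ^ i) \<otimes>\<^bsub>Zp p\<^esub> x) (i + j) = 0"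
    using assms by (intro nth_mult_zero) (auto simp: nth_of_int)
next
  assume "(padic_of_int p (int p ^ i) \<otimes>\<^bsub>Zp p\<^esub> x) (i + j) = 0"
  then have "int p ^ i * int p ^ j dvd int p ^ i * x (i + j)"
    by (simp add: nth_mult nth_of_int mod_simps mod_eq_0_iff_dvd power_add)
  then have "int p ^ j dvd x (i + j)" by simp
  then show "x j = 0" using nth_mod_le[OF assms, of j "i + j"] by (simp add: mod_eq_0_iff_dvd)
qed

lemma nth_zero_mono: "x \<in> carrier (Zp p) \<Longrightarrow> x n = 0 \<Longrightarrow> m \<le> n \<Longrightarrow> x m = 0"
  using nth_mod_le[of x m n] by simp

text \<open>The p-adic integer p^m / m!, so that p^m binom(X, m) is \<open>fact_quot m\<close> times
  \<open>falling m\<close>.\<close>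

definition fact_quot :: "nat \<Rightarrow> padic" where
  "fact_quot m = (THE x. x \<in> carrier (Zp p) \<and>
     padic_of_int p (fact m) \<otimes>\<^bsub>Zp p\<^esub> x = padic_of_int p (int p ^ m))"

lemma of_int_mult_cancel:
  assumes "k \<noteq> 0" "x \<in> carrier (Zp p)" "y \<in> carrier (Zp p)"
    and "padic_of_int p k \<otimes>\<^bsub>Zp p\<^esub> x = padic_of_int p k \<otimes>\<^bsub>Zp p\<^esub> y"
  shows "x = y"
  using Zp.m_lcancel[OF of_int_nonzero[OF assms(1)]] assms by simp

lemma le_mult_p_minus_1: "k \<le> k * (p - 1)"
proof -
  have "1 \<le> p - 1" using p_gt_1 by linarith
  from mult_le_mono2[OF this, of k] show ?thesis by simp
qed

text \<open>Writing m! = p^k r with r prime to p, the quotient is p^(m - k) times the inverse of the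
  unit r; k <= m holds by the Legendre bound.\<close>

lemma fact_quot_aux:
  "fact_quot m \<in> carrier (Zp p) \<and>
   padic_of_int p (fact m) \<otimes>\<^bsub>Zp p\<^esub> fact_quot m = padic_of_int p (int p ^ m) \<and>
   (n + multiplicity p (fact m :: nat) \<le> m \<longrightarrow> fact_quot m n = 0)"
proof -
  define k where "k = multiplicity p (fact m :: nat)"
  have "k \<le> m"
  proof (cases "m = 0")
    case False
    then have "k * (p - 1) < m" using multiplicity_fact_less[OF prime_p] by (simp add: k_def)
    moreover have "k \<le> k * (p - 1)" by (rule le_mult_p_minus_1)
    ultimately show ?thesis by linarith
  qed (simp add: k_def)
  obtain r where r: "(fact m :: nat) = p ^ k * r" "\<not> p dvd r"
    using multiplicity_decompose'[of "fact m :: nat" p] prime_p unfolding k_def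
    by (metis fact_nonzero not_prime_unit)
  have "padic_of_int p (int r) \<in> Units (Zp p)"
    using r by (simp add: Units_iff nth_of_int mod_eq_0_iff_dvd)
  then obtain i where i: "i \<in> carrier (Zp p)" "padic_of_int p (int r) \<otimes>\<^bsub>Zp p\<^esub> i = \<one>\<^bsub>Zp p\<^esub>"
    by (auto simp: Units_def)
  define x where "x = padic_of_int p (int p ^ (m - k)) \<otimes>\<^bsub>Zp p\<^esub> i"
  have f: "(fact m :: int) = int p ^ k * int r" using r(1) by (metis of_nat_fact of_nat_mult of_nat_power)
  have x: "x \<in> carrier (Zp p)" using i by (simp add: x_def)
  have "padic_of_int p (fact m) \<otimes>\<^bsub>Zp p\<^esub> x =
     (padic_of_int p (int p ^ k) \<otimes>\<^bsub>Zp p\<^esub> padic_of_int p (int p ^ (m - k))) \<otimes>\<^bsub>Zp p\<^esub>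
     (padic_of_int p (int r) \<otimes>\<^bsub>Zp p\<^esub> i)"
    unfolding f x_def of_int_mult using i(1) by (simp add: Zp.m_ac)
  also have "\<dots> = padic_of_int p (int p ^ m)"
    using i \<open>k \<le> m\<close> by (simp flip: of_int_mult power_add)
  finally have eq: "padic_of_int p (fact m) \<otimes>\<^bsub>Zp p\<^esub> x = padic_of_int p (int p ^ m)" .
  have fq: "fact_quot m = x" unfolding fact_quot_def
  proof (rule the_equality)
    show "x' = x" if "x' \<in> carrier (Zp p) \<and>
        padic_of_int p (fact m) \<otimes>\<^bsub>Zp p\<^esub> x' = padic_of_int p (int p ^ m)" for x'
      using that x eq of_int_mult_cancel[of "fact m" x' x] by simp
  qed (use x eq in blast)
  have "x n = 0" if "n + k \<le> m"
  proof -
    have "x (m - k) = 0" by (simp add: x_def nth_mult nth_of_int)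
    with x show ?thesis by (rule nth_zero_mono) (use that in simp)
  qed
  then show ?thesis unfolding fq using x eq unfolding k_def by blast
qed

lemma fact_quot_closed [simp]: "fact_quot m \<in> carrier (Zp p)"
  and fact_quot_eq: "padic_of_int p (fact m) \<otimes>\<^bsub>Zp p\<^esub> fact_quot m = padic_of_int p (int p ^ m)"
  and fact_quot_nth_zero: "n + multiplicity p (fact m :: nat) \<le> m \<Longrightarrow> fact_quot m n = 0"
  using fact_quot_aux[of m n] by auto

lemma fact_quot_0: "fact_quot 0 = \<one>\<^bsub>Zp p\<^esub>"
  using fact_quot_eq[of 0] by (simp add: of_int_1)

text \<open>For p > 2 and m > 0 the Legendre bound gives v_p(m!) < m / 2. Hence only the terms with
  m < 2 n of the binomial series count modulo p^n.\<close>

lemma fact_quot_nth_zero_half: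
  assumes "p > 2" "2 * n \<le> m"
  shows "fact_quot m n = 0"
proof (cases "m = 0")
  case True
  then show ?thesis using assms nth_0[OF fact_quot_closed] by simp
next
  case False
  have "multiplicity p (fact m :: nat) * 2 \<le> multiplicity p (fact m :: nat) * (p - 1)"
    using assms by (intro mult_le_mono2) simp
  also have "\<dots> < m" using False multiplicity_fact_less[OF prime_p] by simp
  finally show ?thesis using assms by (intro fact_quot_nth_zero) simp
qed

lemma fact_quot_nth_zero_small: "m < p \<Longrightarrow> n \<le> m \<Longrightarrow> fact_quot m n = 0"
  using prime_p by (intro fact_quot_nth_zero) (simp add: not_dvd_imp_multiplicity_0 prime_dvd_fact_iff)

text \<open>Source of the condition p > d + 1. Let k be the multiplicity of p in m!. If k = 0, the
  valuation of p^m / m! is m > d; otherwise k (p - 1) < m forces m - k >= p - 1 >= d + 1. At m = p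
  the valuation is exactly p - 1.\<close>

lemma fact_quot_nth_zero_large:
  assumes "d + 1 < p" "d < m"
  shows "fact_quot m (Suc d) = 0"
proof (cases "m < p")
  case True
  then show ?thesis using assms by (intro fact_quot_nth_zero_small) auto
next
  case False
  define k where "k = multiplicity p (fact m :: nat)"
  have lt: "k * (p - 1) < m" unfolding k_def using assms by (intro multiplicity_fact_less[OF prime_p]) simp
  have "Suc d + k \<le> m"
  proof (cases "k = 0")
    case False
    then obtain j where j: "k = Suc j" by (cases k) auto
    have "j \<le> j * (p - 1)" by (rule le_mult_p_minus_1)
    then have "(p - 1) + k \<le> (p - 1) + Suc (j * (p - 1))" using j by simp
    also have "\<dots> = Suc (k * (p - 1))" by (simp add: j)
    also have "\<dots> \<le> m" using lt by simp
    finally show ?thesis using assms by simp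
  qed (use assms in simp)
  then show ?thesis by (intro fact_quot_nth_zero) (simp add: k_def)
qed

section \<open>Identification of the scaled binomial polynomials\<close>

lemma const_tate_of_UP [simp]: "tate_of (\<lambda>_. Q) \<in> carrier (UP (Zp p))"
proof -
  have "bound \<zero>\<^bsub>Zp p\<^esub> (degree Q) (tate_of (\<lambda>_. Q))"
    by (rule bound.intro) (auto simp: tate_of_def coeff_eq_0 fun_eq_iff)
  then show ?thesis using coherent_const by (auto simp: UP_def intro!: mem_upI)
qed

lemma const_tate_of_mult:
  "tate_of (\<lambda>_. Q) \<otimes>\<^bsub>UP (Zp p)\<^esub> tate_of (\<lambda>_. Q') = tate_of (\<lambda>_. Q * Q')"
proof -
  have "tate_of (\<lambda>_. Q) \<in> up (Zp p)" for Q
    using const_tate_of_UP[of Q] by (simp add: UP_def)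
  then have "tate_of (\<lambda>_. Q) \<otimes>\<^bsub>UP (Zp p)\<^esub> tate_of (\<lambda>_. Q') = tate_of (\<lambda>_. Q) \<otimes>\<^bsub>tate p\<^esub> tate_of (\<lambda>_. Q')"
    by (simp add: UP_def tate_def)
  then show ?thesis by (simp add: tate_of_mult coherent_const)
qed

lemma prod_lin_factor:
  "(\<Otimes>\<^bsub>UP (Zp p)\<^esub>i\<in>{..<m}. lin_factor (Zp p) ([i] \<cdot>\<^bsub>Zp p\<^esub> \<one>\<^bsub>Zp p\<^esub>)) = tate_of (\<lambda>_. falling m)"
proof -
  interpret U: UP_domain "Zp p" "UP (Zp p)" by unfold_locales simp
  have lin: "lin_factor (Zp p) (padic_of_int p (int i)) = tate_of (\<lambda>_. [:- int i, 1:])" for i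
  proof (rule U.up_eqI)
    fix n
    show "UnivPoly.coeff (UP (Zp p)) (lin_factor (Zp p) (padic_of_int p (int i))) n =
        UnivPoly.coeff (UP (Zp p)) (tate_of (\<lambda>_. [:- int i, 1:])) n"
    proof -
      have "UnivPoly.coeff (UP (Zp p)) (tate_of (\<lambda>_. [:- int i, 1:])) n = tate_of (\<lambda>_. [:- int i, 1:]) n"
        using const_tate_of_UP[of "[:- int i, 1:]"] by (simp add: UP_def)
      also have "\<dots> = padic_of_int p (poly.coeff [:- int i, 1:] n)"
        by (simp add: tate_of_def padic_of_int_def)
      finally show ?thesis
        by (auto simp: U.lin_factor_eq a_minus_def of_int_uminus of_int_1 of_int_0 coeff_pCons split: nat.split)
    qed
  qed auto
  show ?thesis
  proof (induction m)
    case 0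
    have "\<one>\<^bsub>UP (Zp p)\<^esub> = tate_of (\<lambda>_. 1)"
      by (auto simp: UP_def tate_of_def nth_one fun_eq_iff)
    then show ?case by (simp add: falling_def)
  next
    case (Suc m)
    have "(\<Otimes>\<^bsub>UP (Zp p)\<^esub>i\<in>{..<Suc m}. lin_factor (Zp p) ([i] \<cdot>\<^bsub>Zp p\<^esub> \<one>\<^bsub>Zp p\<^esub>)) =
      lin_factor (Zp p) ([m] \<cdot>\<^bsub>Zp p\<^esub> \<one>\<^bsub>Zp p\<^esub>) \<otimes>\<^bsub>UP (Zp p)\<^esub> tate_of (\<lambda>_. falling m)"
      unfolding Suc[symmetric] lessThan_Suc by (intro U.finprod_insert) (auto simp: of_int_nat)
    also have "\<dots> = tate_of (\<lambda>_. [:- int m, 1:] * falling m)"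
      unfolding of_int_nat lin by (rule const_tate_of_mult)
    finally show ?case by (simp only: falling_Suc mult.commute[of "falling m"])
  qed
qed

text \<open>Nonzero integers can be cancelled in \<open>Zp p\<close>, hence m! can be cancelled
  coefficientwise; so the polynomial described by \<open>THE\<close> is unique and equals p^m / m!
  times the falling factorial.\<close>

lemma coeff_scaled_binomial:
  "UnivPoly.coeff (UP (Zp p)) (scaled_binomial p m) k =
    fact_quot m \<otimes>\<^bsub>Zp p\<^esub> padic_of_int p (poly.coeff (falling m) k)"
proof -
  interpret U: UP_domain "Zp p" "UP (Zp p)" by unfold_locales simp
  define B where "B = fact_quot m \<odot>\<^bsub>UP (Zp p)\<^esub> tate_of (\<lambda>_. falling m)"
  have B: "B \<in> carrier (UP (Zp p))" by (simp add: B_def)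
  have addpow: "[k] \<cdot>\<^bsub>UP (Zp p)\<^esub> x = padic_of_int p (int k) \<odot>\<^bsub>UP (Zp p)\<^esub> x" if "x \<in> carrier (UP (Zp p))" for k :: nat and x
    using U.add_pow_eq_smult[OF that, of k] by (simp add: of_int_nat)
  have eq: "[(fact m :: nat)] \<cdot>\<^bsub>UP (Zp p)\<^esub> B = [(p ^ m)] \<cdot>\<^bsub>UP (Zp p)\<^esub> tate_of (\<lambda>_. falling m)"
    using B by (simp add: addpow B_def U.smult_assoc1[symmetric] fact_quot_eq)
  have "scaled_binomial p m = B"
    unfolding scaled_binomial_def prod_lin_factor
  proof (rule the_equality)
    show "B \<in> carrier (UP (Zp p)) \<and> [(fact m :: nat)] \<cdot>\<^bsub>UP (Zp p)\<^esub> B = [(p ^ m)] \<cdot>\<^bsub>UP (Zp p)\<^esub> tate_of (\<lambda>_. falling m)"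
      using B eq by simp
  next
    fix B' assume B': "B' \<in> carrier (UP (Zp p)) \<and>
      [(fact m :: nat)] \<cdot>\<^bsub>UP (Zp p)\<^esub> B' = [(p ^ m)] \<cdot>\<^bsub>UP (Zp p)\<^esub> tate_of (\<lambda>_. falling m)"
    show "B' = B"
    proof (rule U.up_eqI)
      fix n
      define K where "K = (fact m :: nat)"
      have "padic_of_int p (int K) \<otimes>\<^bsub>Zp p\<^esub> UnivPoly.coeff (UP (Zp p)) B' n =
        UnivPoly.coeff (UP (Zp p)) ([K] \<cdot>\<^bsub>UP (Zp p)\<^esub> B') n"
        using B' by (simp add: addpow)
      also have "\<dots> = UnivPoly.coeff (UP (Zp p)) ([K] \<cdot>\<^bsub>UP (Zp p)\<^esub> B) n"
        using B' eq unfolding K_def by argo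
      also have "\<dots> = padic_of_int p (int K) \<otimes>\<^bsub>Zp p\<^esub> UnivPoly.coeff (UP (Zp p)) B n"
        using B by (simp add: addpow)
      finally show "UnivPoly.coeff (UP (Zp p)) B' n = UnivPoly.coeff (UP (Zp p)) B n"
        by (rule of_int_mult_cancel[rotated 3]) (use B B' in \<open>auto simp: K_def\<close>)
    qed (use B B' in auto)
  qed
  moreover have "UnivPoly.coeff (UP (Zp p)) (tate_of (\<lambda>_. falling m)) k = padic_of_int p (poly.coeff (falling m) k)"
    using const_tate_of_UP[of "falling m"] by (simp add: UP_def tate_of_def padic_of_int_def)
  moreover have "UnivPoly.coeff (UP (Zp p)) B k = fact_quot m \<otimes>\<^bsub>Zp p\<^esub> UnivPoly.coeff (UP (Zp p)) (tate_of (\<lambda>_. falling m)) k"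
    unfolding B_def by (intro U.coeff_smult fact_quot_closed const_tate_of_UP)
  ultimately show ?thesis by (simp only:)
qed

end

subsection \<open>Reduction modulo \<open>p\<close>\<close>

text \<open>\<open>quot_algebra\<close> extends the quotient ring to a record of another type with
  the same ring operations; this transports the ring axioms to it.\<close>

lemma cring_cong:
  assumes "cring R" "carrier S = carrier R" "monoid.mult S = monoid.mult R" "monoid.one S = monoid.one R"
    "ring.zero S = ring.zero R" "ring.add S = ring.add R"
  shows "cring S"
proof -
  interpret cring R by fact
  show ?thesis
  proof (rule cringI)
    show "abelian_group S"
      by (rule abelian_groupI) (auto simp: assms(2-) a_ac intro: l_neg)
    show "comm_monoid S"
      by (rule comm_monoidI) (auto simp: assms(2-) m_ac)
  qed (auto simp: assms(2-) l_distr)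
qed

locale padic_algebra = padic_integers p + A: algebra "Zp p" A
  for p :: nat and A :: "(padic, 'a, 'm) module_scheme" (structure)
begin

lemma p_ideal_iff: "x \<in> p_ideal p A \<longleftrightarrow> (\<exists>w\<in>carrier A. x = padic_of_int p (int p) \<odot> w)"
  unfolding p_ideal_def A.cgenideal_add_pow_iff of_int_nat ..

lemma p_ideal: "ideal (p_ideal p A) A"
  unfolding p_ideal_def by (intro A.cgenideal_ideal) simp

lemma Zp_p_ideal: "ideal (p_ideal p (Zp p)) (Zp p)"
  unfolding p_ideal_def by (intro Zp.cgenideal_ideal) simp

lemma Fp_cring: "cring (Fp p)"
  unfolding Fp_def using Zp_p_ideal by (rule ideal.quotient_is_cring) (rule Zp.is_cring)

lemma quot_simps:
  "carrier (quot_algebra p A) = carrier (A Quot p_ideal p A)"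
  "monoid.mult (quot_algebra p A) = monoid.mult (A Quot p_ideal p A)"
  "monoid.one (quot_algebra p A) = monoid.one (A Quot p_ideal p A)"
  "ring.zero (quot_algebra p A) = ring.zero (A Quot p_ideal p A)"
  "ring.add (quot_algebra p A) = ring.add (A Quot p_ideal p A)"
  "module.smult (quot_algebra p A) = (\<lambda>C X. \<Union>c\<in>C. \<Union>x\<in>X. reduce p A (c \<odot> x))"
  by (simp_all add: quot_algebra_def ring.defs module.defs)

lemma quot_cring: "cring (quot_algebra p A)"
  by (rule cring_cong[OF ideal.quotient_is_cring[OF p_ideal]])
    (simp_all add: quot_simps A.is_cring)

lemma reduce_hom: "ring_hom_cring A (quot_algebra p A) (reduce p A)"
proof -
  have "(+>) (p_ideal p A) \<in> ring_hom A (A Quot p_ideal p A)"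
    using p_ideal by (rule ideal.rcos_ring_hom)
  then have "reduce p A \<in> ring_hom A (quot_algebra p A)"
    unfolding ring_hom_def by (simp add: quot_simps reduce_def Pi_iff)
  then show ?thesis using A.is_cring quot_cring
    by (simp add: ring_hom_cring_def ring_hom_cring_axioms_def)
qed

lemma Zp_reduce_hom: "ring_hom_cring (Zp p) (Fp p) (reduce p (Zp p))"
proof -
  have "(+>\<^bsub>Zp p\<^esub>) (p_ideal p (Zp p)) \<in> ring_hom (Zp p) (Fp p)"
    unfolding Fp_def using Zp_p_ideal by (rule ideal.rcos_ring_hom)
  then have "reduce p (Zp p) \<in> ring_hom (Zp p) (Fp p)"
    unfolding ring_hom_def by (simp add: reduce_def Pi_iff)
  then show ?thesis using Zp.is_cring Fp_cring
    by (simp add: ring_hom_cring_def ring_hom_cring_axioms_def)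
qed

sublocale Fp: cring "Fp p" by (rule Fp_cring)
sublocale Q: cring "quot_algebra p A" by (rule quot_cring)
sublocale red: ring_hom_cring A "quot_algebra p A" "reduce p A" by (rule reduce_hom)
sublocale Zred: ring_hom_cring "Zp p" "Fp p" "reduce p (Zp p)" by (rule Zp_reduce_hom)

lemma reduce_surj:
  assumes "X \<in> carrier (quot_algebra p A)"
  obtains x where "x \<in> carrier A" "X = reduce p A x"
  using assms by (auto simp: quot_simps FactRing_def A_RCOSETS_defs reduce_def a_r_coset_def r_coset_def)

lemma Zp_reduce_surj:
  assumes "X \<in> carrier (Fp p)"
  obtains x where "x \<in> carrier (Zp p)" "X = reduce p (Zp p) x"
  using assms by (auto simp: Fp_def FactRing_def A_RCOSETS_defs reduce_def a_r_coset_def r_coset_def)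

lemma reduce_eq_iff:
  assumes "x \<in> carrier A" "y \<in> carrier A"
  shows "reduce p A x = reduce p A y \<longleftrightarrow> (\<exists>w\<in>carrier A. x \<ominus> y = padic_of_int p (int p) \<odot> w)"
proof -
  interpret I: ideal "p_ideal p A" A by (rule p_ideal)
  have "reduce p A x = reduce p A y \<longleftrightarrow> x \<ominus> y \<in> p_ideal p A"
    unfolding reduce_def using A.quotient_eq_iff_same_a_r_cos[OF p_ideal assms] by simp
  then show ?thesis by (simp add: p_ideal_iff)
qed

lemma reduce_zero_iff:
  assumes "x \<in> carrier A"
  shows "reduce p A x = \<zero>\<^bsub>quot_algebra p A\<^esub> \<longleftrightarrow> (\<exists>w\<in>carrier A. x = padic_of_int p (int p) \<odot> w)"
  using reduce_eq_iff[OF assms A.zero_closed] assms by (simp add: a_minus_def)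

lemma Zp_reduce_eq_iff:
  assumes "x \<in> carrier (Zp p)" "y \<in> carrier (Zp p)"
  shows "reduce p (Zp p) x = reduce p (Zp p) y \<longleftrightarrow> x 1 = y 1"
proof -
  interpret I: ideal "p_ideal p (Zp p)" "Zp p" by (rule Zp_p_ideal)
  have "reduce p (Zp p) x = reduce p (Zp p) y \<longleftrightarrow> x \<ominus>\<^bsub>Zp p\<^esub> y \<in> p_ideal p (Zp p)"
    unfolding reduce_def using Zp.quotient_eq_iff_same_a_r_cos[OF Zp_p_ideal assms] by simp
  also have "\<dots> \<longleftrightarrow> (x \<ominus>\<^bsub>Zp p\<^esub> y) 1 = 0"
    unfolding p_ideal_def of_int_nat using assms p_pow_divides_iff[of "x \<ominus>\<^bsub>Zp p\<^esub> y" 1]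
    by (simp add: Zp.cgenideal_iff_divides)
  also have "\<dots> \<longleftrightarrow> x 1 = y 1" by (rule nth_minus_eq_0_iff[OF assms])
  finally show ?thesis .
qed

lemma Zp_reduce_zero_iff:
  "x \<in> carrier (Zp p) \<Longrightarrow> reduce p (Zp p) x = \<zero>\<^bsub>Fp p\<^esub> \<longleftrightarrow> x 1 = 0"
  using Zp_reduce_eq_iff[of x "\<zero>\<^bsub>Zp p\<^esub>"] by simp

text \<open>Scalar multiplication on A / pA is a union over all representatives. Changing c by an
  element of p Z_p and x by one of pA changes c x by an element of pA, so all cosets in the union
  coincide.\<close>

lemma reduce_smult:
  assumes c: "c \<in> carrier (Zp p)" and x: "x \<in> carrier A"
  shows "reduce p (Zp p) c \<odot>\<^bsub>quot_algebra p A\<^esub> reduce p A x = reduce p A (c \<odot> x)"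
proof -
  interpret I: ideal "p_ideal p A" A by (rule p_ideal)
  interpret J: ideal "p_ideal p (Zp p)" "Zp p" by (rule Zp_p_ideal)
  have eq: "reduce p A (c' \<odot> x') = reduce p A (c \<odot> x)"
    if c'_in: "c' \<in> reduce p (Zp p) c" and x'_in: "x' \<in> reduce p A x" for c' x'
  proof -
    obtain i where i: "i \<in> p_ideal p A" "x' = i \<oplus> x"
      using x'_in by (auto simp: reduce_def a_r_coset_def r_coset_def)
    obtain j where j: "j \<in> p_ideal p (Zp p)" "c' = j \<oplus>\<^bsub>Zp p\<^esub> c"
      using c'_in by (auto simp: reduce_def a_r_coset_def r_coset_def)
    obtain w where w: "w \<in> carrier A" "i = padic_of_int p (int p) \<odot> w" using i by (auto simp: p_ideal_iff)
    obtain v where v: "v \<in> carrier (Zp p)" "j = padic_of_int p (int p) \<otimes>\<^bsub>Zp p\<^esub> v"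
      using j by (auto simp: p_ideal_def of_int_nat Zp.cgenideal_iff_divides factor_def)
    have c': "c' \<in> carrier (Zp p)" using j v c by simp
    have "c' \<odot> x' = c' \<odot> i \<oplus> (j \<odot> x \<oplus> c \<odot> x)"
      using i j w v c' c x by (simp add: A.smult_r_distr A.smult_l_distr)
    also have "c' \<odot> i = padic_of_int p (int p) \<odot> (c' \<odot> w)"
      using w c' by (simp add: A.smult_assoc1[symmetric] Zp.m_comm)
    also have "j \<odot> x = padic_of_int p (int p) \<odot> (v \<odot> x)"
      using v x by (simp add: A.smult_assoc1)
    finally have "c' \<odot> x' = padic_of_int p (int p) \<odot> (c' \<odot> w \<oplus> v \<odot> x) \<oplus> c \<odot> x"
      using c c' v w x by (simp add: A.smult_r_distr A.a_assoc)
    moreover have "reduce p A (padic_of_int p (int p) \<odot> (c' \<odot> w \<oplus> v \<odot> x)) = \<zero>\<^bsub>quot_algebra p A\<^esub>"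
      using c' v w x by (subst reduce_zero_iff) auto
    ultimately show ?thesis using c c' v w x by simp
  qed
  have "c \<in> reduce p (Zp p) c" "x \<in> reduce p A x"
    unfolding reduce_def using J.a_rcos_self[OF c] I.a_rcos_self[OF x] by auto
  then have "(\<Union>c'\<in>reduce p (Zp p) c. \<Union>x'\<in>reduce p A x. reduce p A (c' \<odot> x')) = reduce p A (c \<odot> x)"
    using eq by blast
  then show ?thesis by (simp add: quot_simps)
qed

lemma quot_algebra_is_algebra: "algebra (Fp p) (quot_algebra p A)"
proof (rule algebraI)
  fix a b X Y
  assume "a \<in> carrier (Fp p)" "b \<in> carrier (Fp p)" "X \<in> carrier (quot_algebra p A)"
  then obtain a' b' x where *: "a' \<in> carrier (Zp p)" "a = reduce p (Zp p) a'"
    "b' \<in> carrier (Zp p)" "b = reduce p (Zp p) b'" "x \<in> carrier A" "X = reduce p A x"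
    using Zp_reduce_surj reduce_surj by metis
  show "(a \<oplus>\<^bsub>Fp p\<^esub> b) \<odot>\<^bsub>quot_algebra p A\<^esub> X = a \<odot>\<^bsub>quot_algebra p A\<^esub> X \<oplus>\<^bsub>quot_algebra p A\<^esub> b \<odot>\<^bsub>quot_algebra p A\<^esub> X"
    using * by (simp add: reduce_smult A.smult_l_distr flip: Zred.hom_add red.hom_add)
  show "(a \<otimes>\<^bsub>Fp p\<^esub> b) \<odot>\<^bsub>quot_algebra p A\<^esub> X = a \<odot>\<^bsub>quot_algebra p A\<^esub> (b \<odot>\<^bsub>quot_algebra p A\<^esub> X)"
    using * by (simp add: reduce_smult A.smult_assoc1 flip: Zred.hom_mult)
next
  fix a X Y
  assume "a \<in> carrier (Fp p)" "X \<in> carrier (quot_algebra p A)" "Y \<in> carrier (quot_algebra p A)"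
  then obtain a' x y where *: "a' \<in> carrier (Zp p)" "a = reduce p (Zp p) a'"
    "y \<in> carrier A" "Y = reduce p A y" "x \<in> carrier A" "X = reduce p A x"
    using Zp_reduce_surj reduce_surj by metis
  show "a \<odot>\<^bsub>quot_algebra p A\<^esub> (X \<oplus>\<^bsub>quot_algebra p A\<^esub> Y) = a \<odot>\<^bsub>quot_algebra p A\<^esub> X \<oplus>\<^bsub>quot_algebra p A\<^esub> a \<odot>\<^bsub>quot_algebra p A\<^esub> Y"
    using * by (simp add: reduce_smult A.smult_r_distr flip: red.hom_add)
  show "a \<odot>\<^bsub>quot_algebra p A\<^esub> X \<otimes>\<^bsub>quot_algebra p A\<^esub> Y = a \<odot>\<^bsub>quot_algebra p A\<^esub> (X \<otimes>\<^bsub>quot_algebra p A\<^esub> Y)"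
    using * by (simp add: reduce_smult A.smult_assoc2 flip: red.hom_mult)
next
  fix a X
  assume "a \<in> carrier (Fp p)" "X \<in> carrier (quot_algebra p A)"
  then obtain a' x where *: "a' \<in> carrier (Zp p)" "a = reduce p (Zp p) a'"
    "x \<in> carrier A" "X = reduce p A x"
    using Zp_reduce_surj reduce_surj by metis
  show "a \<odot>\<^bsub>quot_algebra p A\<^esub> X \<in> carrier (quot_algebra p A)"
    using * by (simp add: reduce_smult)
next
  fix X
  assume "X \<in> carrier (quot_algebra p A)"
  then obtain x where *: "x \<in> carrier A" "X = reduce p A x"
    using reduce_surj by metis
  show "\<one>\<^bsub>Fp p\<^esub> \<odot>\<^bsub>quot_algebra p A\<^esub> X = X"
    using * by (simp add: reduce_smult flip: Zred.hom_one)
qed (rule Fp_cring quot_cring)+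

lemma reduce_sum:
  assumes "finite S" "g \<in> S \<rightarrow> carrier (Zp p)" "x \<in> S \<rightarrow> carrier A"
  shows "(\<Oplus>\<^bsub>quot_algebra p A\<^esub>i\<in>S. reduce p (Zp p) (g i) \<odot>\<^bsub>quot_algebra p A\<^esub> reduce p A (x i))
    = reduce p A (\<Oplus>i\<in>S. g i \<odot> x i)"
proof -
  have "(\<Oplus>\<^bsub>quot_algebra p A\<^esub>i\<in>S. reduce p (Zp p) (g i) \<odot>\<^bsub>quot_algebra p A\<^esub> reduce p A (x i))
    = (\<Oplus>\<^bsub>quot_algebra p A\<^esub>i\<in>S. reduce p A (g i \<odot> x i))"
    using assms by (intro Q.finsum_cong') (auto simp: reduce_smult Pi_iff)
  also have "\<dots> = reduce p A (\<Oplus>i\<in>S. g i \<odot> x i)"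
    using assms by (subst red.hom_finsum) (auto simp: Pi_iff comp_def)
  finally show ?thesis .
qed

text \<open>Lifts a linear combination in A / pA to A coefficient by coefficient, so that arguments
  about bases modulo p can be carried out with p-adic coordinates.\<close>

lemma reduce_lift:
  fixes n :: nat
  assumes h: "\<And>i. i < n \<Longrightarrow> h i \<in> carrier (Fp p)" and x: "\<And>i. i < n \<Longrightarrow> x i \<in> carrier A"
  obtains g where "\<And>i. i < n \<Longrightarrow> g i \<in> carrier (Zp p)" "\<And>i. i < n \<Longrightarrow> h i = reduce p (Zp p) (g i)"
    "(\<Oplus>\<^bsub>quot_algebra p A\<^esub>i\<in>{..<n}. h i \<odot>\<^bsub>quot_algebra p A\<^esub> reduce p A (x i)) = reduce p A (\<Oplus>i\<in>{..<n}. g i \<odot> x i)"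
proof -
  interpret QA: algebra "Fp p" "quot_algebra p A" by (rule quot_algebra_is_algebra)
  have "\<exists>g. g \<in> carrier (Zp p) \<and> h i = reduce p (Zp p) g" if "i < n" for i
    by (rule Zp_reduce_surj[OF h[OF that]]) auto
  then obtain g where g: "\<And>i. i < n \<Longrightarrow> g i \<in> carrier (Zp p)" "\<And>i. i < n \<Longrightarrow> h i = reduce p (Zp p) (g i)"
    by metis
  have "(\<Oplus>\<^bsub>quot_algebra p A\<^esub>i\<in>{..<n}. h i \<odot>\<^bsub>quot_algebra p A\<^esub> reduce p A (x i)) =
      (\<Oplus>\<^bsub>quot_algebra p A\<^esub>i\<in>{..<n}. reduce p (Zp p) (g i) \<odot>\<^bsub>quot_algebra p A\<^esub> reduce p A (x i))"
    using g x by (intro Q.finsum_cong') (auto intro!: QA.smult_closed)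
  also have "\<dots> = reduce p A (\<Oplus>i\<in>{..<n}. g i \<odot> x i)" using g x by (intro reduce_sum) auto
  finally show ?thesis using g that by blast
qed

end

subsection \<open>The trace series\<close>

locale free_padic_algebra = padic_algebra +
  fixes d :: nat and b :: "nat \<Rightarrow> 'a"
  assumes basis: "is_basis (Zp p) A d b"
begin

abbreviation coord :: "'a \<Rightarrow> nat \<Rightarrow> padic" where
  "coord \<equiv> coords (Zp p) A d b"

abbreviation Tr :: "'a \<Rightarrow> padic" where
  "Tr \<equiv> alg_trace (Zp p) A"

lemmas coord_closed [simp] = A.coords_closed[OF basis]
lemmas coord_linear = A.coords_linear[OF basis]
lemmas b_closed [simp] = A.basis_closed[OF basis]
lemmas Tr_linear = A.alg_trace_linear[OF basis]

lemma Tr_closed [simp]: "x \<in> carrier A \<Longrightarrow> Tr x \<in> carrier (Zp p)"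
  by (rule A.is_linearD(1)[OF Tr_linear])

lemma is_linear_minus:
  assumes f: "A.is_linear f" and "x \<in> carrier A" "y \<in> carrier A"
  shows "f (x \<ominus> y) = f x \<ominus>\<^bsub>Zp p\<^esub> f y"
proof -
  have "f (x \<ominus> y) \<oplus>\<^bsub>Zp p\<^esub> f y = f ((x \<ominus> y) \<oplus> y)"
    using assms by (simp add: A.is_linearD(2)[OF f])
  also have "(x \<ominus> y) \<oplus> y = x" using assms by (simp add: a_minus_def A.a_assoc A.l_neg)
  finally show ?thesis
    using assms A.is_linearD(1)[OF f] Zp.add.inv_solve_right[of "f (x \<ominus> y)" "f x" "f y"]
    by (simp add: a_minus_def)
qed

lemma coord_eqI:
  assumes "x \<in> carrier A" "y \<in> carrier A" "\<And>i n. i < d \<Longrightarrow> coord x i n = coord y i n"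
  shows "x = y"
proof -
  have "(\<Oplus>i\<in>{..<d}. coord x i \<odot> b i) = (\<Oplus>i\<in>{..<d}. coord y i \<odot> b i)"
    using assms by (intro A.finsum_cong') (auto simp: fun_eq_iff intro!: arg_cong2[of _ _ _ _ "(\<odot>)"])
  then show ?thesis using assms by (simp add: A.coords_sum[OF basis])
qed

text \<open>Freeness makes the p-adic filtration of A coordinatewise: the coordinates of z divided
  by p^n are the coordinates of w.\<close>

lemma p_multiple_iff:
  assumes z: "z \<in> carrier A"
  shows "(\<exists>w\<in>carrier A. z = padic_of_int p (int p ^ n) \<odot> w) \<longleftrightarrow> (\<forall>i<d. coord z i n = 0)"
proof
  assume "\<exists>w\<in>carrier A. z = padic_of_int p (int p ^ n) \<odot> w"
  then show "\<forall>i<d. coord z i n = 0"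
    using A.is_linearD(3)[OF coord_linear] by (auto simp: nth_mult nth_of_int)
next
  assume zero: "\<forall>i<d. coord z i n = 0"
  have "\<exists>w. w \<in> carrier (Zp p) \<and> coord z i = padic_of_int p (int p ^ n) \<otimes>\<^bsub>Zp p\<^esub> w" if "i < d" for i
    using p_pow_divE[of "coord z i" n] zero z that by (metis coord_closed)
  then obtain w where w: "\<And>i. i < d \<Longrightarrow> w i \<in> carrier (Zp p)"
    "\<And>i. i < d \<Longrightarrow> coord z i = padic_of_int p (int p ^ n) \<otimes>\<^bsub>Zp p\<^esub> w i" by metis
  have "z = (\<Oplus>i\<in>{..<d}. coord z i \<odot> b i)" using z by (simp add: A.coords_sum[OF basis])
  also have "\<dots> = (\<Oplus>i\<in>{..<d}. padic_of_int p (int p ^ n) \<odot> (w i \<odot> b i))"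
    using w by (intro A.finsum_cong') (auto simp: A.smult_assoc1)
  also have "\<dots> = padic_of_int p (int p ^ n) \<odot> (\<Oplus>i\<in>{..<d}. w i \<odot> b i)"
    using w by (intro A.finsum_smult_ldistr[symmetric]) auto
  finally show "\<exists>w\<in>carrier A. z = padic_of_int p (int p ^ n) \<odot> w"
    using w by (intro bexI[of _ "\<Oplus>i\<in>{..<d}. w i \<odot> b i"] A.finsum_closed) auto
qed

lemma cong_iff:
  assumes x: "x \<in> carrier A" and y: "y \<in> carrier A"
  shows "x \<ominus> y \<in> PIdl ([(p ^ n)] \<cdot> \<one>) \<longleftrightarrow> (\<forall>i<d. coord x i n = coord y i n)"
proof -
  have "coord (x \<ominus> y) i n = 0 \<longleftrightarrow> coord x i n = coord y i n" if i: "i < d" for i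
    using is_linear_minus[OF coord_linear[OF i] x y] x y i by (simp add: nth_minus_eq_0_iff)
  then show ?thesis
    unfolding A.cgenideal_add_pow_iff of_int_nat of_nat_power using p_multiple_iff[of "x \<ominus> y" n] x y by simp
qed

text \<open>Linear forms are p-adically continuous without loss of precision, which is why the trace
  can be exchanged with the limit in \<open>binomial_series\<close>.\<close>

lemma linear_cong:
  assumes f: "A.is_linear f" and x: "x \<in> carrier A" and y: "y \<in> carrier A"
    and eq: "\<And>i. i < d \<Longrightarrow> coord x i n = coord y i n"
  shows "f x n = f y n"
proof -
  have *: "f z n = (\<Sum>i<d. coord z i n * f (b i) n) mod int p ^ n" if z: "z \<in> carrier A" for z
  proof -
    have "f z n = (\<Sum>i<d. (coord z i \<otimes>\<^bsub>Zp p\<^esub> f (b i)) n) mod int p ^ n"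
      using z A.is_linearD(1)[OF f]
      by (subst A.is_linear_expand[OF basis f z]) (intro nth_finsum, auto)
    also have "\<dots> = (\<Sum>i<d. coord z i n * f (b i) n) mod int p ^ n"
      by (intro sum_mod_cong) (simp add: nth_mult)
    finally show ?thesis .
  qed
  show ?thesis unfolding *[OF x] *[OF y] using eq by simp
qed

text \<open>Being free of finite rank, A is p-adically complete and separated. From index
  \<open>g n\<close> on, entry n of every coordinate has settled; the limit is assembled from the
  settled entries, so g is also a modulus of convergence for it.\<close>

lemma padic_limit_cong:
  assumes f: "\<And>m. f m \<in> carrier A" and g: "mono g"
    and cauchy: "\<And>n N i. N \<ge> g n \<Longrightarrow> i < d \<Longrightarrow> coord (f N) i n = coord (f (g n)) i n"
  shows "padic_limit p A f \<in> carrier A"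
    and "\<And>n N i. N \<ge> g n \<Longrightarrow> i < d \<Longrightarrow> coord (f N) i n = coord (padic_limit p A f) i n"
proof -
  define l where "l = (\<lambda>i n. coord (f (g n)) i n)"
  have l: "l i \<in> carrier (Zp p)" if i: "i < d" for i
  proof -
    have "g n \<le> g (Suc n)" for n using g by (simp add: mono_def)
    then have "l i (Suc n) mod int p ^ n = l i n" for n
      using nth_mod_le[OF coord_closed[OF f i], of n "Suc n" "g (Suc n)"] cauchy[of n "g (Suc n)" i] i
      by (simp add: l_def)
    moreover have "l i n \<in> {0..<int p ^ n}" for n
      using coord_closed[OF f i, of "g n"] by (simp add: l_def carrier_iff)
    ultimately show ?thesis by (simp add: carrier_iff)
  qed
  define L where "L = (\<Oplus>i\<in>{..<d}. l i \<odot> b i)"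
  have L: "L \<in> carrier A" unfolding L_def using l by (intro A.finsum_closed) auto
  have coord_L: "coord L i = l i" if "i < d" for i
    unfolding L_def using l that by (intro A.coords_eqI[OF basis]) auto
  have lim: "coord (f N) i n = coord L i n" if "N \<ge> g n" "i < d" for N n i
    using cauchy[OF that] that by (simp add: coord_L l_def)
  have "padic_limit p A f = L"
    unfolding padic_limit_def
  proof (rule the_equality)
    show "L \<in> carrier A \<and> (\<forall>n. \<exists>N. \<forall>m\<ge>N. f m \<ominus> L \<in> PIdl ([(p ^ n)] \<cdot> \<one>))"
      using L lim by (auto simp: cong_iff f)
    fix K assume "K \<in> carrier A \<and> (\<forall>n. \<exists>N. \<forall>m\<ge>N. f m \<ominus> K \<in> PIdl ([(p ^ n)] \<cdot> \<one>))"
    then have K: "K \<in> carrier A" and K': "\<exists>N. \<forall>m\<ge>N. \<forall>i<d. coord (f m) i n = coord K i n" for n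
      by (auto simp: cong_iff f)
    show "K = L"
    proof (rule coord_eqI[OF K L])
      fix i n assume i: "i < d"
      obtain N where N: "\<forall>m\<ge>N. \<forall>i<d. coord (f m) i n = coord K i n" using K' by blast
      then show "coord K i n = coord L i n"
        using lim[of n "max N (g n)" i] i by (metis max.cobounded1 max.cobounded2)
    qed
  qed
  then show "padic_limit p A f \<in> carrier A"
    and "\<And>n N i. N \<ge> g n \<Longrightarrow> i < d \<Longrightarrow> coord (f N) i n = coord (padic_limit p A f) i n"
    using L lim by auto
qed

lemma trace_coeff_closed:
  assumes "U \<in> carrier A" "y \<in> carrier A" "c \<in> carrier (Zp p)"
  shows "trace_coeff p A U y c m \<in> carrier (Zp p)"
  using assms by (simp add: trace_coeff_def)

text \<open>Modulo p^n the binomial series is a finite sum and the trace passes through it. The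
  cut-off N is left free so that it can exceed 2 n, which leaves room for the later division by
  p^s.\<close>

lemma trace_series_nth:
  assumes U: "U \<in> carrier A" and y: "y \<in> carrier A" and c: "c \<in> carrier (Zp p)"
    and p: "p > 2" and N: "N \<ge> 2 * n"
  shows "trace_series p A U y c k n =
    (\<Sum>m\<le>N. (fact_quot m \<otimes>\<^bsub>Zp p\<^esub> trace_coeff p A U y c m) n * poly.coeff (falling m) k) mod int p ^ n"
proof -
  define \<beta> where "\<beta> = (\<lambda>m. fact_quot m \<otimes>\<^bsub>Zp p\<^esub> padic_of_int p (poly.coeff (falling m) k))"
  have \<beta>: "\<beta> m \<in> carrier (Zp p)" for m by (simp add: \<beta>_def)
  define f where "f = (\<lambda>N. \<Oplus>m\<in>{..N}. \<beta> m \<odot> U [^] m)"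
  have f: "f N \<in> carrier A" for N unfolding f_def using U \<beta> by (intro A.finsum_closed) auto
  have B: "binomial_series p A U k = padic_limit p A f"
    unfolding binomial_series_def f_def \<beta>_def by (simp add: coeff_scaled_binomial)
  have cauchy: "coord (f N) i n = coord (f (2 * n)) i n" if "N \<ge> 2 * n" and i: "i < d" for N n i
    using that(1)
  proof (induction N rule: dec_induct)
    case (step N)
    have "f (Suc N) = \<beta> (Suc N) \<odot> U [^] Suc N \<oplus> f N"
      unfolding f_def atMost_Suc using U \<beta> by (intro A.finsum_insert) auto
    then have "coord (f (Suc N)) i = \<beta> (Suc N) \<otimes>\<^bsub>Zp p\<^esub> coord (U [^] Suc N) i \<oplus>\<^bsub>Zp p\<^esub> coord (f N) i"
      using A.is_linearD(2,3)[OF coord_linear[OF i]] \<beta> U f by (simp del: A.nat_pow_Suc)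
    moreover have "\<beta> (Suc N) n = 0"
      using step p fact_quot_nth_zero_half[of n "Suc N"] by (simp add: \<beta>_def nth_mult)
    ultimately have "coord (f (Suc N)) i n = coord (f N) i n mod int p ^ n"
      by (simp add: nth_add nth_mult mod_simps)
    then show ?case using step.IH f i by simp
  qed simp
  have mono: "mono (\<lambda>n::nat. 2 * n)" by (simp add: mono_def)
  note lim = padic_limit_cong[OF f mono cauchy, folded B]
  have term_closed: "\<beta> m \<otimes>\<^bsub>Zp p\<^esub> Tr (y \<otimes> U [^] m) \<in> carrier (Zp p)" for m using \<beta> y U by simp
  have "Tr (y \<otimes> binomial_series p A U k) n = Tr (y \<otimes> f N) n"
    using lim N f y by (intro linear_cong[OF A.is_linear_mult[OF Tr_linear y]]) auto
  also have "Tr (y \<otimes> f N) = (\<Oplus>\<^bsub>Zp p\<^esub>m\<in>{..N}. \<beta> m \<otimes>\<^bsub>Zp p\<^esub> Tr (y \<otimes> U [^] m))"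
    unfolding f_def using \<beta> U by (intro A.is_linear_sum[OF A.is_linear_mult[OF Tr_linear y]]) auto
  finally have main: "Tr (y \<otimes> binomial_series p A U k) n =
      (\<Sum>m\<le>N. (\<beta> m \<otimes>\<^bsub>Zp p\<^esub> Tr (y \<otimes> U [^] m)) n) mod int p ^ n"
    using term_closed by (simp add: nth_finsum)
  define e where "e = (if k = 0 then c else \<zero>\<^bsub>Zp p\<^esub>)"
  have e: "e \<in> carrier (Zp p)" using c by (simp add: e_def)
  have "trace_series p A U y c k n = (Tr (y \<otimes> binomial_series p A U k) n - e n) mod int p ^ n"
    using lim(1) y e by (simp add: trace_series_def e_def[symmetric] nth_minus)
  also have "\<dots> = ((\<Sum>m\<le>N. (\<beta> m \<otimes>\<^bsub>Zp p\<^esub> Tr (y \<otimes> U [^] m)) n) - e n) mod int p ^ n"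
    by (simp add: main mod_simps)
  \<comment> \<open>The constant c is absorbed into the summand m = 0, where it turns Tr(y) into
    C_0. This fits every k because \<open>falling 0\<close> is the constant 1.\<close>
  also have "(\<Sum>m\<le>N. (\<beta> m \<otimes>\<^bsub>Zp p\<^esub> Tr (y \<otimes> U [^] m)) n) - e n =
    (\<Sum>m\<le>N. (\<beta> m \<otimes>\<^bsub>Zp p\<^esub> Tr (y \<otimes> U [^] m)) n - (if m = 0 then e n else 0))"
    by (simp add: sum_subtractf sum.delta)
  also have "\<dots> mod int p ^ n =
    (\<Sum>m\<le>N. (fact_quot m \<otimes>\<^bsub>Zp p\<^esub> trace_coeff p A U y c m) n * poly.coeff (falling m) k) mod int p ^ n"
  proof (rule sum_mod_cong)
    fix m
    show "((\<beta> m \<otimes>\<^bsub>Zp p\<^esub> Tr (y \<otimes> U [^] m)) n - (if m = 0 then e n else 0)) mod int p ^ n =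
      (fact_quot m \<otimes>\<^bsub>Zp p\<^esub> trace_coeff p A U y c m) n * poly.coeff (falling m) k mod int p ^ n"
    proof (cases "m = 0")
      case True
      then show ?thesis using y c U
        by (auto simp: \<beta>_def e_def trace_coeff_def fact_quot_0 falling_def of_int_0 of_int_1 nth_minus)
    next
      case False
      then show ?thesis
        by (simp add: \<beta>_def trace_coeff_def nth_mult nth_of_int mod_simps ac_simps)
    qed
  qed
  finally show ?thesis .
qed

text \<open>If all traces of y z are divisible by p, the quotients by p form a linear form, as Z_p
  is torsion-free. Surjectivity onto the dual represents it by some w; then p w and y induce the
  same form, and injectivity gives y = p w.\<close>

lemma trace_nondegenerate:
  assumes et: "finite_etale (Zp p) A d" and y: "y \<in> carrier A"
    and zero: "\<And>z. z \<in> carrier A \<Longrightarrow> Tr (y \<otimes> z) 1 = 0"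
  shows "\<exists>w\<in>carrier A. y = padic_of_int p (int p) \<odot> w"
proof -
  let ?P = "padic_of_int p (int p)"
  let ?\<Phi> = "\<lambda>x. \<lambda>z\<in>carrier A. Tr (x \<otimes> z)"
  have bij: "bij_betw ?\<Phi> (carrier A) (linear_forms (Zp p) A)" using et by (simp add: finite_etale_def)
  have "\<exists>v. v \<in> carrier (Zp p) \<and> Tr (y \<otimes> z) = ?P \<otimes>\<^bsub>Zp p\<^esub> v" if "z \<in> carrier A" for z
    using p_pow_divE[of "Tr (y \<otimes> z)" 1] zero[OF that] y that by (metis A.m_closed Tr_closed power_one_right)
  then obtain f where f: "\<And>z. z \<in> carrier A \<Longrightarrow> f z \<in> carrier (Zp p)"
    "\<And>z. z \<in> carrier A \<Longrightarrow> Tr (y \<otimes> z) = ?P \<otimes>\<^bsub>Zp p\<^esub> f z" by metis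
  note lin = A.is_linear_mult[OF Tr_linear y]
  have cancel: "u = v" if "u \<in> carrier (Zp p)" "v \<in> carrier (Zp p)" "?P \<otimes>\<^bsub>Zp p\<^esub> u = ?P \<otimes>\<^bsub>Zp p\<^esub> v" for u v
    by (rule of_int_mult_cancel[OF _ that]) simp
  have "restrict f (carrier A) \<in> linear_forms (Zp p) A"
    unfolding linear_forms_def
  proof (intro CollectI conjI ballI)
    show "restrict f (carrier A) \<in> carrier A \<rightarrow>\<^sub>E carrier (Zp p)" using f by auto
  next
    fix x z assume xz: "x \<in> carrier A" "z \<in> carrier A"
    have "?P \<otimes>\<^bsub>Zp p\<^esub> f (x \<oplus> z) = ?P \<otimes>\<^bsub>Zp p\<^esub> (f x \<oplus>\<^bsub>Zp p\<^esub> f z)"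
      using A.is_linearD(2)[OF lin xz] f xz by (simp add: Zp.r_distr)
    then have "f (x \<oplus> z) = f x \<oplus>\<^bsub>Zp p\<^esub> f z"
      using f xz by (blast intro: cancel A.a_closed Zp.a_closed)
    then show "restrict f (carrier A) (x \<oplus> z) = restrict f (carrier A) x \<oplus>\<^bsub>Zp p\<^esub> restrict f (carrier A) z"
      using xz by simp
  next
    fix a x assume ax: "a \<in> carrier (Zp p)" "x \<in> carrier A"
    have "?P \<otimes>\<^bsub>Zp p\<^esub> f (a \<odot> x) = ?P \<otimes>\<^bsub>Zp p\<^esub> (a \<otimes>\<^bsub>Zp p\<^esub> f x)"
      using A.is_linearD(3)[OF lin ax] f ax by (simp add: Zp.m_lcomm)
    then have "f (a \<odot> x) = a \<otimes>\<^bsub>Zp p\<^esub> f x"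
      using f ax by (blast intro: cancel A.smult_closed Zp.m_closed)
    then show "restrict f (carrier A) (a \<odot> x) = a \<otimes>\<^bsub>Zp p\<^esub> restrict f (carrier A) x"
      using ax by simp
  qed
  then have "restrict f (carrier A) \<in> ?\<Phi> ` carrier A"
    using bij_betw_imp_surj_on[OF bij] by (simp only:)
  then obtain w where w: "w \<in> carrier A" "?\<Phi> w = restrict f (carrier A)"
    by (elim imageE) (erule that, erule sym)
  have "Tr (?P \<odot> w \<otimes> z) = Tr (y \<otimes> z)" if z: "z \<in> carrier A" for z
  proof -
    have "Tr (?P \<odot> w \<otimes> z) = ?P \<otimes>\<^bsub>Zp p\<^esub> Tr (w \<otimes> z)"
      using w z by (simp add: A.smult_assoc2 A.is_linearD(3)[OF Tr_linear])
    also have "Tr (w \<otimes> z) = f z" using fun_cong[OF w(2), of z] z by simp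
    finally show ?thesis using f z by simp
  qed
  then have "?\<Phi> (?P \<odot> w) = ?\<Phi> y" by (intro restrict_ext) auto
  then have "?P \<odot> w = y"
    using w y by (intro inj_onD[OF bij_betw_imp_inj_on[OF bij]]) auto
  then show ?thesis using w by auto
qed

end

context free_padic_algebra
begin

text \<open>Multiplying the power basis of \<open>A / p A\<close> by the unit \<open>\<omega>\<close> gives the basis
  \<open>\<omega>, \<dots>, \<omega> ^ d\<close>, so \<open>x \<noteq> 0\<close> pairs nontrivially with one of these powers.\<close>

lemma ex_trace_coeff_unit:
  assumes et: "finite_etale (Zp p) A d" and U: "U \<in> carrier A" and y: "y \<in> carrier A"
    and pow: "is_basis (Fp p) (quot_algebra p A) d (\<lambda>i. reduce p A U [^]\<^bsub>quot_algebra p A\<^esub> i)"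
    and unit: "reduce p A U \<in> Units (quot_algebra p A)"
    and nz: "reduce p A y \<noteq> \<zero>\<^bsub>quot_algebra p A\<^esub>"
  shows "\<exists>m\<in>{1..d}. Tr (y \<otimes> U [^] m) 1 \<noteq> 0"
proof (rule ccontr)
  assume neg: "\<not> ?thesis"
  have zero: "Tr (y \<otimes> U [^] Suc i) 1 = 0" if "i < d" for i
  proof -
    have "Suc i \<in> {1..d}" using that by simp
    then show ?thesis using neg by blast
  qed
  obtain X where X: "X \<in> carrier (quot_algebra p A)"
    "reduce p A U \<otimes>\<^bsub>quot_algebra p A\<^esub> X = \<one>\<^bsub>quot_algebra p A\<^esub>"
    using unit by (auto simp: Units_def)
  obtain V where V: "V \<in> carrier A" "X = reduce p A V" using reduce_surj[OF X(1)] .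
  have UV: "reduce p A (U \<otimes> V) = \<one>\<^bsub>quot_algebra p A\<^esub>" using X V U by simp
  let ?P = "padic_of_int p (int p)"
  have red_zero: "Tr (y \<otimes> w) 1 = 0" if w: "w \<in> carrier A" "reduce p A w = \<zero>\<^bsub>quot_algebra p A\<^esub>" for w
  proof -
    obtain v where "v \<in> carrier A" "w = ?P \<odot> v" using reduce_zero_iff w by auto
    then show ?thesis
      using A.is_linearD(3)[OF A.is_linear_mult[OF Tr_linear y]] by (simp add: nth_mult nth_of_int)
  qed
  have "Tr (y \<otimes> z) 1 = 0" if z: "z \<in> carrier A" for z
  proof -
    interpret QA: algebra "Fp p" "quot_algebra p A" by (rule quot_algebra_is_algebra)
    \<comment> \<open>Not z but z V, that is z divided by \<open>\<omega>\<close> modulo p, is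
      expanded in the power basis; multiplying back by U then raises the exponents from 0, ..., d -
      1 to 1, ..., d.\<close>
    define f where "f = coords (Fp p) (quot_algebra p A) d (\<lambda>i. reduce p A U [^]\<^bsub>quot_algebra p A\<^esub> i) (reduce p A (z \<otimes> V))"
    have f: "f i \<in> carrier (Fp p)" if "i < d" for i
      unfolding f_def using QA.coords_closed[OF pow _ that] z V by simp
    have fs: "(\<Oplus>\<^bsub>quot_algebra p A\<^esub>i\<in>{..<d}. f i \<odot>\<^bsub>quot_algebra p A\<^esub> reduce p A U [^]\<^bsub>quot_algebra p A\<^esub> i)
        = reduce p A (z \<otimes> V)"
      unfolding f_def using z V by (intro QA.coords_sum[OF pow]) simp
    obtain g where g: "\<And>i. i < d \<Longrightarrow> g i \<in> carrier (Zp p)" "\<And>i. i < d \<Longrightarrow> f i = reduce p (Zp p) (g i)"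
        "(\<Oplus>\<^bsub>quot_algebra p A\<^esub>i\<in>{..<d}. f i \<odot>\<^bsub>quot_algebra p A\<^esub> reduce p A (U [^] i)) = reduce p A (\<Oplus>i\<in>{..<d}. g i \<odot> U [^] i)"
      by (rule reduce_lift[of d f "\<lambda>i. U [^] i"]) (use f U in auto)
    define t where "t = (\<Oplus>i\<in>{..<d}. g i \<odot> U [^] i)"
    have t: "t \<in> carrier A" unfolding t_def using g U by (intro A.finsum_closed) auto
    have "reduce p A U [^]\<^bsub>quot_algebra p A\<^esub> i = reduce p A (U [^] i)" for i :: nat
      using U by simp
    then have "reduce p A (z \<otimes> V) = reduce p A t"
      using fs g(3) unfolding t_def by (simp only:)
    moreover have "reduce p A z = reduce p A (z \<otimes> V) \<otimes>\<^bsub>quot_algebra p A\<^esub> reduce p A U"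
    proof -
      have "reduce p A (z \<otimes> V) \<otimes>\<^bsub>quot_algebra p A\<^esub> reduce p A U = reduce p A (z \<otimes> V \<otimes> U)"
        using z V U by simp
      also have "z \<otimes> V \<otimes> U = z \<otimes> (U \<otimes> V)" using z V(1) U by (simp add: A.m_ac)
      also have "reduce p A \<dots> = reduce p A z" using z V(1) U UV by (simp add: red.hom_mult[of z "U \<otimes> V"] del: red.hom_mult)
      finally show ?thesis by simp
    qed
    ultimately have "reduce p A z = reduce p A (t \<otimes> U)" using t U by simp
    then have "reduce p A (z \<ominus> t \<otimes> U) = \<zero>\<^bsub>quot_algebra p A\<^esub>"
      using z t U by (simp add: a_minus_def Q.r_neg)
    then have "Tr (y \<otimes> (z \<ominus> t \<otimes> U)) 1 = 0" using z t U by (intro red_zero) auto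
    then have "Tr (y \<otimes> z) 1 = Tr (y \<otimes> (t \<otimes> U)) 1"
      using is_linear_minus[OF A.is_linear_mult[OF Tr_linear y], of z "t \<otimes> U"] z t U y
      by (simp add: nth_minus_eq_0_iff)
    also have "t \<otimes> U = (\<Oplus>i\<in>{..<d}. g i \<odot> U [^] Suc i)"
    proof -
      have "t \<otimes> U = (\<Oplus>i\<in>{..<d}. g i \<odot> U [^] i \<otimes> U)"
        unfolding t_def using g U by (intro A.finsum_ldistr) auto
      also have "\<dots> = (\<Oplus>i\<in>{..<d}. g i \<odot> U [^] Suc i)"
        using g U by (intro A.finsum_cong') (auto simp: A.smult_assoc2)
      finally show ?thesis .
    qed
    also have "Tr (y \<otimes> (\<Oplus>i\<in>{..<d}. g i \<odot> U [^] Suc i)) = (\<Oplus>\<^bsub>Zp p\<^esub>i\<in>{..<d}. g i \<otimes>\<^bsub>Zp p\<^esub> Tr (y \<otimes> U [^] Suc i))"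
      using g U by (intro A.is_linear_sum[OF A.is_linear_mult[OF Tr_linear y]]) auto
    also have "\<dots> 1 = (\<Sum>i<d. (g i \<otimes>\<^bsub>Zp p\<^esub> Tr (y \<otimes> U [^] Suc i)) 1) mod int p ^ 1"
      using g U y by (intro nth_finsum) auto
    also have "(\<Sum>i<d. (g i \<otimes>\<^bsub>Zp p\<^esub> Tr (y \<otimes> U [^] Suc i)) 1) = 0"
      using zero by (intro sum.neutral) (auto simp: nth_mult)
    finally show ?thesis by simp
  qed
  then show False using trace_nondegenerate[OF et y] nz reduce_zero_iff[OF y] by blast
qed

end

section \<open>The normalized trace series and its reduction\<close>

locale trace_expansion = free_padic_algebra +
  fixes U y :: 'a and c :: padic
  assumes U_closed: "U \<in> carrier A" and y_closed: "y \<in> carrier A" and c_closed: "c \<in> carrier (Zp p)"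
    and p_gt: "p > d + 1" and trace_unit: "\<exists>m\<in>{1..d}. Tr (y \<otimes> U [^] m) 1 \<noteq> 0"
begin

abbreviation C :: "nat \<Rightarrow> padic" where
  "C \<equiv> trace_coeff p A U y c"

text \<open>\<open>the_enat\<close> loses nothing: the minimum is finite, since a unit C_m with 1 <=
  m <= d contributes the value m.\<close>

definition s :: nat where
  "s = the_enat (min_valuation p d C)"

lemma C_closed [simp]: "C m \<in> carrier (Zp p)"
  using U_closed y_closed c_closed by (rule trace_coeff_closed)

lemma p_gt_2: "p > 2"
  using p_gt trace_unit by auto

lemma min_valuation_eq: "min_valuation p d C = enat s" and s_le: "s \<le> d"
proof -
  obtain m where m: "m \<in> {1..d}" "C m 1 \<noteq> 0" using trace_unit by (force simp: trace_coeff_def)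
  have "min_valuation p d C \<le> enat m + vp p (C m)"
    unfolding min_valuation_def using m by (intro Min_le) auto
  also have "vp p (C m) = 0"
    using vp_ge_iff[OF C_closed, of 1 m] m by (cases "vp p (C m)") (auto simp: zero_enat_def)
  finally have "min_valuation p d C \<le> enat d"
    using m by (metis add.right_neutral atLeastAtMost_iff enat_ord_simps(1) order_trans)
  then show "min_valuation p d C = enat s" "s \<le> d"
    unfolding s_def by (cases "min_valuation p d C"; simp)+
qed

lemma C_0_nth: "C 0 s = 0"
proof -
  have "enat s \<le> vp p (C 0)"
    unfolding min_valuation_eq[symmetric] min_valuation_def by (intro Min_le) auto
  then show ?thesis by (simp add: vp_ge_iff)
qed

lemma C_nth:
  assumes "1 \<le> m" "m \<le> d" "m \<le> s"
  shows "C m (s - m) = 0"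
proof -
  have "enat s \<le> enat m + vp p (C m)"
    unfolding min_valuation_eq[symmetric] min_valuation_def using assms by (intro Min_le) auto
  then have "enat (s - m) \<le> vp p (C m)" using assms by (cases "vp p (C m)") auto
  then show ?thesis by (simp add: vp_ge_iff)
qed

lemma min_attained:
  obtains "C 0 (s + 1) \<noteq> 0" | m where "1 \<le> m" "m \<le> d" "m \<le> s" "C m (s - m + 1) \<noteq> 0"
proof -
  have "enat s \<in> insert (vp p (C 0)) ((\<lambda>m. enat m + vp p (C m)) ` {1..d})"
    unfolding min_valuation_eq[symmetric] min_valuation_def by (intro Min_in) auto
  then consider "vp p (C 0) = enat s" | m where "m \<in> {1..d}" "enat s = enat m + vp p (C m)"
    by auto
  then show ?thesis
  proof cases
    case 1
    then have "C 0 (s + 1) \<noteq> 0" using vp_ge_iff[OF C_closed, of "s + 1" 0] by auto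
    then show ?thesis by (rule that)
  next
    case (2 m)
    then obtain v where v: "vp p (C m) = enat v" "s = m + v" by (cases "vp p (C m)") auto
    then have "C m (v + 1) \<noteq> 0" using vp_ge_iff[OF C_closed, of "v + 1" m] by auto
    then show ?thesis using that(2)[of m] 2 v by auto
  qed
qed

text \<open>For m <= s the definition of s supplies the powers missing from p^m; for s < m <= d the
  factor p^m / m! suffices alone; beyond d that factor is divisible even by p^(d + 1), and s <=
  d.\<close>

lemma scaled_coeff_nth: "(fact_quot m \<otimes>\<^bsub>Zp p\<^esub> C m) s = 0"
proof -
  consider "m = 0" | "1 \<le> m" "m \<le> d" "m \<le> s" | "1 \<le> m" "m \<le> d" "s < m" | "d < m" by linarith
  then show ?thesis
  proof cases
    case 1
    then show ?thesis using C_0_nth by (simp add: nth_mult)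
  next
    case 2
    have "(fact_quot m \<otimes>\<^bsub>Zp p\<^esub> C m) (m + (s - m)) = 0"
      using C_nth 2 p_gt by (intro nth_mult_zero) (auto simp: fact_quot_nth_zero_small)
    then show ?thesis using 2 by simp
  next
    case 3
    then have "fact_quot m s = 0" using p_gt by (intro fact_quot_nth_zero_small) auto
    then show ?thesis by (simp add: nth_mult)
  next
    case 4
    then have "fact_quot m (Suc d) = 0" using p_gt by (intro fact_quot_nth_zero_large) auto
    then have "fact_quot m s = 0" using s_le nth_zero_mono[of "fact_quot m" "Suc d" s] by simp
    then show ?thesis by (simp add: nth_mult)
  qed
qed

text \<open>The coefficient of the falling factorial of index m in p^-s F_c, that is p^(m - s) C_m /
  m!.\<close>

definition D :: "nat \<Rightarrow> padic" where
  "D m = (SOME x. x \<in> carrier (Zp p) \<and>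
     fact_quot m \<otimes>\<^bsub>Zp p\<^esub> C m = padic_of_int p (int p ^ s) \<otimes>\<^bsub>Zp p\<^esub> x)"

lemma D_closed [simp]: "D m \<in> carrier (Zp p)"
  and D_eq: "fact_quot m \<otimes>\<^bsub>Zp p\<^esub> C m = padic_of_int p (int p ^ s) \<otimes>\<^bsub>Zp p\<^esub> D m"
proof -
  have "\<exists>x. x \<in> carrier (Zp p) \<and> fact_quot m \<otimes>\<^bsub>Zp p\<^esub> C m = padic_of_int p (int p ^ s) \<otimes>\<^bsub>Zp p\<^esub> x"
    using p_pow_divE[of "fact_quot m \<otimes>\<^bsub>Zp p\<^esub> C m" s] scaled_coeff_nth[of m] by (metis C_closed Zp.m_closed fact_quot_closed)
  from someI_ex[OF this] show "D m \<in> carrier (Zp p)"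
    "fact_quot m \<otimes>\<^bsub>Zp p\<^esub> C m = padic_of_int p (int p ^ s) \<otimes>\<^bsub>Zp p\<^esub> D m"
    unfolding D_def by auto
qed

lemma D_nth_zero_iff: "D m n = 0 \<longleftrightarrow> (fact_quot m \<otimes>\<^bsub>Zp p\<^esub> C m) (s + n) = 0"
  unfolding D_eq by (rule p_pow_mult_nth_zero_iff[symmetric]) simp

lemma D_tail: "2 * (n + s) \<le> m \<Longrightarrow> D m n = 0"
  unfolding D_nth_zero_iff using fact_quot_nth_zero_half[OF p_gt_2, of "n + s" m]
  by (simp add: nth_mult add.commute)

text \<open>Dividing p^(d + 1) by p^s with s <= d leaves at least one factor p, so the terms beyond
  d disappear from the reduction.\<close>

lemma D_high: "d < m \<Longrightarrow> D m 1 = 0"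
  unfolding D_nth_zero_iff using fact_quot_nth_zero_large[of d m] p_gt s_le
    nth_zero_mono[of "fact_quot m" "Suc d" "s + 1"]
  by (simp add: nth_mult)

text \<open>An index m where the minimum s is attained works: if p divided D_m, multiplying (p^m /
  m!) C_m by m! would make p^m C_m divisible by p^(s + 1).\<close>

lemma D_unit: "\<exists>m\<le>d. D m 1 \<noteq> 0"
proof (cases rule: min_attained)
  case 1
  then have "D 0 1 \<noteq> 0" unfolding D_nth_zero_iff by (simp add: fact_quot_0)
  then show ?thesis by blast
next
  case (2 m)
  have "D m 1 \<noteq> 0"
  proof
    assume "D m 1 = 0"
    then have "(fact_quot m \<otimes>\<^bsub>Zp p\<^esub> C m) (s + 1) = 0" by (simp only: D_nth_zero_iff)
    then have "(padic_of_int p (fact m) \<otimes>\<^bsub>Zp p\<^esub> (fact_quot m \<otimes>\<^bsub>Zp p\<^esub> C m)) (s + 1) = 0"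
      by (simp only: nth_mult) simp
    also have "padic_of_int p (fact m) \<otimes>\<^bsub>Zp p\<^esub> (fact_quot m \<otimes>\<^bsub>Zp p\<^esub> C m) = padic_of_int p (int p ^ m) \<otimes>\<^bsub>Zp p\<^esub> C m"
      by (simp add: fact_quot_eq flip: Zp.m_assoc)
    finally have "(padic_of_int p (int p ^ m) \<otimes>\<^bsub>Zp p\<^esub> C m) (m + (s - m + 1)) = 0" using 2 by simp
    then show False using 2 p_pow_mult_nth_zero_iff[OF C_closed] by blast
  qed
  then show ?thesis using 2 by blast
qed

text \<open>Approximates p^-s F_c modulo p^n. The range 2 (n + s) comes from \<open>D_tail\<close>:
  beyond it p^m / m! is divisible by p^(n + s), which after division by p^s still leaves
  p^n.\<close>

definition G :: "nat \<Rightarrow> int poly" where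
  "G n = (\<Sum>m\<le>2 * (n + s). [:D m n:] * falling m)"

lemma coeff_G_cong:
  assumes "2 * (n + s) \<le> N" "n \<le> n'"
  shows "(\<Sum>m\<le>N. D m n' * poly.coeff (falling m) k) mod int p ^ n = poly.coeff (G n) k mod int p ^ n"
proof -
  have "(\<Sum>m\<le>N. D m n' * poly.coeff (falling m) k) mod int p ^ n
    = (\<Sum>m\<le>N. D m n * poly.coeff (falling m) k) mod int p ^ n"
  proof (rule sum_mod_cong)
    fix m
    have "D m n' * poly.coeff (falling m) k mod int p ^ n = (D m n' mod int p ^ n) * poly.coeff (falling m) k mod int p ^ n"
      by (simp only: mod_mult_left_eq)
    then show "D m n' * poly.coeff (falling m) k mod int p ^ n = D m n * poly.coeff (falling m) k mod int p ^ n"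
      using nth_mod_le[OF D_closed assms(2)] by simp
  qed
  also have "(\<Sum>m\<le>N. D m n * poly.coeff (falling m) k) = (\<Sum>m\<le>2 * (n + s). D m n * poly.coeff (falling m) k)"
    using assms(1) D_tail by (intro sum.mono_neutral_right) auto
  finally show ?thesis by (simp add: G_def coeff_sum)
qed

lemma coherent_G: "coherent G"
  unfolding coherent_def const_poly_dvd_iff
proof (intro allI)
  fix n k
  have "poly.coeff (G (Suc n)) k = (\<Sum>m\<le>2 * (Suc n + s). D m (Suc n) * poly.coeff (falling m) k)"
    by (simp add: G_def coeff_sum)
  then have "poly.coeff (G (Suc n)) k mod int p ^ n = poly.coeff (G n) k mod int p ^ n"
    using coeff_G_cong[of n "2 * (Suc n + s)" "Suc n" k] by simp
  then show "int p ^ n dvd poly.coeff (G (Suc n) - G n) k" by (simp add: mod_eq_dvd_iff)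
qed

lemma trace_series_eq: "trace_series p A U y c = tate_of (\<lambda>n. [:int p ^ s:] * G n)"
proof (intro ext)
  fix k n
  define N where "N = 2 * (n + s)"
  have "trace_series p A U y c k n =
      (\<Sum>m\<le>N. (fact_quot m \<otimes>\<^bsub>Zp p\<^esub> C m) n * poly.coeff (falling m) k) mod int p ^ n"
    using U_closed y_closed c_closed p_gt_2 by (intro trace_series_nth) (auto simp: N_def)
  also have "\<dots> = (\<Sum>m\<le>N. int p ^ s * (D m n * poly.coeff (falling m) k)) mod int p ^ n"
    unfolding D_eq by (intro sum_mod_cong) (simp add: nth_mult nth_of_int mod_simps mult.assoc)
  finally show "trace_series p A U y c k n = tate_of (\<lambda>n. [:int p ^ s:] * G n) k n"
    by (simp add: tate_of_def G_def N_def coeff_sum sum_distrib_left ac_simps)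
qed

text \<open>The degree of the reduction of p^-s F_c, falling factorials being monic of increasing
  degree. The restriction to m <= d makes the set finite and excludes no unit by
  \<open>D_high\<close>.\<close>

definition e :: nat where
  "e = Max {m. m \<le> d \<and> D m 1 \<noteq> 0}"

lemma e_le: "e \<le> d" and D_e: "D e 1 \<noteq> 0" and D_above: "m > e \<Longrightarrow> D m 1 = 0"
proof -
  have fin: "finite {m. m \<le> d \<and> D m 1 \<noteq> 0}" by simp
  have "e \<in> {m. m \<le> d \<and> D m 1 \<noteq> 0}" unfolding e_def using D_unit by (intro Max_in) auto
  then show "e \<le> d" "D e 1 \<noteq> 0" by auto
  show "D m 1 = 0" if "m > e"
  proof (rule ccontr)
    assume "D m 1 \<noteq> 0"
    then have "m \<in> {m. m \<le> d \<and> D m 1 \<noteq> 0}" using D_high[of m] by (cases "m \<le> d") auto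
    then have "m \<le> e" unfolding e_def by (rule Max_ge[OF fin])
    then show False using that by simp
  qed
qed

lemma coeff_G_1: "poly.coeff (G 1) k = (\<Sum>m\<le>2 * (1 + s). D m 1 * poly.coeff (falling m) k)"
  by (simp add: G_def coeff_sum)

lemma coeff_G_1_above: "k > e \<Longrightarrow> poly.coeff (G 1) k = 0"
  unfolding coeff_G_1
proof (intro sum.neutral ballI)
  fix m assume "k > e"
  then show "D m 1 * poly.coeff (falling m) k = 0"
    using D_above[of m] by (cases "m > e") (auto simp: coeff_eq_0 degree_falling)
qed

lemma coeff_G_1_lead: "poly.coeff (G 1) e = D e 1"
proof -
  \<comment> \<open>The leading term has to lie inside the truncated sum; otherwise
    \<open>D_tail\<close> would make D_e vanish modulo p.\<close>
  have "e \<le> 2 * (1 + s)" using D_e D_tail[of 1 e] by (cases "e \<le> 2 * (1 + s)") auto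
  then have "poly.coeff (G 1) e = (\<Sum>m\<in>{e}. D m 1 * poly.coeff (falling m) e)"
    unfolding coeff_G_1
  proof (intro sum.mono_neutral_right)
    show "\<forall>m\<in>{..2 * (1 + s)} - {e}. D m 1 * poly.coeff (falling m) e = 0"
    proof
      fix m assume "m \<in> {..2 * (1 + s)} - {e}"
      then consider "m < e" | "m > e" by fastforce
      then show "D m 1 * poly.coeff (falling m) e = 0"
        using D_above[of m] by cases (auto simp: coeff_eq_0 degree_falling)
    qed
  qed auto
  then show ?thesis by (simp add: lead_coeff_falling)
qed

lemma not_dvd_coeff_G_1_lead: "\<not> int p dvd poly.coeff (G 1) e"
proof -
  have "D e 1 mod int p ^ 1 = D e 1" by (rule nth_mod) simp
  then show ?thesis using D_e unfolding coeff_G_1_lead by auto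
qed

theorem trace_series_reduction:
  "trace_series p A U y c = ([(p ^ s)] \<cdot>\<^bsub>Zp p\<^esub> \<one>\<^bsub>Zp p\<^esub>) \<odot>\<^bsub>tate p\<^esub> tate_of G"
  "reduce_series p (tate_of G) \<in> carrier (UP (Fp p)) - {\<zero>\<^bsub>UP (Fp p)\<^esub>}"
  "deg (Fp p) (reduce_series p (tate_of G)) \<le> d"
proof -
  show "trace_series p A U y c = ([(p ^ s)] \<cdot>\<^bsub>Zp p\<^esub> \<one>\<^bsub>Zp p\<^esub>) \<odot>\<^bsub>tate p\<^esub> tate_of G"
    unfolding trace_series_eq of_int_nat of_nat_power tate_of_smult ..
  have cl: "tate_of G k \<in> carrier (Zp p)" for k using coherent_G by simp
  have zero: "reduce_series p (tate_of G) k = \<zero>\<^bsub>Fp p\<^esub> \<longleftrightarrow> int p dvd poly.coeff (G 1) k" for k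
    using Zp_reduce_zero_iff[OF cl, of k]
    by (simp add: reduce_series_def tate_of_def mod_eq_0_iff_dvd)
  have above: "reduce_series p (tate_of G) k = \<zero>\<^bsub>Fp p\<^esub>" if "k > d" for k
    unfolding zero using coeff_G_1_above[of k] that e_le by simp
  have up: "reduce_series p (tate_of G) \<in> up (Fp p)"
    using above cl by (auto intro!: mem_upI exI[of _ d] bound.intro simp: reduce_series_def)
  have "reduce_series p (tate_of G) e \<noteq> \<zero>\<^bsub>Fp p\<^esub>"
    unfolding zero by (rule not_dvd_coeff_G_1_lead)
  then have "reduce_series p (tate_of G) \<noteq> (\<lambda>_. \<zero>\<^bsub>Fp p\<^esub>)" by metis
  then show "reduce_series p (tate_of G) \<in> carrier (UP (Fp p)) - {\<zero>\<^bsub>UP (Fp p)\<^esub>}"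
    using up by (simp add: UP_def)
  interpret UF: UP_cring "Fp p" "UP (Fp p)" by unfold_locales simp
  show "deg (Fp p) (reduce_series p (tate_of G)) \<le> d"
    using above up by (intro UF.deg_aboveI) (auto simp: UP_def)
qed

text \<open>The last inequality bounds the multiplicity count from below. It serves the sharpness
  example, where distinct zeros push the degree up to d.\<close>

theorem trace_series_weierstrass:
  obtains W where "weierstrass_factor p (trace_series p A U y c) W" "deg (Zp p) W \<le> d"
    "finite (tate_zeros p (trace_series p A U y c))"
    "zero_count p (trace_series p A U y c) W \<le> deg (Zp p) W"
    "card (tate_zeros p (trace_series p A U y c)) \<le> zero_count p (trace_series p A U y c) W"
proof -
  let ?F = "trace_series p A U y c"
  have above: "int p dvd poly.coeff (G 1) k" if "k > e" for k
    using coeff_G_1_above[OF that] by simp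
  obtain W where W: "weierstrass_factor p ?F W" "deg (Zp p) W = e"
    "tate_zeros p ?F = {z \<in> carrier (Zp p). eval (Zp p) (Zp p) id z W = \<zero>\<^bsub>Zp p\<^esub>}"
    using weierstrass_preparation[OF coherent_G above not_dvd_coeff_G_1_lead, of s]
    unfolding trace_series_eq[symmetric] by blast
  interpret UD: UP_domain "Zp p" "UP (Zp p)" by unfold_locales simp
  have Wc: "W \<in> carrier (UP (Zp p))" and "UnivPoly.coeff (UP (Zp p)) W (deg (Zp p) W) = \<one>\<^bsub>Zp p\<^esub>"
    using W(1) by (auto simp: weierstrass_factor_def)
  then have Wn: "W \<noteq> \<zero>\<^bsub>UP (Zp p)\<^esub>" by auto
  note count = UD.root_count[OF Wc Wn, folded W(3)]
  have "card (tate_zeros p ?F) = (\<Sum>z\<in>tate_zeros p ?F. 1)" by simp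
  also have "\<dots> \<le> zero_count p ?F W"
    unfolding zero_count_def using UD.root_mult_pos[OF _ Wc Wn] by (intro sum_mono) (auto simp: W(3))
  finally show ?thesis using that[of W] W e_le count by (simp add: zero_count_def)
qed

text \<open>At X = j the falling factorials of index m > j vanish, and for m <= j the coefficients
  C_m do, so every single term of the expansion is zero.\<close>

lemma tate_eval_of_nat:
  assumes "\<And>m. m \<le> j \<Longrightarrow> C m = \<zero>\<^bsub>Zp p\<^esub>"
  shows "tate_eval p (trace_series p A U y c) (padic_of_int p (int j)) = \<zero>\<^bsub>Zp p\<^esub>"
proof -
  have "tate_eval p (trace_series p A U y c) (padic_of_int p (int j)) =
      poly_value (\<lambda>n. [:int p ^ s:] * G n) (padic_of_int p (int j))"
    unfolding trace_series_eq using coherent_G coherent_const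
    by (intro tate_eval_tate_of coherent_mult) auto
  also have "\<dots> = \<zero>\<^bsub>Zp p\<^esub>"
  proof
    fix n
    have "D m n * poly (falling m) (int j) = 0" for m
    proof (cases "m \<le> j")
      case True
      then have "D m n = 0" unfolding D_nth_zero_iff using assms by simp
      then show ?thesis by simp
    qed (simp add: poly_falling_eq_0)
    then have "(\<Sum>m\<le>2 * (n + s). D m n * poly (falling m) (int j)) = 0" by (intro sum.neutral) blast
    then have "poly (G n) (int j) = 0" by (simp add: G_def poly_sum)
    moreover have "[poly (G n) (int j mod int p ^ n) = poly (G n) (int j)] (mod int p ^ n)"
      unfolding poly_altdef by (intro cong_sum cong_scalar_left cong_pow) (simp add: cong_def)
    ultimately have "int p ^ n dvd poly (G n) (int j mod int p ^ n)" by (simp add: cong_def mod_eq_0_iff_dvd)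
    then show "poly_value (\<lambda>n. [:int p ^ s:] * G n) (padic_of_int p (int j)) n = \<zero>\<^bsub>Zp p\<^esub> n"
      by (simp add: poly_value_def nth_of_int mod_eq_0_iff_dvd)
  qed
  finally show ?thesis .
qed

end

subsection \<open>Reduction of bases and traces\<close>

context free_padic_algebra
begin

text \<open>Reduced coordinates give existence. For uniqueness two representations are lifted; the
  difference of the lifts lies in pA, so its coordinates vanish modulo p.\<close>

lemma reduce_basis: "is_basis (Fp p) (quot_algebra p A) d (\<lambda>i. reduce p A (b i))"
proof -
  let ?Q = "quot_algebra p A"
  interpret QA: algebra "Fp p" ?Q by (rule quot_algebra_is_algebra)
  have "\<exists>!f. f \<in> {..<d} \<rightarrow>\<^sub>E carrier (Fp p) \<and> X = (\<Oplus>\<^bsub>?Q\<^esub>i\<in>{..<d}. f i \<odot>\<^bsub>?Q\<^esub> reduce p A (b i))"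
    if X: "X \<in> carrier ?Q" for X
  proof (rule ex_ex1I)
    obtain x where x: "x \<in> carrier A" "X = reduce p A x" using reduce_surj[OF X] .
    define f where "f = (\<lambda>i\<in>{..<d}. reduce p (Zp p) (coord x i))"
    have f: "f \<in> {..<d} \<rightarrow>\<^sub>E carrier (Fp p)" using x by (auto simp: f_def)
    have "(\<Oplus>\<^bsub>?Q\<^esub>i\<in>{..<d}. f i \<odot>\<^bsub>?Q\<^esub> reduce p A (b i)) =
        (\<Oplus>\<^bsub>?Q\<^esub>i\<in>{..<d}. reduce p (Zp p) (coord x i) \<odot>\<^bsub>?Q\<^esub> reduce p A (b i))"
      using x by (intro Q.finsum_cong') (auto simp: f_def intro!: QA.smult_closed)
    also have "\<dots> = reduce p A (\<Oplus>i\<in>{..<d}. coord x i \<odot> b i)"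
      using x by (intro reduce_sum) auto
    also have "\<dots> = X" using x by (simp add: A.coords_sum[OF basis])
    finally show "\<exists>f. f \<in> {..<d} \<rightarrow>\<^sub>E carrier (Fp p) \<and> X = (\<Oplus>\<^bsub>?Q\<^esub>i\<in>{..<d}. f i \<odot>\<^bsub>?Q\<^esub> reduce p A (b i))"
      using f by auto
  next
    fix f f'
    assume f: "f \<in> {..<d} \<rightarrow>\<^sub>E carrier (Fp p) \<and> X = (\<Oplus>\<^bsub>?Q\<^esub>i\<in>{..<d}. f i \<odot>\<^bsub>?Q\<^esub> reduce p A (b i))"
      and f': "f' \<in> {..<d} \<rightarrow>\<^sub>E carrier (Fp p) \<and> X = (\<Oplus>\<^bsub>?Q\<^esub>i\<in>{..<d}. f' i \<odot>\<^bsub>?Q\<^esub> reduce p A (b i))"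
    obtain g where g: "\<And>i. i < d \<Longrightarrow> g i \<in> carrier (Zp p)" "\<And>i. i < d \<Longrightarrow> f i = reduce p (Zp p) (g i)"
        "(\<Oplus>\<^bsub>?Q\<^esub>i\<in>{..<d}. f i \<odot>\<^bsub>?Q\<^esub> reduce p A (b i)) = reduce p A (\<Oplus>i\<in>{..<d}. g i \<odot> b i)"
      by (rule reduce_lift[of d f b]) (use f in auto)
    obtain g' where g': "\<And>i. i < d \<Longrightarrow> g' i \<in> carrier (Zp p)" "\<And>i. i < d \<Longrightarrow> f' i = reduce p (Zp p) (g' i)"
        "(\<Oplus>\<^bsub>?Q\<^esub>i\<in>{..<d}. f' i \<odot>\<^bsub>?Q\<^esub> reduce p A (b i)) = reduce p A (\<Oplus>i\<in>{..<d}. g' i \<odot> b i)"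
      by (rule reduce_lift[of d f' b]) (use f' in auto)
    define v v' where "v = (\<Oplus>i\<in>{..<d}. g i \<odot> b i)" and "v' = (\<Oplus>i\<in>{..<d}. g' i \<odot> b i)"
    have v: "v \<in> carrier A" "v' \<in> carrier A"
      unfolding v_def v'_def using g(1) g'(1) by (auto intro!: A.finsum_closed)
    have "reduce p A v = reduce p A v'"
      unfolding v_def v'_def g(3)[symmetric] g'(3)[symmetric] using f f' by (metis (no_types, lifting))
    then have "\<exists>w\<in>carrier A. v \<ominus> v' = padic_of_int p (int p ^ 1) \<odot> w" using reduce_eq_iff[OF v] by simp
    then have zero: "coord (v \<ominus> v') i 1 = 0" if "i < d" for i using p_multiple_iff[of "v \<ominus> v'" 1] v that by simp
    have "f i = f' i" if i: "i < d" for i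
    proof -
      have "coord v i = g i" "coord v' i = g' i"
        unfolding v_def v'_def using g g' i by (auto intro!: A.coords_eqI[OF basis])
      then have "g i 1 = g' i 1"
        using zero[OF i] is_linear_minus[OF coord_linear[OF i] v(1,2)] g g' i by (simp add: nth_minus_eq_0_iff)
      then show ?thesis using g g' i by (simp add: Zp_reduce_eq_iff)
    qed
    then show "f = f'" using f f' by (auto intro!: PiE_ext[of f "{..<d}" "\<lambda>_. carrier (Fp p)" f'])
  qed
  then show ?thesis by (auto simp: is_basis_def)
qed

text \<open>Coordinates, hence the diagonal entries of a multiplication map, commute with reduction.
  This verifies the condition on Tr(x) in the sharpness example, where c is Tr(y) itself.\<close>

lemma reduce_trace:
  assumes x: "x \<in> carrier A"
  shows "alg_trace (Fp p) (quot_algebra p A) (reduce p A x) = reduce p (Zp p) (Tr x)"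
proof -
  let ?Q = "quot_algebra p A"
  interpret QA: algebra "Fp p" ?Q by (rule quot_algebra_is_algebra)
  have co: "coords (Fp p) ?Q d (\<lambda>i. reduce p A (b i)) (reduce p A z) i = reduce p (Zp p) (coord z i)"
    if z: "z \<in> carrier A" and i: "i < d" for z i
  proof -
    have "reduce p A z = (\<Oplus>\<^bsub>?Q\<^esub>i\<in>{..<d}. reduce p (Zp p) (coord z i) \<odot>\<^bsub>?Q\<^esub> reduce p A (b i))"
      using z by (subst reduce_sum) (auto simp: A.coords_sum[OF basis])
    then show ?thesis using z i by (simp add: QA.coords_eqI[OF reduce_basis] Pi_iff)
  qed
  have "alg_trace (Fp p) ?Q (reduce p A x) = (\<Oplus>\<^bsub>Fp p\<^esub>i\<in>{..<d}. reduce p (Zp p) (coord (x \<otimes> b i) i))"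
    unfolding QA.alg_trace_eq[OF reduce_basis red.hom_closed[OF x]]
    using x by (intro Fp.finsum_cong') (auto simp: co simp flip: red.hom_mult)
  also have "\<dots> = reduce p (Zp p) (\<Oplus>\<^bsub>Zp p\<^esub>i\<in>{..<d}. coord (x \<otimes> b i) i)"
    using x by (subst Zred.hom_finsum) (auto simp: comp_def)
  finally show ?thesis by (simp add: A.alg_trace_eq[OF basis x])
qed

end

text \<open>Counting in place of linear algebra: the basis e shows that the module has as many
  elements as there are coordinate tuples, so an injective map from the tuples is onto.\<close>

lemma (in algebra) is_basis_of_inj:
  assumes e: "is_basis R M n e" and fin: "finite (carrier R)"
    and b: "\<And>i. i < n \<Longrightarrow> b i \<in> carrier M"
    and inj: "inj_on (\<lambda>f. \<Oplus>\<^bsub>M\<^esub>i\<in>{..<n}. f i \<odot>\<^bsub>M\<^esub> b i) ({..<n} \<rightarrow>\<^sub>E carrier R)"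
  shows "is_basis R M n b"
proof -
  let ?X = "{..<n} \<rightarrow>\<^sub>E carrier R"
  let ?\<Phi> = "\<lambda>b f. \<Oplus>\<^bsub>M\<^esub>i\<in>{..<n}. f i \<odot>\<^bsub>M\<^esub> b i"
  have finX: "finite ?X" using fin by (intro finite_PiE) auto
  have closed: "?\<Phi> c ` ?X \<subseteq> carrier M" if "\<And>i. i < n \<Longrightarrow> c i \<in> carrier M" for c
    using that by (auto intro!: M.finsum_closed)
  have onto: "?\<Phi> e ` ?X = carrier M"
  proof
    show "carrier M \<subseteq> ?\<Phi> e ` ?X" using e by (auto simp: is_basis_def image_iff)
  qed (rule closed[OF basis_closed[OF e]])
  have "card (carrier M) \<le> card ?X" unfolding onto[symmetric] using finX by (rule card_image_le)
  moreover have "card (?\<Phi> b ` ?X) = card ?X" using inj by (rule card_image)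
  moreover have "finite (carrier M)" unfolding onto[symmetric] using finX by simp
  ultimately have img: "?\<Phi> b ` ?X = carrier M"
    using closed[OF b] by (intro card_seteq) auto
  have "\<exists>!f. f \<in> ?X \<and> v = ?\<Phi> b f" if "v \<in> carrier M" for v
  proof (rule ex_ex1I)
    show "\<exists>f. f \<in> ?X \<and> v = ?\<Phi> b f" using that unfolding img[symmetric] by auto
    show "f = g" if "f \<in> ?X \<and> v = ?\<Phi> b f" "g \<in> ?X \<and> v = ?\<Phi> b g" for f g
      using that by (intro inj_onD[OF inj]) auto
  qed
  then show ?thesis using b by (auto simp: is_basis_def)
qed

subsection \<open>The split algebra\<close>

definition unit_vec :: "('r, 's) ring_scheme \<Rightarrow> nat \<Rightarrow> nat \<Rightarrow> nat \<Rightarrow> 'r" where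
  "unit_vec R d i = (\<lambda>j\<in>{..<d}. if j = i then \<one>\<^bsub>R\<^esub> else \<zero>\<^bsub>R\<^esub>)"

context cring
begin

lemma split_carrier: "carrier (split_algebra R d) = {..<d} \<rightarrow>\<^sub>E carrier R"
  and split_mult: "x \<otimes>\<^bsub>split_algebra R d\<^esub> y = (\<lambda>i\<in>{..<d}. x i \<otimes> y i)"
  and split_one: "\<one>\<^bsub>split_algebra R d\<^esub> = (\<lambda>i\<in>{..<d}. \<one>)"
  and split_zero: "\<zero>\<^bsub>split_algebra R d\<^esub> = (\<lambda>i\<in>{..<d}. \<zero>)"
  and split_add: "x \<oplus>\<^bsub>split_algebra R d\<^esub> y = (\<lambda>i\<in>{..<d}. x i \<oplus> y i)"
  and split_smult: "a \<odot>\<^bsub>split_algebra R d\<^esub> x = (\<lambda>i\<in>{..<d}. a \<otimes> x i)"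
  by (simp_all add: split_algebra_def)

lemmas split_simps = split_carrier split_mult split_one split_zero split_add split_smult

lemma split_eqI:
  "x \<in> carrier (split_algebra R d) \<Longrightarrow> y \<in> carrier (split_algebra R d) \<Longrightarrow>
    (\<And>i. i < d \<Longrightarrow> x i = y i) \<Longrightarrow> x = y"
  unfolding split_carrier by (rule PiE_ext) auto

lemma split_nth_closed: "x \<in> carrier (split_algebra R d) \<Longrightarrow> i < d \<Longrightarrow> x i \<in> carrier R"
  by (auto simp: split_carrier)

lemma split_cring: "cring (split_algebra R d)"
proof (rule cringI)
  let ?S = "split_algebra R d"
  show "abelian_group ?S"
  proof (rule abelian_groupI)
    fix x assume x: "x \<in> carrier ?S"
    have "(\<lambda>i\<in>{..<d}. \<ominus> x i) \<oplus>\<^bsub>?S\<^esub> x = \<zero>\<^bsub>?S\<^esub>"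
      unfolding split_simps by (rule restrict_ext) (use split_nth_closed[OF x] in \<open>simp add: l_neg\<close>)
    moreover have "(\<lambda>i\<in>{..<d}. \<ominus> x i) \<in> carrier ?S"
      using split_nth_closed[OF x] by (simp add: split_carrier)
    ultimately show "\<exists>y\<in>carrier ?S. y \<oplus>\<^bsub>?S\<^esub> x = \<zero>\<^bsub>?S\<^esub>" by blast
    show "\<zero>\<^bsub>?S\<^esub> \<oplus>\<^bsub>?S\<^esub> x = x"
      by (rule split_eqI[OF _ x]) (use split_nth_closed[OF x] in \<open>simp_all add: split_simps\<close>)
  next
    fix x y z assume x: "x \<in> carrier ?S" and y: "y \<in> carrier ?S" and z: "z \<in> carrier ?S"
    show "x \<oplus>\<^bsub>?S\<^esub> y \<oplus>\<^bsub>?S\<^esub> z = x \<oplus>\<^bsub>?S\<^esub> (y \<oplus>\<^bsub>?S\<^esub> z)"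
      unfolding split_simps by (rule restrict_ext)
        (use split_nth_closed[OF x] split_nth_closed[OF y] split_nth_closed[OF z] in \<open>simp add: a_assoc\<close>)
  next
    fix x y assume x: "x \<in> carrier ?S" and y: "y \<in> carrier ?S"
    show "x \<oplus>\<^bsub>?S\<^esub> y = y \<oplus>\<^bsub>?S\<^esub> x"
      unfolding split_simps by (rule restrict_ext)
        (use split_nth_closed[OF x] split_nth_closed[OF y] in \<open>simp add: a_comm\<close>)
    show "x \<oplus>\<^bsub>?S\<^esub> y \<in> carrier ?S"
      using split_nth_closed[OF x] split_nth_closed[OF y] by (simp add: split_carrier split_add)
  qed (simp add: split_simps)
  show "comm_monoid ?S"
  proof (rule comm_monoidI)
    fix x assume x: "x \<in> carrier ?S"
    show "\<one>\<^bsub>?S\<^esub> \<otimes>\<^bsub>?S\<^esub> x = x"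
      by (rule split_eqI[OF _ x]) (use split_nth_closed[OF x] in \<open>simp_all add: split_simps\<close>)
  next
    fix x y z assume x: "x \<in> carrier ?S" and y: "y \<in> carrier ?S" and z: "z \<in> carrier ?S"
    show "x \<otimes>\<^bsub>?S\<^esub> y \<otimes>\<^bsub>?S\<^esub> z = x \<otimes>\<^bsub>?S\<^esub> (y \<otimes>\<^bsub>?S\<^esub> z)"
      unfolding split_simps by (rule restrict_ext)
        (use split_nth_closed[OF x] split_nth_closed[OF y] split_nth_closed[OF z] in \<open>simp add: m_assoc\<close>)
  next
    fix x y assume x: "x \<in> carrier ?S" and y: "y \<in> carrier ?S"
    show "x \<otimes>\<^bsub>?S\<^esub> y = y \<otimes>\<^bsub>?S\<^esub> x"
      unfolding split_simps by (rule restrict_ext)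
        (use split_nth_closed[OF x] split_nth_closed[OF y] in \<open>simp add: m_comm\<close>)
    show "x \<otimes>\<^bsub>?S\<^esub> y \<in> carrier ?S"
      using split_nth_closed[OF x] split_nth_closed[OF y] by (simp add: split_carrier split_mult)
  qed (simp add: split_simps)
  fix x y z assume x: "x \<in> carrier ?S" and y: "y \<in> carrier ?S" and z: "z \<in> carrier ?S"
  show "(x \<oplus>\<^bsub>?S\<^esub> y) \<otimes>\<^bsub>?S\<^esub> z = x \<otimes>\<^bsub>?S\<^esub> z \<oplus>\<^bsub>?S\<^esub> y \<otimes>\<^bsub>?S\<^esub> z"
    unfolding split_simps by (rule restrict_ext)
      (use split_nth_closed[OF x] split_nth_closed[OF y] split_nth_closed[OF z] in \<open>simp add: l_distr\<close>)
qed

lemma split_is_algebra: "algebra R (split_algebra R d)"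
proof (rule algebraI)
  let ?S = "split_algebra R d"
  fix a b x assume ab: "a \<in> carrier R" "b \<in> carrier R" and x: "x \<in> carrier ?S"
  note x' = split_nth_closed[OF x]
  show "(a \<oplus> b) \<odot>\<^bsub>?S\<^esub> x = a \<odot>\<^bsub>?S\<^esub> x \<oplus>\<^bsub>?S\<^esub> b \<odot>\<^bsub>?S\<^esub> x"
    unfolding split_simps by (rule restrict_ext) (use ab x' in \<open>simp add: l_distr\<close>)
  show "(a \<otimes> b) \<odot>\<^bsub>?S\<^esub> x = a \<odot>\<^bsub>?S\<^esub> (b \<odot>\<^bsub>?S\<^esub> x)"
    unfolding split_simps by (rule restrict_ext) (use ab x' in \<open>simp add: m_assoc\<close>)
next
  let ?S = "split_algebra R d"
  fix a x y assume a: "a \<in> carrier R" and x: "x \<in> carrier ?S" and y: "y \<in> carrier ?S"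
  note xy = split_nth_closed[OF x] split_nth_closed[OF y]
  show "a \<odot>\<^bsub>?S\<^esub> (x \<oplus>\<^bsub>?S\<^esub> y) = a \<odot>\<^bsub>?S\<^esub> x \<oplus>\<^bsub>?S\<^esub> a \<odot>\<^bsub>?S\<^esub> y"
    unfolding split_simps by (rule restrict_ext) (use a xy in \<open>simp add: r_distr\<close>)
  show "a \<odot>\<^bsub>?S\<^esub> x \<otimes>\<^bsub>?S\<^esub> y = a \<odot>\<^bsub>?S\<^esub> (x \<otimes>\<^bsub>?S\<^esub> y)"
    unfolding split_simps by (rule restrict_ext) (use a xy in \<open>simp add: m_assoc\<close>)
next
  fix a x assume a: "a \<in> carrier R" and x: "x \<in> carrier (split_algebra R d)"
  show "a \<odot>\<^bsub>split_algebra R d\<^esub> x \<in> carrier (split_algebra R d)"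
    using a split_nth_closed[OF x] by (simp add: split_carrier split_smult)
next
  fix x assume x: "x \<in> carrier (split_algebra R d)"
  show "\<one> \<odot>\<^bsub>split_algebra R d\<^esub> x = x"
    by (rule split_eqI[OF _ x]) (use split_nth_closed[OF x] in \<open>simp_all add: split_simps\<close>)
qed (rule is_cring split_cring)+

lemma split_finsum:
  assumes "finite I" "x \<in> I \<rightarrow> carrier (split_algebra R d)"
  shows "(\<Oplus>\<^bsub>split_algebra R d\<^esub>i\<in>I. x i) = (\<lambda>j\<in>{..<d}. \<Oplus>i\<in>I. x i j)"
proof -
  interpret S: cring "split_algebra R d" by (rule split_cring)
  show ?thesis using assms
  proof (induction I rule: finite_induct)
    case (insert k I)
    have "x i j \<in> carrier R" if "i \<in> insert k I" "j < d" for i j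
      using insert.prems that split_nth_closed by blast
    then have "(\<lambda>j\<in>{..<d}. x k j \<oplus> (\<lambda>j\<in>{..<d}. \<Oplus>i\<in>I. x i j) j) = (\<lambda>j\<in>{..<d}. \<Oplus>i\<in>insert k I. x i j)"
      using insert.hyps by (intro restrict_ext) (simp add: Pi_iff)
    then show ?case using insert by (simp add: split_add Pi_iff)
  qed (simp add: split_zero)
qed

lemma unit_vec_closed: "unit_vec R d i \<in> carrier (split_algebra R d)"
  by (auto simp: unit_vec_def split_carrier)

lemma split_unit_vec_sum:
  assumes "f \<in> {..<d} \<rightarrow> carrier R"
  shows "(\<Oplus>\<^bsub>split_algebra R d\<^esub>i\<in>{..<d}. f i \<odot>\<^bsub>split_algebra R d\<^esub> unit_vec R d i) = restrict f {..<d}"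
proof -
  interpret A: algebra R "split_algebra R d" by (rule split_is_algebra)
  have "(\<Oplus>\<^bsub>split_algebra R d\<^esub>i\<in>{..<d}. f i \<odot>\<^bsub>split_algebra R d\<^esub> unit_vec R d i) =
     (\<lambda>j\<in>{..<d}. \<Oplus>i\<in>{..<d}. (f i \<odot>\<^bsub>split_algebra R d\<^esub> unit_vec R d i) j)"
    using assms by (intro split_finsum) (auto intro!: A.smult_closed unit_vec_closed)
  also have "\<dots> = restrict f {..<d}"
  proof (rule restrict_ext)
    fix j assume j: "j \<in> {..<d}"
    have "(\<Oplus>i\<in>{..<d}. (f i \<odot>\<^bsub>split_algebra R d\<^esub> unit_vec R d i) j) = (\<Oplus>i\<in>{..<d}. if j = i then f i else \<zero>)"
      using assms j by (intro finsum_cong') (auto simp: split_smult unit_vec_def Pi_iff)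
    then show "(\<Oplus>i\<in>{..<d}. (f i \<odot>\<^bsub>split_algebra R d\<^esub> unit_vec R d i) j) = f j"
      using assms j by (simp add: add.finprod_singleton)
  qed
  finally show ?thesis .
qed

lemma split_unit_vec_expand:
  assumes "v \<in> carrier (split_algebra R d)"
  shows "(\<Oplus>\<^bsub>split_algebra R d\<^esub>i\<in>{..<d}. v i \<odot>\<^bsub>split_algebra R d\<^esub> unit_vec R d i) = v"
proof -
  have "v \<in> {..<d} \<rightarrow> carrier R" "restrict v {..<d} = v"
    using assms by (auto simp: split_carrier PiE_restrict)
  then show ?thesis using split_unit_vec_sum by simp
qed

lemma split_basis: "is_basis R (split_algebra R d) d (unit_vec R d)"
  unfolding is_basis_def
proof (intro conjI ballI)
  fix v assume v: "v \<in> carrier (split_algebra R d)"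
  show "\<exists>!f. f \<in> {..<d} \<rightarrow>\<^sub>E carrier R \<and> v = (\<Oplus>\<^bsub>split_algebra R d\<^esub>i\<in>{..<d}. f i \<odot>\<^bsub>split_algebra R d\<^esub> unit_vec R d i)"
    using v split_unit_vec_expand by (intro ex1I[of _ v]) (auto simp: split_carrier)
qed (use unit_vec_closed in auto)

lemma split_coords:
  assumes v: "v \<in> carrier (split_algebra R d)" and i: "i < d"
  shows "coords R (split_algebra R d) d (unit_vec R d) v i = v i"
proof -
  interpret A: algebra R "split_algebra R d" by (rule split_is_algebra)
  have "v \<in> {..<d} \<rightarrow> carrier R" using v by (auto simp: split_carrier)
  from A.coords_eqI[OF split_basis this i] show ?thesis by (simp add: split_unit_vec_expand[OF v])
qed

lemma split_trace:
  assumes x: "x \<in> carrier (split_algebra R d)"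
  shows "alg_trace R (split_algebra R d) x = (\<Oplus>i\<in>{..<d}. x i)"
proof -
  interpret A: algebra R "split_algebra R d" by (rule split_is_algebra)
  show ?thesis unfolding A.alg_trace_eq[OF split_basis x]
    using x split_nth_closed[OF x] unit_vec_closed
    by (intro finsum_cong') (auto simp: split_coords, auto simp: split_mult unit_vec_def)
qed

text \<open>The unit vectors are orthonormal for the trace form, so a form is represented by the
  vector of its values on them and by no other vector.\<close>

lemma split_finite_etale: "finite_etale R (split_algebra R d) d"
proof -
  let ?S = "split_algebra R d"
  interpret A: algebra R ?S by (rule split_is_algebra)
  let ?\<Phi> = "\<lambda>x. \<lambda>y\<in>carrier ?S. alg_trace R ?S (x \<otimes>\<^bsub>?S\<^esub> y)"
  have lin: "A.is_linear (\<lambda>y. alg_trace R ?S (x \<otimes>\<^bsub>?S\<^esub> y))" if "x \<in> carrier ?S" for x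
    using A.alg_trace_linear[OF split_basis] that by (rule A.is_linear_mult)
  have tr: "alg_trace R ?S (x \<otimes>\<^bsub>?S\<^esub> unit_vec R d i) = x i" if x: "x \<in> carrier ?S" and i: "i < d" for x i
  proof -
    have "alg_trace R ?S (x \<otimes>\<^bsub>?S\<^esub> unit_vec R d i) = (\<Oplus>j\<in>{..<d}. if i = j then x j else \<zero>)"
      unfolding split_trace[OF A.m_closed[OF x unit_vec_closed]]
      using split_nth_closed[OF x] by (intro finsum_cong') (auto simp: split_mult unit_vec_def)
    then show ?thesis using i split_nth_closed[OF x] by (simp add: add.finprod_singleton)
  qed
  have "bij_betw ?\<Phi> (carrier ?S) (linear_forms R ?S)"
  proof (rule bij_betw_imageI)
    show "inj_on ?\<Phi> (carrier ?S)"
    proof (rule inj_onI)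
      fix x y assume xy: "x \<in> carrier ?S" "y \<in> carrier ?S" "?\<Phi> x = ?\<Phi> y"
      show "x = y"
      proof (rule split_eqI[OF xy(1,2)])
        fix i assume i: "i < d"
        show "x i = y i"
          using fun_cong[OF xy(3), of "unit_vec R d i"] tr[OF xy(1) i] tr[OF xy(2) i] unit_vec_closed by simp
      qed
    qed
    show "?\<Phi> ` carrier ?S = linear_forms R ?S"
    proof
      show "?\<Phi> ` carrier ?S \<subseteq> linear_forms R ?S"
        using lin A.is_linearD[OF lin] unfolding linear_forms_def by auto
      show "linear_forms R ?S \<subseteq> ?\<Phi> ` carrier ?S"
      proof
        fix f assume f: "f \<in> linear_forms R ?S"
        then have linf: "A.is_linear f" by (auto simp: A.is_linear_def linear_forms_def)
        define x where "x = (\<lambda>i\<in>{..<d}. f (unit_vec R d i))"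
        have x: "x \<in> carrier ?S"
          using A.is_linearD(1)[OF linf] unit_vec_closed by (auto simp: x_def split_carrier)
        have "alg_trace R ?S (x \<otimes>\<^bsub>?S\<^esub> z) = f z" if z: "z \<in> carrier ?S" for z
          unfolding A.is_linear_expand[OF split_basis lin[OF x] z] A.is_linear_expand[OF split_basis linf z]
          using z split_nth_closed[OF z] A.is_linearD(1)[OF linf] unit_vec_closed
          by (intro finsum_cong') (auto simp: split_coords tr[OF x], auto simp: x_def)
        then have "?\<Phi> x = f" using f unfolding linear_forms_def
          by (intro ext) (auto simp: PiE_iff extensional_def)
        then show "f \<in> ?\<Phi> ` carrier ?S" using x by blast
      qed
    qed
  qed
  then show ?thesis unfolding finite_etale_def using split_is_algebra split_basis by blast
qed

lemma split_Units:
  assumes x: "x \<in> carrier (split_algebra R d)" and u: "\<And>i. i < d \<Longrightarrow> x i \<in> Units R"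
  shows "x \<in> Units (split_algebra R d)"
proof -
  let ?S = "split_algebra R d"
  define z where "z = (\<lambda>i\<in>{..<d}. inv (x i))"
  have z: "z \<in> carrier ?S" using u by (auto simp: z_def split_carrier)
  have "x \<otimes>\<^bsub>?S\<^esub> z = \<one>\<^bsub>?S\<^esub>" "z \<otimes>\<^bsub>?S\<^esub> x = \<one>\<^bsub>?S\<^esub>"
    unfolding split_mult split_one by (rule restrict_ext; use u in \<open>simp add: z_def\<close>)+
  then show ?thesis using x z by (auto simp: Units_def)
qed

end

subsection \<open>Sharpness\<close>

text \<open>Induction through k binom(d + 1, k) = (d + 1) binom(d, k - 1): one factor k is absorbed,
  and expanding the remaining power of k = j + 1 leaves sums of the same kind with d in place of d +
  1 and smaller exponents.\<close>

lemma alternating_power_sum: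
  "m < d \<Longrightarrow> (\<Sum>k\<le>d. (-1) ^ k * int (d choose k) * int k ^ m) = 0"
proof (induction d arbitrary: m)
  case (Suc d)
  show ?case
  proof (cases m)
    case 0
    then show ?thesis using choose_alternating_sum[of "Suc d", where ?'a = int] by simp
  next
    case (Suc l)
    have "(\<Sum>k\<le>Suc d. (-1) ^ k * int (Suc d choose k) * int k ^ m) =
      (\<Sum>j\<le>d. (-1) ^ Suc j * int (Suc d choose Suc j) * int (Suc j) ^ m)"
      by (simp only: sum.atMost_Suc_shift) (simp add: Suc)
    also have "\<dots> = (\<Sum>j\<le>d. \<Sum>i\<le>l. - int (Suc d) * int (l choose i) * ((-1) ^ j * int (d choose j) * int j ^ i))"
    proof (rule sum.cong[OF refl])
      fix j
      have "int (Suc j) * int (Suc d choose Suc j) = int (Suc d) * int (d choose j)"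
        by (metis Suc_times_binomial of_nat_mult)
      moreover have "int (Suc j) ^ l = (\<Sum>i\<le>l. int (l choose i) * int j ^ i)"
        using binomial_ring[of "int j" 1 l] by (simp add: add.commute)
      ultimately have eq: "(-1) ^ Suc j * int (Suc d choose Suc j) * int (Suc j) ^ m =
          - ((-1) ^ j) * (int (Suc d) * int (d choose j)) * (\<Sum>i\<le>l. int (l choose i) * int j ^ i)"
        unfolding Suc power_Suc by (metis (no_types, lifting) mult.assoc mult.commute mult_minus1)
      show "(-1) ^ Suc j * int (Suc d choose Suc j) * int (Suc j) ^ m =
        (\<Sum>i\<le>l. - int (Suc d) * int (l choose i) * ((-1) ^ j * int (d choose j) * int j ^ i))"
        unfolding eq sum_distrib_left by (intro sum.cong refl) (simp add: algebra_simps)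
    qed
    also have "\<dots> = (\<Sum>i\<le>l. - int (Suc d) * int (l choose i) * (\<Sum>j\<le>d. (-1) ^ j * int (d choose j) * int j ^ i))"
      unfolding sum_distrib_left by (rule sum.swap)
    also have "\<dots> = 0" using Suc.IH Suc.prems \<open>m = Suc l\<close> by (intro sum.neutral) auto
    finally show ?thesis .
  qed
qed simp

text \<open>The Vandermonde argument modulo q. Splitting off X - a leaves a quotient of smaller
  degree that still vanishes modulo q at the other points, because the differences x - a are
  invertible modulo q.\<close>

lemma prime_dvd_poly_of_roots:
  fixes q :: int and h :: "int poly"
  assumes q: "prime q"
  shows "finite S \<Longrightarrow> (\<And>x y. x \<in> S \<Longrightarrow> y \<in> S \<Longrightarrow> x \<noteq> y \<Longrightarrow> \<not> q dvd x - y) \<Longrightarrow>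
    h = 0 \<or> degree h < card S \<Longrightarrow> (\<And>x. x \<in> S \<Longrightarrow> q dvd poly h x) \<Longrightarrow> [:q:] dvd h"
proof (induction S arbitrary: h rule: finite_induct)
  case (insert a S)
  define g where "g = synthetic_div h a"
  have h: "h = [:- a, 1:] * g + [:poly h a:]" unfolding g_def by (rule synthetic_div_correct'[symmetric])
  have "[:q:] dvd g"
  proof (rule insert.IH)
    show "\<not> q dvd x - y" if "x \<in> S" "y \<in> S" "x \<noteq> y" for x y using insert.prems(1) that by auto
    show "g = 0 \<or> degree g < card S"
      using insert.prems(2) insert.hyps by (auto simp: g_def synthetic_div_eq_0_iff degree_synthetic_div)
    fix x assume x: "x \<in> S"
    have "poly h x = (x - a) * poly g x + poly h a" by (subst h) (simp add: algebra_simps)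
    moreover have "q dvd poly h x" "q dvd poly h a" using insert.prems(3) x by auto
    ultimately have "q dvd (x - a) * poly g x" by (metis dvd_add_left_iff)
    moreover have "\<not> q dvd x - a" using insert.prems(1)[of x a] insert.hyps x by auto
    ultimately show "q dvd poly g x" using q by (simp add: prime_dvd_mult_iff)
  qed
  moreover have "[:q:] dvd [:poly h a:]" using insert.prems(3)[of a] by simp
  ultimately show ?case by (subst h) (rule dvd_add[OF dvd_mult])
qed simp

lemma (in comm_monoid) Units_of_left_inverse:
  "x \<in> carrier G \<Longrightarrow> z \<in> carrier G \<Longrightarrow> z \<otimes> x = \<one> \<Longrightarrow> x \<in> Units G"
  using m_comm[of x z] by (auto simp: Units_def)

section \<open>The extremal split algebra\<close>

locale sharp_example = padic_integers +
  fixes d :: nat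
  assumes d_pos: "d \<ge> 1" and p_gt: "p > d + 1"
begin

abbreviation S :: "(padic, nat \<Rightarrow> padic) module" where
  "S \<equiv> split_algebra (Zp p) d"

definition int_vec :: "(nat \<Rightarrow> int) \<Rightarrow> nat \<Rightarrow> padic" where
  "int_vec f = (\<lambda>j\<in>{..<d}. padic_of_int p (f j))"

text \<open>By d < p the entries are distinct modulo p, which makes the powers of U a basis modulo
  p, and nonzero modulo p, which makes U a unit.\<close>

definition U :: "nat \<Rightarrow> padic" where
  "U = int_vec (\<lambda>j. int (Suc j))"

text \<open>The coefficients of the d-th difference at k = j + 1 with reversed sign, the term k = 0
  left out. For m >= 1 that term is killed by k^m, while C_0 vanishes through the choice c = Tr(y).
  The entry at 0 is d, a unit, so y does not reduce to zero.\<close>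

definition y :: "nat \<Rightarrow> padic" where
  "y = int_vec (\<lambda>j. (-1) ^ j * int (d choose Suc j))"

text \<open>Congruent to 1 modulo p by construction, so its order there is P = 1 and U is prescribed
  directly.\<close>

definition \<eta> :: "nat \<Rightarrow> padic" where
  "\<eta> = \<one>\<^bsub>S\<^esub> \<oplus>\<^bsub>S\<^esub> [p] \<cdot>\<^bsub>S\<^esub> U"

sublocale S: free_padic_algebra p S d "unit_vec (Zp p) d"
  by (intro free_padic_algebra.intro padic_algebra.intro padic_integers_axioms
      Zp.split_is_algebra free_padic_algebra_axioms.intro Zp.split_basis)

lemma int_vec_closed [simp]: "int_vec f \<in> carrier S"
  by (simp add: int_vec_def Zp.split_carrier)

lemma int_vec_nth: "j < d \<Longrightarrow> int_vec f j = padic_of_int p (f j)"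
  by (simp add: int_vec_def)

lemma U_closed [simp]: "U \<in> carrier S" and y_closed [simp]: "y \<in> carrier S"
  by (simp_all add: U_def y_def)

lemma int_vec_mult: "int_vec f \<otimes>\<^bsub>S\<^esub> int_vec g = int_vec (\<lambda>j. f j * g j)"
  unfolding Zp.split_mult int_vec_def by (rule restrict_ext) (simp add: of_int_mult)

lemma int_vec_pow: "int_vec f [^]\<^bsub>S\<^esub> (m::nat) = int_vec (\<lambda>j. f j ^ m)"
proof (induction m)
  case 0
  show ?case unfolding int_vec_def by (simp add: Zp.split_one of_int_1)
qed (simp add: int_vec_mult mult.commute)

lemma trace_int_vec: "alg_trace (Zp p) S (int_vec f) = padic_of_int p (\<Sum>j<d. f j)"
proof -
  have "alg_trace (Zp p) S (int_vec f) = (\<Oplus>\<^bsub>Zp p\<^esub>j\<in>{..<d}. padic_of_int p (f j))"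
    unfolding Zp.split_trace[OF int_vec_closed] by (intro Zp.finsum_cong') (auto simp: int_vec_nth)
  then show ?thesis by (simp add: of_int_sum)
qed

lemma \<eta>_eq: "\<eta> = int_vec (\<lambda>j. 1 + int p * int (Suc j))"
proof -
  have "[p] \<cdot>\<^bsub>S\<^esub> U = int_vec (\<lambda>j. int p * int (Suc j))"
    unfolding S.A.add_pow_eq_smult[OF U_closed] of_int_nat
    unfolding Zp.split_smult U_def int_vec_def by (rule restrict_ext) (simp add: of_int_mult)
  then have eq: "\<eta> = \<one>\<^bsub>S\<^esub> \<oplus>\<^bsub>S\<^esub> int_vec (\<lambda>j. int p * int (Suc j))" by (simp only: \<eta>_def)
  show ?thesis
    unfolding eq Zp.split_add Zp.split_one
    unfolding int_vec_def by (intro restrict_ext) (simp add: of_int_add of_int_1)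
qed

lemma int_vec_unit:
  assumes "\<And>j. j < d \<Longrightarrow> \<not> int p dvd f j"
  shows "int_vec f \<in> Units S"
  using assms by (intro Zp.split_Units) (auto simp: int_vec_nth Units_iff nth_of_int mod_eq_0_iff_dvd)

lemma not_dvd_small: "k > 0 \<Longrightarrow> k \<le> d \<Longrightarrow> \<not> int p dvd int k"
  using p_gt by (auto simp: nat_dvd_not_less)

lemma reduce_split_zero_iff:
  "reduce p S x = \<zero>\<^bsub>quot_algebra p S\<^esub> \<longleftrightarrow> (\<forall>j<d. x j 1 = 0)" if x: "x \<in> carrier S"
  using S.reduce_zero_iff[OF x] S.p_multiple_iff[OF x, of 1] Zp.split_coords[OF x] by simp

lemma finite_Fp: "finite (carrier (Fp p))"
proof -
  have "carrier (Fp p) \<subseteq> (\<lambda>k. reduce p (Zp p) (padic_of_int p k)) ` {0..<int p}"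
  proof
    fix X assume X: "X \<in> carrier (Fp p)"
    obtain x where x: "x \<in> carrier (Zp p)" "X = reduce p (Zp p) x" using S.Zp_reduce_surj[OF X] .
    have "x 1 \<in> {0..<int p}" using x by (metis carrier_iff power_one_right)
    moreover have "X = reduce p (Zp p) (padic_of_int p (x 1))"
      unfolding x(2) using x(1) nth_mod[of x 1] by (subst S.Zp_reduce_eq_iff) (auto simp: nth_of_int)
    ultimately show "X \<in> (\<lambda>k. reduce p (Zp p) (padic_of_int p k)) ` {0..<int p}" by blast
  qed
  then show ?thesis by (rule finite_subset) simp
qed

lemma power_sum_nth:
  assumes g: "\<And>i. i < d \<Longrightarrow> g i \<in> carrier (Zp p)" and j: "j < d"
  shows "(\<Oplus>\<^bsub>S\<^esub>i\<in>{..<d}. g i \<odot>\<^bsub>S\<^esub> U [^]\<^bsub>S\<^esub> i) j 1 = (\<Sum>i<d. g i 1 * int (Suc j) ^ i) mod int p"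
proof -
  have "(\<Oplus>\<^bsub>S\<^esub>i\<in>{..<d}. g i \<odot>\<^bsub>S\<^esub> U [^]\<^bsub>S\<^esub> i) = (\<lambda>j\<in>{..<d}. \<Oplus>\<^bsub>Zp p\<^esub>i\<in>{..<d}. (g i \<odot>\<^bsub>S\<^esub> U [^]\<^bsub>S\<^esub> i) j)"
    using g by (intro Zp.split_finsum) auto
  then have "(\<Oplus>\<^bsub>S\<^esub>i\<in>{..<d}. g i \<odot>\<^bsub>S\<^esub> U [^]\<^bsub>S\<^esub> i) j = (\<Oplus>\<^bsub>Zp p\<^esub>i\<in>{..<d}. g i \<otimes>\<^bsub>Zp p\<^esub> padic_of_int p (int (Suc j) ^ i))"
    using j g by (auto simp: Zp.split_smult U_def int_vec_pow int_vec_nth intro!: Zp.finsum_cong')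
  then have "(\<Oplus>\<^bsub>S\<^esub>i\<in>{..<d}. g i \<odot>\<^bsub>S\<^esub> U [^]\<^bsub>S\<^esub> i) j 1 = (\<Sum>i<d. (g i \<otimes>\<^bsub>Zp p\<^esub> padic_of_int p (int (Suc j) ^ i)) 1) mod int p ^ 1"
    using g by (simp add: nth_finsum Pi_iff)
  also have "\<dots> = (\<Sum>i<d. g i 1 * int (Suc j) ^ i) mod int p ^ 1"
    by (intro sum_mod_cong) (simp add: nth_mult nth_of_int mod_simps)
  finally show ?thesis by simp
qed

text \<open>Two coefficient tuples with the same image differ by a polynomial of degree below d that
  vanishes modulo p at 1, ..., d, hence by a multiple of p. Injectivity suffices because
  \<open>Fp p\<close> is finite.\<close>

lemma power_basis: "is_basis (Fp p) (quot_algebra p S) d (\<lambda>i. reduce p S U [^]\<^bsub>quot_algebra p S\<^esub> i)"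
proof -
  let ?Q = "quot_algebra p S"
  interpret QA: algebra "Fp p" ?Q by (rule S.quot_algebra_is_algebra)
  show ?thesis
  proof (rule QA.is_basis_of_inj[OF S.reduce_basis finite_Fp])
    show "reduce p S U [^]\<^bsub>?Q\<^esub> i \<in> carrier ?Q" for i :: nat by simp
    show "inj_on (\<lambda>f. \<Oplus>\<^bsub>?Q\<^esub>i\<in>{..<d}. f i \<odot>\<^bsub>?Q\<^esub> reduce p S U [^]\<^bsub>?Q\<^esub> i) ({..<d} \<rightarrow>\<^sub>E carrier (Fp p))"
    proof (rule inj_onI)
      fix f f' assume f: "f \<in> {..<d} \<rightarrow>\<^sub>E carrier (Fp p)" and f': "f' \<in> {..<d} \<rightarrow>\<^sub>E carrier (Fp p)"
        and eq: "(\<Oplus>\<^bsub>?Q\<^esub>i\<in>{..<d}. f i \<odot>\<^bsub>?Q\<^esub> reduce p S U [^]\<^bsub>?Q\<^esub> i) =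
          (\<Oplus>\<^bsub>?Q\<^esub>i\<in>{..<d}. f' i \<odot>\<^bsub>?Q\<^esub> reduce p S U [^]\<^bsub>?Q\<^esub> i)"
      have pow: "reduce p S U [^]\<^bsub>?Q\<^esub> i = reduce p S (U [^]\<^bsub>S\<^esub> i)" for i :: nat
        by simp
      obtain g where g: "\<And>i. i < d \<Longrightarrow> g i \<in> carrier (Zp p)" "\<And>i. i < d \<Longrightarrow> f i = reduce p (Zp p) (g i)"
          "(\<Oplus>\<^bsub>?Q\<^esub>i\<in>{..<d}. f i \<odot>\<^bsub>?Q\<^esub> reduce p S (U [^]\<^bsub>S\<^esub> i)) = reduce p S (\<Oplus>\<^bsub>S\<^esub>i\<in>{..<d}. g i \<odot>\<^bsub>S\<^esub> U [^]\<^bsub>S\<^esub> i)"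
        by (rule S.reduce_lift[of d f "\<lambda>i. U [^]\<^bsub>S\<^esub> i"]) (use f in auto)
      obtain g' where g': "\<And>i. i < d \<Longrightarrow> g' i \<in> carrier (Zp p)" "\<And>i. i < d \<Longrightarrow> f' i = reduce p (Zp p) (g' i)"
          "(\<Oplus>\<^bsub>?Q\<^esub>i\<in>{..<d}. f' i \<odot>\<^bsub>?Q\<^esub> reduce p S (U [^]\<^bsub>S\<^esub> i)) = reduce p S (\<Oplus>\<^bsub>S\<^esub>i\<in>{..<d}. g' i \<odot>\<^bsub>S\<^esub> U [^]\<^bsub>S\<^esub> i)"
        by (rule S.reduce_lift[of d f' "\<lambda>i. U [^]\<^bsub>S\<^esub> i"]) (use f' in auto)
      define v v' where "v = (\<Oplus>\<^bsub>S\<^esub>i\<in>{..<d}. g i \<odot>\<^bsub>S\<^esub> U [^]\<^bsub>S\<^esub> i)" and "v' = (\<Oplus>\<^bsub>S\<^esub>i\<in>{..<d}. g' i \<odot>\<^bsub>S\<^esub> U [^]\<^bsub>S\<^esub> i)"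
      have v: "v \<in> carrier S" "v' \<in> carrier S"
        unfolding v_def v'_def using g g' by (auto intro!: S.A.finsum_closed)
      have "reduce p S v = reduce p S v'"
        unfolding v_def v'_def g(3)[symmetric] g'(3)[symmetric] using eq unfolding pow .
      then have "\<exists>w\<in>carrier S. v \<ominus>\<^bsub>S\<^esub> v' = padic_of_int p (int p ^ 1) \<odot>\<^bsub>S\<^esub> w"
        using S.reduce_eq_iff[OF v] by simp
      then have zero: "S.coord (v \<ominus>\<^bsub>S\<^esub> v') j 1 = 0" if "j < d" for j
        using S.p_multiple_iff[of "v \<ominus>\<^bsub>S\<^esub> v'" 1] v that by simp
      have vj: "v j 1 = v' j 1" if j: "j < d" for j
      proof -
        have "S.coord (v \<ominus>\<^bsub>S\<^esub> v') j = v j \<ominus>\<^bsub>Zp p\<^esub> v' j"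
          using S.is_linear_minus[OF S.coord_linear[OF j] v] v j by (simp add: Zp.split_coords)
        then have "(v j \<ominus>\<^bsub>Zp p\<^esub> v' j) 1 = 0" using zero[OF j] by (simp only:)
        then show ?thesis
          unfolding nth_minus_eq_0_iff[OF Zp.split_nth_closed[OF v(1) j] Zp.split_nth_closed[OF v(2) j]] .
      qed
      define h where "h = (\<Sum>i<d. Polynomial.monom (g i 1 - g' i 1) i)"
      have coeff_h: "poly.coeff h i = (if i < d then g i 1 - g' i 1 else 0)" for i
        by (auto simp: h_def coeff_sum sum.delta)
      have "int p dvd poly h (int (Suc j))" if j: "j < d" for j
      proof -
        have "(\<Sum>i<d. g i 1 * int (Suc j) ^ i) mod int p = (\<Sum>i<d. g' i 1 * int (Suc j) ^ i) mod int p"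
          using vj[OF j] power_sum_nth[of g j] power_sum_nth[of g' j] g(1) g'(1) j unfolding v_def v'_def by argo
        moreover have "poly h (int (Suc j)) = (\<Sum>i<d. g i 1 * int (Suc j) ^ i) - (\<Sum>i<d. g' i 1 * int (Suc j) ^ i)"
          by (simp add: h_def poly_sum poly_monom left_diff_distrib sum_subtractf)
        ultimately show ?thesis by (simp only: mod_eq_dvd_iff)
      qed
      moreover have "h = 0 \<or> degree h < d"
      proof (cases "h = 0")
        case False
        then have "poly.coeff h (degree h) \<noteq> 0" by simp
        then show ?thesis unfolding coeff_h by (auto split: if_splits)
      qed simp
      moreover have "\<not> int p dvd x - z" if "x \<in> (\<lambda>j. int (Suc j)) ` {..<d}" "z \<in> (\<lambda>j. int (Suc j)) ` {..<d}" "x \<noteq> z" for x z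
      proof
        assume "int p dvd x - z"
        then have "int p \<le> \<bar>x - z\<bar>" using that(3) by (intro zdvd_imp_le) auto
        moreover have "\<bar>x - z\<bar> < int d" using that by auto
        ultimately show False using p_gt by simp
      qed
      ultimately have "[:int p:] dvd h"
        using prime_p by (intro prime_dvd_poly_of_roots[of "int p" "(\<lambda>j. int (Suc j)) ` {..<d}"])
          (auto simp: card_image inj_on_def)
      then have dvd: "int p dvd poly.coeff h i" for i by (simp only: const_poly_dvd_iff)
      have "f i = f' i" if i: "i < d" for i
      proof -
        have "g i 1 mod int p ^ 1 = g' i 1 mod int p ^ 1" using dvd[of i] i by (simp add: coeff_h mod_eq_dvd_iff)
        then have "g i 1 = g' i 1" unfolding nth_mod[OF g(1)[OF i]] nth_mod[OF g'(1)[OF i]] .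
        then show ?thesis using g g' i by (simp add: S.Zp_reduce_eq_iff)
      qed
      then show "f = f'" using f f' by (auto intro!: PiE_ext[of f "{..<d}" "\<lambda>_. carrier (Fp p)" f'])
    qed
  qed
qed

lemma eta_minus_one: "\<eta> \<ominus>\<^bsub>S\<^esub> \<one>\<^bsub>S\<^esub> \<in> p_ideal p S"
proof -
  have "\<eta> \<ominus>\<^bsub>S\<^esub> \<one>\<^bsub>S\<^esub> = [p] \<cdot>\<^bsub>S\<^esub> U"
    unfolding \<eta>_def
    by (simp add: a_minus_def S.A.a_comm[of "\<one>\<^bsub>S\<^esub>" "[p] \<cdot>\<^bsub>S\<^esub> U"] S.A.a_assoc S.A.r_neg)
  then show ?thesis unfolding S.p_ideal_iff S.A.add_pow_eq_smult[OF U_closed] of_int_nat by auto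
qed

lemma ord_eta: "group.ord (units_of (quot_algebra p S)) (reduce p S \<eta>) = 1"
proof -
  interpret G: group "units_of (quot_algebra p S)" by (rule S.Q.units_group)
  have \<eta>: "\<eta> \<in> carrier S" by (simp add: \<eta>_eq)
  have "reduce p S \<eta> = reduce p S \<one>\<^bsub>S\<^esub>"
    using eta_minus_one S.reduce_eq_iff[OF \<eta> S.A.one_closed] by (simp add: S.p_ideal_iff)
  then have "reduce p S \<eta> = \<one>\<^bsub>units_of (quot_algebra p S)\<^esub>" by (simp add: units_of_one)
  then show ?thesis by simp
qed

lemma datum: "trace_datum p d S \<eta> 1 U y 0 y (alg_trace (Zp p) S y)"
proof
  show "prime p" by (rule prime_p)
  show "d + 1 < p" by (rule p_gt)
  show "finite_etale (Zp p) S d" by (rule Zp.split_finite_etale)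
  show "\<eta> \<in> Units S" unfolding \<eta>_eq
  proof (rule int_vec_unit)
    show "\<not> int p dvd 1 + int p * int (Suc j)" for j
      using p_gt by (metis dvd_add_left_iff dvd_triv_left int_one_le_iff_zero_less int_dvd_int_iff nat_dvd_1_iff_1 not_add_less2 of_nat_1 One_nat_def)
  qed
  show "1 = group.ord (units_of (quot_algebra p S)) (reduce p S \<eta>)" using ord_eta by simp
  show "U \<in> carrier S" by simp
  show "\<eta> [^]\<^bsub>S\<^esub> (1::nat) = \<one>\<^bsub>S\<^esub> \<oplus>\<^bsub>S\<^esub> [p] \<cdot>\<^bsub>S\<^esub> U" unfolding \<eta>_def by simp
  show "is_basis (Fp p) (quot_algebra p S) d (\<lambda>i. reduce p S U [^]\<^bsub>quot_algebra p S\<^esub> i)" by (rule power_basis)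
  have "U \<in> Units S" unfolding U_def by (intro int_vec_unit not_dvd_small) auto
  then obtain V where V: "V \<in> carrier S" "V \<otimes>\<^bsub>S\<^esub> U = \<one>\<^bsub>S\<^esub>" by (auto simp: Units_def)
  then have "reduce p S V \<otimes>\<^bsub>quot_algebra p S\<^esub> reduce p S U = \<one>\<^bsub>quot_algebra p S\<^esub>"
    using S.red.hom_mult[OF V(1) U_closed] by (simp del: S.red.hom_mult)
  then show "reduce p S U \<in> Units (quot_algebra p S)"
    using V(1) by (intro S.Q.Units_of_left_inverse[of _ "reduce p S V"]) auto
  show "y \<in> carrier S" by simp
  show "y = y \<otimes>\<^bsub>S\<^esub> \<eta> [^]\<^bsub>S\<^esub> (0::int)" by simp
  show "alg_trace (Zp p) S y \<in> carrier (Zp p)" by simp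
  have "y 0 1 \<noteq> 0"
    using d_pos not_dvd_small[of d] by (simp add: y_def int_vec_nth nth_of_int mod_eq_0_iff_dvd)
  then show "reduce p S y \<noteq> \<zero>\<^bsub>quot_algebra p S\<^esub>"
    using reduce_split_zero_iff[OF y_closed] d_pos by auto
  show "alg_trace (Fp p) (quot_algebra p S) (reduce p S y) = reduce p (Zp p) (alg_trace (Zp p) S y)"
    by (rule S.reduce_trace) simp
qed

lemma trace_coeff_zero:
  assumes "m < d"
  shows "trace_coeff p S U y (alg_trace (Zp p) S y) m = \<zero>\<^bsub>Zp p\<^esub>"
proof (cases "m = 0")
  case True
  then show ?thesis by (simp add: trace_coeff_def a_minus_def Zp.r_neg)
next
  case False
  have "0 = (\<Sum>k\<le>d. (-1) ^ k * int (d choose k) * int k ^ m)" using alternating_power_sum[OF assms] by simp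
  \<comment> \<open>The summand k = 0 is dropped: 0^m = 0, as m is not 0 in this case.\<close>
  also have "\<dots> = (\<Sum>j<d. (-1) ^ Suc j * int (d choose Suc j) * int (Suc j) ^ m)"
    using False by (simp add: sum.atMost_shift)
  also have "\<dots> = - (\<Sum>j<d. (-1) ^ j * int (d choose Suc j) * int (Suc j) ^ m)"
    by (simp add: sum_negf)
  finally have "(\<Sum>j<d. (-1) ^ j * int (d choose Suc j) * int (Suc j) ^ m) = 0" by simp
  then show ?thesis
    using False by (simp add: trace_coeff_def U_def y_def int_vec_pow int_vec_mult trace_int_vec of_int_0)
qed

end

text \<open>Etaleness supplies a basis b of A and, together with the conditions on U and y modulo p,
  the unit among the C_m.\<close>

lemma trace_datum_expansion:
  assumes "trace_datum p d A \<eta> P U \<gamma> a y c"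
  obtains b where "trace_expansion p A d b U y c"
proof -
  interpret trace_datum p d A \<eta> P U \<gamma> a y c by fact
  obtain b where b: "is_basis (Zp p) A d b" using etale by (auto simp: finite_etale_def)
  have alg: "algebra (Zp p) A" using etale by (simp add: finite_etale_def)
  interpret F: free_padic_algebra p A d b
    by (intro free_padic_algebra.intro padic_algebra.intro padic_integers.intro
        free_padic_algebra_axioms.intro prime_p alg b)
  \<comment> \<open>The exponent a may be negative; its power then lies in A because it is the
    inverse of a unit.\<close>
  have "\<eta> [^]\<^bsub>A\<^esub> (k::nat) \<in> Units A" for k
    using unit_eta by (rule F.A.Units_pow_closed)
  then have "\<eta> [^]\<^bsub>A\<^esub> a \<in> carrier A"
    unfolding int_pow_def2 by (metis F.A.Units_closed F.A.Units_inv_closed)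
  then have y: "y \<in> carrier A" using gamma_closed y_eq by simp
  have "\<exists>m\<in>{1..d}. F.Tr (y \<otimes>\<^bsub>A\<^esub> U [^]\<^bsub>A\<^esub> m) 1 \<noteq> 0"
    by (rule F.ex_trace_coeff_unit[OF etale U_closed y basis unit_omega x_nonzero])
  then have "trace_expansion p A d b U y c"
    using U_closed y c_closed p_gt by unfold_locales auto
  then show ?thesis by (rule that)
qed

theorem theoremA3:
  shows "(\<forall>p d (A :: (padic, 'a) module) \<eta> P U \<gamma> a y c F s.
      trace_datum p d A \<eta> P U \<gamma> a y c \<longrightarrow>
      F = trace_series p A U y c \<longrightarrow>
      s = min_valuation p d (trace_coeff p A U y c) \<longrightarrow>
        s \<le> enat d \<and>
        (\<exists>G\<in>carrier (tate p).
           F = ([(p ^ the_enat s)] \<cdot>\<^bsub>Zp p\<^esub> \<one>\<^bsub>Zp p\<^esub>) \<odot>\<^bsub>tate p\<^esub> G \<and>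
           reduce_series p G \<in> carrier (UP (Fp p)) - {\<zero>\<^bsub>UP (Fp p)\<^esub>} \<and>
           deg (Fp p) (reduce_series p G) \<le> d) \<and>
        (\<exists>W. weierstrass_factor p F W \<and> deg (Zp p) W \<le> d \<and>
           finite (tate_zeros p F) \<and> zero_count p F W \<le> d))
    \<and>
    (\<forall>p d. prime p \<and> d \<ge> 1 \<and> p > d + 1 \<longrightarrow>
      (\<exists>\<eta> P U \<gamma> a y c F W.
        trace_datum p d (split_algebra (Zp p) d) \<eta> P U \<gamma> a y c \<and>
        \<eta> \<ominus>\<^bsub>split_algebra (Zp p) d\<^esub> \<one>\<^bsub>split_algebra (Zp p) d\<^esub> \<in> p_ideal p (split_algebra (Zp p) d) \<and>
        F = trace_series p (split_algebra (Zp p) d) U y c \<and>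
        weierstrass_factor p F W \<and> deg (Zp p) W = d \<and>
        finite (tate_zeros p F) \<and> zero_count p F W = d))"
proof (intro conjI allI impI, goal_cases)
  case (1 p d A \<eta> P U \<gamma> a y c F s)
  obtain b where "trace_expansion p A d b U y c" using trace_datum_expansion[OF 1(1)] .
  then interpret T: trace_expansion p A d b U y c .
  show ?case using 1(3) T.min_valuation_eq T.s_le by simp
next
  case (2 p d A \<eta> P U \<gamma> a y c F s)
  obtain b where "trace_expansion p A d b U y c" using trace_datum_expansion[OF 2(1)] .
  then interpret T: trace_expansion p A d b U y c .
  have "the_enat s = T.s" using 2(3) T.min_valuation_eq by simp
  then show ?case unfolding 2(2)
    using T.trace_series_reduction T.coherent_G by (intro bexI[of _ "T.tate_of T.G"]) simp_all
next
  case (3 p d A \<eta> P U \<gamma> a y c F s)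
  obtain b where "trace_expansion p A d b U y c" using trace_datum_expansion[OF 3(1)] .
  then interpret T: trace_expansion p A d b U y c .
  obtain W where "weierstrass_factor p F W" "deg (Zp p) W \<le> d" "finite (tate_zeros p F)"
    "zero_count p F W \<le> deg (Zp p) W"
    using T.trace_series_weierstrass unfolding 3(2) by blast
  then show ?case by (intro exI[of _ W]) simp
next
  case (4 p d)
  then interpret E: sharp_example p d by unfold_locales auto
  define c where "c = alg_trace (Zp p) E.S E.y"
  define F where "F = trace_series p E.S E.U E.y c"
  have datum: "trace_datum p d E.S E.\<eta> 1 E.U E.y 0 E.y c" unfolding c_def by (rule E.datum)
  obtain b where "trace_expansion p E.S d b E.U E.y c" using trace_datum_expansion[OF datum] .
  then interpret T: trace_expansion p E.S d b E.U E.y c .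
  obtain W where W: "weierstrass_factor p F W" "deg (Zp p) W \<le> d" "finite (tate_zeros p F)"
    "zero_count p F W \<le> deg (Zp p) W" "card (tate_zeros p F) \<le> zero_count p F W"
    using T.trace_series_weierstrass unfolding F_def by blast
  have "(\<lambda>j. padic_of_int p (int j)) ` {..<d} \<subseteq> tate_zeros p F"
    using T.tate_eval_of_nat E.trace_coeff_zero by (auto simp: tate_zeros_def F_def c_def)
  then have "card ((\<lambda>j. padic_of_int p (int j)) ` {..<d}) \<le> card (tate_zeros p F)"
    using W(3) by (intro card_mono)
  moreover have "inj_on (\<lambda>j. padic_of_int p (int j)) {..<d}"
  proof (rule inj_onI)
    fix i j assume ij: "i \<in> {..<d}" "j \<in> {..<d}" "padic_of_int p (int i) = padic_of_int p (int j)"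
    \<comment> \<open>Entry 1 already separates the candidates, since i, j < d < p.\<close>
    have "int i mod int p = int j mod int p" using fun_cong[OF ij(3), of 1] by (simp add: E.nth_of_int)
    then show "i = j" using ij 4 by simp
  qed
  ultimately have "d \<le> card (tate_zeros p F)" by (simp add: card_image)
  \<comment> \<open>All inequalities collapse: d <= number of zeros <= \<open>zero_count\<close> <=
    degree of W <= d.\<close>
  then have "deg (Zp p) W = d" "zero_count p F W = d" using W by auto
  then show ?case using datum E.eta_minus_one W F_def by blast
qed

end
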